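(* Let $\gamma>0$, $\omega>0$, $n\ge 1$, and let $\tau_1,\dots,\tau_n>0$. Assume that $f:\mathbb{R}^n\to\mathbb{R}$ is locally Lipschitz continuous, that $g:\mathbb{R}\times[0,1]\to\mathbb{R}$ is Hölder continuous, and that $g(t,x)$ is $\omega$-periodic in $t$. Suppose that there exist positive constants $\beta_1,\dots,\beta_n$ such that $$|f(\xi_1,\dots,\xi_n)-f(\eta_1,\dots,\eta_n)|\le \sum_{k=1}^n\beta_k|\xi_k-\eta_k|\qquad\text{for all }(\xi_1,\dots,\xi_n),(\eta_1,\dots,\eta_n)\in\mathbb{R}^n,$$ and $$\sum_{k=1}^n\beta_k\,e^{(\gamma\pi^4+\pi^2-1)\tau_k}<\gamma\pi^4+\pi^2-1.$$ Then the delayed extended Fisher-Kolmogorov problem $$\begin{cases}\dfrac{\partial}{\partial t}u(t,x)+\gamma\dfrac{\partial^4}{\partial x^4}u(t,x)-\dfrac{\partial^2}{\partial x^2}u(t,x)-u(t,x)=g(t,x)+f(u(t-\tau_1,x),\dots,u(t-\tau_n,x)) & \text{in }\mathbb{R}\times(0,1),\\[4pt] u(t,0)=u(t,1)=0,\quad u_{xx}(t,0)=u_{xx}(t,1)=0, & t\in\mathbb{R},\end{cases}$$ has a unique time $\omega$-periodic classical solution $\bar u\in C^{1,2}(\mathbb{R}\times[0,1])$, and $\bar u$ is globally asymptotically stable.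
   Context: $C^{1,2}(\mathbb{R}\times[0,1])$ denotes the functions $u(t,x)$ that are continuously differentiable once in $t$ and twice in $x$ on $\mathbb{R}\times[0,1]$; similarly for $\mathbb{R}_+=[0,\infty)$ in place of $\mathbb{R}$. A classical solution is a function for which all derivatives appearing in the equation exist and which satisfies the equation and the boundary conditions pointwise. Time $\omega$-periodic means $u(t+\omega,x)=u(t,x)$ for all $t,x$. Put $r=\max\{\tau_1,\dots,\tau_n\}$ and let $\|\cdot\|_2$ be the norm of $L^2([0,1],\mathbb{R})$. For an initial history $\kappa\in C([-r,0]\times(0,1),\mathbb{R})$, regarded as an element $t\mapsto\kappa(t,\cdot)$ of $C([-r,0],L^2([0,1],\mathbb{R}))$, let $u_\kappa$ denote a classical solution in $C^{1,2}(\mathbb{R}_+\times[0,1])$, with $t\mapsto u_\kappa(t,\cdot)$ in $C([-r,\infty),L^2([0,1],\mathbb{R}))$, of the initial value problem consisting of the same differential equation in $\mathbb{R}_+\times(0,1)$, the same boundary conditions for $t\in\mathbb{R}_+$, and $u(t,x)=\kappa(t,x)$ for $t\in[-r,0]$, $x\in(0,1)$. Global asymptotic stability of $\bar u$ is understood in the $L^2$ sense: (i) for every $\varepsilon>0$ there is $\delta>0$ such that $\max_{t\in[-r,0]}\|\bar u(t,\cdot)-\kappa(t,\cdot)\|_2<\delta$ implies $\|\bar u(t,\cdot)-u_\kappa(t,\cdot)\|_2<\varepsilon$ for all $t\ge0$; and (ii) for every such $\kappa$, $\|\bar u(t,\cdot)-u_\kappa(t,\cdot)\|_2\to0$ as $t\to+\infty$.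 *)

theory Defs
  imports "HOL-Analysis.Analysis"
begin

text \<open>
  A function of time and space is a curried \<open>u :: real \<Rightarrow> real \<Rightarrow> real\<close>, with \<open>u t x\<close> relevant for
  \<open>x \<in> [0,1]\<close> only; values for other \<open>x\<close> are never constrained.  The \<open>n \<ge> 1\<close> delays are indexed by a
  finite type \<open>'n\<close>, so that \<open>f :: real ^ 'n \<Rightarrow> real\<close>.
\<close>

definition locally_lipschitz :: "('a::metric_space \<Rightarrow> 'b::metric_space) \<Rightarrow> bool" where
  "locally_lipschitz f \<longleftrightarrow> (\<forall>\<xi>. \<exists>e>0. \<exists>L. L-lipschitz_on (cball \<xi> e) f)"

definition hoelder_continuous_on :: "'a::metric_space set \<Rightarrow> ('a \<Rightarrow> 'b::metric_space) \<Rightarrow> bool" where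
  "hoelder_continuous_on S f \<longleftrightarrow>
     (\<exists>\<alpha> C. 0 < \<alpha> \<and> \<alpha> \<le> 1 \<and> (\<forall>p\<in>S. \<forall>q\<in>S. dist (f p) (f q) \<le> C * dist p q powr \<alpha>))"

definition time_periodic :: "real \<Rightarrow> (real \<Rightarrow> real \<Rightarrow> real) \<Rightarrow> bool" where
  "time_periodic \<omega> u \<longleftrightarrow> (\<forall>t. \<forall>x\<in>{0..1}. u (t + \<omega>) x = u t x)"

text \<open>
  Derivatives are taken within the domain, hence one-sided at \<open>x = 0\<close>, at \<open>x = 1\<close>, and at \<open>t = 0\<close> when
  the time domain is \<open>T = [0,\<infinity>)\<close>.  Higher spatial derivatives are iterates \<open>(Dx ^^ k) (u t)\<close>; their
  existence is always required separately.
\<close>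

definition Dt :: "real set \<Rightarrow> (real \<Rightarrow> real \<Rightarrow> real) \<Rightarrow> real \<Rightarrow> real \<Rightarrow> real" where
  "Dt T u t x = vector_derivative (\<lambda>s. u s x) (at t within T)"

definition Dx :: "(real \<Rightarrow> real) \<Rightarrow> real \<Rightarrow> real" where
  "Dx v x = vector_derivative v (at x within {0..1})"

definition C12 :: "real set \<Rightarrow> (real \<Rightarrow> real \<Rightarrow> real) \<Rightarrow> bool" where
  "C12 T u \<longleftrightarrow>
     (\<forall>t\<in>T. \<forall>x\<in>{0..1}.
        (\<lambda>s. u s x) differentiable (at t within T) \<and>
        u t differentiable (at x within {0..1}) \<and>
        Dx (u t) differentiable (at x within {0..1})) \<and>
     continuous_on (T \<times> {0..1}) (\<lambda>(t, x). u t x) \<and>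
     continuous_on (T \<times> {0..1}) (\<lambda>(t, x). Dt T u t x) \<and>
     continuous_on (T \<times> {0..1}) (\<lambda>(t, x). Dx (u t) x) \<and>
     continuous_on (T \<times> {0..1}) (\<lambda>(t, x). (Dx ^^ 2) (u t) x)"

text \<open>
  Classical solutions in \<open>C\<^sup>1\<^sup>,\<^sup>2\<close> of the delayed extended Fisher-Kolmogorov equation with its boundary
  conditions, on the time domain \<open>T\<close>: the whole line, or \<open>[0,\<infinity>)\<close> for the initial value problem,
  where \<open>u\<close> at negative times supplies the history.
\<close>

definition efk_classical_solution ::
  "real set \<Rightarrow> real \<Rightarrow> ('n::finite \<Rightarrow> real) \<Rightarrow> (real ^ 'n \<Rightarrow> real) \<Rightarrow> (real \<Rightarrow> real \<Rightarrow> real)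
    \<Rightarrow> (real \<Rightarrow> real \<Rightarrow> real) \<Rightarrow> bool" where
  "efk_classical_solution T \<gamma> \<tau> f g u \<longleftrightarrow>
     C12 T u \<and>
     (\<forall>t\<in>T. \<forall>x\<in>{0<..<1}.
        (Dx ^^ 2) (u t) differentiable (at x) \<and>
        (Dx ^^ 3) (u t) differentiable (at x) \<and>
        Dt T u t x + \<gamma> * (Dx ^^ 4) (u t) x - (Dx ^^ 2) (u t) x - u t x
          = g t x + f (\<chi> k. u (t - \<tau> k) x)) \<and>
     (\<forall>t\<in>T. u t 0 = 0 \<and> u t 1 = 0 \<and> (Dx ^^ 2) (u t) 0 = 0 \<and> (Dx ^^ 2) (u t) 1 = 0)"

definition square_integrable :: "(real \<Rightarrow> real) \<Rightarrow> bool" where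
  "square_integrable v \<longleftrightarrow>
     v \<in> borel_measurable (lebesgue_on {0..1}) \<and> integrable (lebesgue_on {0..1}) (\<lambda>x. (v x)\<^sup>2)"

definition L2_norm :: "(real \<Rightarrow> real) \<Rightarrow> real" where
  "L2_norm v = sqrt (\<integral>x. (v x)\<^sup>2 \<partial>(lebesgue_on {0..1}))"

text \<open>\<open>t \<mapsto> u t\<close> is an element of \<open>C(I, L\<^sup>2([0,1]))\<close>.\<close>

definition continuous_into_L2 :: "real set \<Rightarrow> (real \<Rightarrow> real \<Rightarrow> real) \<Rightarrow> bool" where
  "continuous_into_L2 I u \<longleftrightarrow>
     (\<forall>t\<in>I. square_integrable (u t)) \<and>
     (\<forall>t\<in>I. ((\<lambda>s. L2_norm (\<lambda>x. u s x - u t x)) \<longlongrightarrow> 0) (at t within I))"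

definition max_delay :: "('n::finite \<Rightarrow> real) \<Rightarrow> real" where
  "max_delay \<tau> = Max (range \<tau>)"

definition initial_history :: "real \<Rightarrow> (real \<Rightarrow> real \<Rightarrow> real) \<Rightarrow> bool" where
  "initial_history r \<kappa> \<longleftrightarrow>
     continuous_on ({-r..0} \<times> {0<..<1}) (\<lambda>(t, x). \<kappa> t x) \<and> continuous_into_L2 {-r..0} \<kappa>"

definition efk_ivp_solution ::
  "real \<Rightarrow> ('n::finite \<Rightarrow> real) \<Rightarrow> (real ^ 'n \<Rightarrow> real) \<Rightarrow> (real \<Rightarrow> real \<Rightarrow> real)
    \<Rightarrow> (real \<Rightarrow> real \<Rightarrow> real) \<Rightarrow> (real \<Rightarrow> real \<Rightarrow> real) \<Rightarrow> bool" where
  "efk_ivp_solution \<gamma> \<tau> f g \<kappa> u \<longleftrightarrow>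
     efk_classical_solution {0..} \<gamma> \<tau> f g u \<and>
     continuous_into_L2 {- max_delay \<tau>..} u \<and>
     (\<forall>t\<in>{- max_delay \<tau>..0}. \<forall>x\<in>{0<..<1}. u t x = \<kappa> t x)"

text \<open>
  The supremum below is the maximum in the usual definition, the \<open>L\<^sup>2\<close> distance being
  continuous on the compact interval \<open>[-r,0]\<close>.  Both clauses concern all histories that admit a
  classical solution, and all such solutions.  Not every history does, since a solution that is
  \<open>C\<^sup>1\<^sup>,\<^sup>2\<close> up to \<open>t = 0\<close> forces \<open>\<kappa> 0\<close> to be twice continuously differentiable.
\<close>

definition globally_asymptotically_stable ::
  "real \<Rightarrow> ('n::finite \<Rightarrow> real) \<Rightarrow> (real ^ 'n \<Rightarrow> real) \<Rightarrow> (real \<Rightarrow> real \<Rightarrow> real)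
    \<Rightarrow> (real \<Rightarrow> real \<Rightarrow> real) \<Rightarrow> bool" where
  "globally_asymptotically_stable \<gamma> \<tau> f g ubar \<longleftrightarrow>
     (\<forall>\<epsilon>>0. \<exists>\<delta>>0. \<forall>\<kappa> u.
        initial_history (max_delay \<tau>) \<kappa> \<longrightarrow> efk_ivp_solution \<gamma> \<tau> f g \<kappa> u \<longrightarrow>
        (SUP t\<in>{- max_delay \<tau>..0}. L2_norm (\<lambda>x. ubar t x - \<kappa> t x)) < \<delta> \<longrightarrow>
        (\<forall>t\<ge>0. L2_norm (\<lambda>x. ubar t x - u t x) < \<epsilon>)) \<and>
     (\<forall>\<kappa> u.
        initial_history (max_delay \<tau>) \<kappa> \<longrightarrow> efk_ivp_solution \<gamma> \<tau> f g \<kappa> u \<longrightarrow>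
        ((\<lambda>t. L2_norm (\<lambda>x. ubar t x - u t x)) \<longlongrightarrow> 0) at_top)"

end

theory Submission
  imports Defs
begin

text \<open>
  Write the equation as \<open>u\<^sub>t + A u = g + f (u (t - \<tau>\<^sub>1), \<dots>, u (t - \<tau>\<^sub>n))\<close> with \<open>A = \<gamma> \<partial>\<^sup>4 - \<partial>\<^sup>2 - 1\<close>.  The boundary
  conditions make the functions \<open>sin (k \<pi> x)\<close> eigenfunctions of \<open>A\<close>, and the smallest eigenvalue is
  \<open>\<lambda> = \<gamma> \<pi>\<^sup>4 + \<pi>\<^sup>2 - 1\<close>.  The smallness hypothesis implies \<open>\<Sum>\<beta>\<^sub>k < \<lambda>\<close>: dissipation dominates the delayed
  reaction, and this drives all parts of the proof.

  Stability and uniqueness.  The squared \<open>L\<^sup>2\<close> distance \<open>E\<close> of two solutions satisfies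
  \<open>E' \<le> - (2 \<lambda> - \<Sum>\<beta>\<^sub>k) E + \<Sum>\<beta>\<^sub>k E (t - \<tau>\<^sub>k)\<close> (\<open>energy_inequality\<close>).  It follows by integration by parts and
  Wirtinger's inequality (\<open>energy_dissipation\<close>).  Since \<open>\<Sum>\<beta>\<^sub>k < \<lambda>\<close>, the Halanay inequality
  (\<open>halanay_inequality\<close>) yields exponential decay.  This is global asymptotic stability, and it leaves no room
  for two periodic solutions.

  Existence.  For a periodic forcing \<open>F\<close> each sine coefficient of a solution of \<open>u\<^sub>t + A u = F\<close> solves a scalar linear
  equation with a unique periodic solution.  Summing up gives a solution operator \<open>sol\<close>, which has norm
  \<open>1 / \<lambda>\<close> on \<open>L\<^sup>2\<close> uniformly in time and maps \<open>L\<^sup>2\<close> into bounded functions.  Hence the iteration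
  \<open>u \<mapsto> sol (g + f (u (t - \<tau>\<^sub>1), \<dots>))\<close> converges uniformly (\<open>sol_fixed_point\<close>).

  Regularity.  The fixed point \<open>u\<close> is \<open>1/2\<close>-Hoelder continuous in time, so its forcing \<open>F\<close> is Hoelder continuous with some
  exponent \<open>\<alpha> > 0\<close>.  The series of \<open>u\<close> can be differentiated twice in \<open>x\<close>, but for small \<open>\<alpha>\<close> the series of \<open>u\<^sub>t\<close> does not
  converge absolutely.  Instead, \<open>exp (- \<epsilon> A) u\<^sub>t\<close> is shown to converge uniformly as \<open>\<epsilon>\<close> tends to \<open>0\<close>
  (\<open>smooth_dt_Cauchy\<close>).  The key is the bound of order \<open>t\<^sup>-\<^sup>2\<close> for \<open>A\<^sup>2 exp (- t A)\<close> in the supremum norm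
  (\<open>heat2_multiplier_bound\<close>), obtained from an \<open>L\<^sup>1\<close> bound of the kernel by summation by parts.  Finally,
  completeness of the sine system shows that \<open>\<gamma> u\<^sub>x\<^sub>x\<close> has the second derivative that the equation demands
  (\<open>second_derivative_from_sine_coefs\<close>).
\<close>

section \<open>The sine system on the unit interval\<close>

abbreviation freq :: "nat \<Rightarrow> real" where
  "freq k \<equiv> real (Suc k) * pi"

text \<open>
  The energy of the difference of two functions.  For continuous functions the gauge integral used
  here agrees with the Lebesgue integral behind \<^const>\<open>L2_norm\<close>, and it is the more convenient of the
  two for integration by parts.
\<close>

abbreviation L2_dist_sq :: "(real \<Rightarrow> real \<Rightarrow> real) \<Rightarrow> (real \<Rightarrow> real \<Rightarrow> real) \<Rightarrow> real \<Rightarrow> real" where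
  "L2_dist_sq u v t \<equiv> integral {0..1} (\<lambda>x. (u t x - v t x)\<^sup>2)"

definition mode :: "nat \<Rightarrow> real \<Rightarrow> real" where
  "mode k x = sin (freq k * x)"

text \<open>
  The factor 2 makes \<open>sine_coef k h\<close> the coefficient of \<open>mode k\<close> in the sine series of \<open>h\<close>, because
  each mode has square integral \<open>1/2\<close>.
\<close>

definition sine_coef :: "nat \<Rightarrow> (real \<Rightarrow> real) \<Rightarrow> real" where
  "sine_coef k h = 2 * integral {0..1} (\<lambda>x. h x * mode k x)"

lemma continuous_on_mode [continuous_intros]:
  fixes f :: "'a::t2_space \<Rightarrow> real"
  shows "continuous_on S f \<Longrightarrow> continuous_on S (\<lambda>x. mode k (f x))"
  unfolding mode_def by (intro continuous_on_sin continuous_on_mult continuous_on_const) assumption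

lemma abs_mode_le_1: "\<bar>mode k x\<bar> \<le> 1"
  unfolding mode_def by simp

lemma mode_0 [simp]: "mode k 0 = 0"
  by (simp add: mode_def)

lemma mode_1 [simp]: "mode k 1 = 0"
  unfolding mode_def by (metis mult.right_neutral sin_npi)

lemma has_integral_cos_int:
  "((\<lambda>x. cos (of_int n * pi * x)) has_integral (if n = 0 then 1 else 0)) {0..1::real}"
proof (cases "n = 0")
  case True
  then show ?thesis using has_integral_const_real[of "1::real" 0 1] by simp
next
  case False
  have "((\<lambda>x. cos (of_int n * pi * x)) has_integral
      (sin (of_int n * pi * 1) / (of_int n * pi) - sin (of_int n * pi * 0) / (of_int n * pi))) {0..1::real}"
  proof (rule fundamental_theorem_of_calculus)
    show "(0::real) \<le> 1" by simp
    fix x :: real assume "x \<in> {0..1}"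
    show "((\<lambda>x. sin (of_int n * pi * x) / (of_int n * pi)) has_vector_derivative cos (of_int n * pi * x)) (at x within {0..1})"
      unfolding has_real_derivative_iff_has_vector_derivative [symmetric]
      using False by (auto intro!: derivative_eq_intros)
  qed
  moreover have "sin (of_int n * pi * 1) = 0"
    by (metis mult.right_neutral sin_zero_iff_int2)
  ultimately show ?thesis using False by simp
qed

lemma has_integral_mode_mode:
  "((\<lambda>x. mode j x * mode k x) has_integral (if j = k then 1/2 else 0)) {0..1}"
proof -
  have "mode j x * mode k x = 1/2 * cos (of_int (int j - int k) * pi * x) - 1/2 * cos (of_int (int j + int k + 2) * pi * x)" for x
    unfolding mode_def sin_times_sin by (simp add: algebra_simps diff_divide_distrib)
  moreover have "((\<lambda>x. 1/2 * cos (of_int (int j - int k) * pi * x) - 1/2 * cos (of_int (int j + int k + 2) * pi * x)) has_integral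
      1/2 * (if int j - int k = 0 then 1 else 0) - 1/2 * (if int j + int k + 2 = 0 then 1 else 0)) {0..1}"
    by (intro has_integral_diff has_integral_mult_right has_integral_cos_int)
  ultimately show ?thesis by (cases "j = k") auto
qed

lemma has_integral_cosine_cosine:
  "((\<lambda>x. cos (freq j * x) * cos (freq k * x)) has_integral (if j = k then 1/2 else 0)) {0..1}"
proof -
  have "cos (freq j * x) * cos (freq k * x) = 1/2 * cos (of_int (int j - int k) * pi * x) + 1/2 * cos (of_int (int j + int k + 2) * pi * x)" for x
    unfolding cos_times_cos by (simp add: algebra_simps add_divide_distrib)
  moreover have "((\<lambda>x. 1/2 * cos (of_int (int j - int k) * pi * x) + 1/2 * cos (of_int (int j + int k + 2) * pi * x)) has_integral
      1/2 * (if int j - int k = 0 then 1 else 0) + 1/2 * (if int j + int k + 2 = 0 then 1 else 0)) {0..1}"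
    by (intro has_integral_add has_integral_mult_right has_integral_cos_int)
  ultimately show ?thesis by (cases "j = k") auto
qed

text \<open>
  The half-integer sines appear when a cosine polynomial is multiplied by \<open>2 sin (\<pi> z / 2)\<close>: the product
  telescopes into a half-integer sine polynomial whose coefficients are differences of the original
  ones.
\<close>

lemma has_integral_half_mode:
  "((\<lambda>x. sin ((real j + 1/2) * pi * x) * sin ((real k + 1/2) * pi * x)) has_integral (if j = k then 1/2 else 0)) {0..1}"
proof -
  have "sin ((real j + 1/2) * pi * x) * sin ((real k + 1/2) * pi * x) = 1/2 * cos (of_int (int j - int k) * pi * x) - 1/2 * cos (of_int (int j + int k + 1) * pi * x)" for x
    unfolding sin_times_sin by (simp add: algebra_simps diff_divide_distrib)
  moreover have "((\<lambda>x. 1/2 * cos (of_int (int j - int k) * pi * x) - 1/2 * cos (of_int (int j + int k + 1) * pi * x)) has_integral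
      1/2 * (if int j - int k = 0 then 1 else 0) - 1/2 * (if int j + int k + 1 = 0 then 1 else 0)) {0..1}"
    by (intro has_integral_diff has_integral_mult_right has_integral_cos_int)
  ultimately show ?thesis by (cases "j = k") auto
qed

lemma has_integral_orthogonal_sum_square:
  fixes e :: "nat \<Rightarrow> real \<Rightarrow> real"
  assumes "\<And>j k. ((\<lambda>x. e j x * e k x) has_integral (if j = k then 1/2 else 0)) {0..1}"
  shows "((\<lambda>x. (\<Sum>k<N. a k * e k x)\<^sup>2) has_integral (\<Sum>k<N. (a k)\<^sup>2) / 2) {0..1}"
proof -
  have eq: "(\<Sum>k<N. a k * e k x)\<^sup>2 = (\<Sum>j<N. \<Sum>k<N. (a j * a k) * (e j x * e k x))" for x
    by (simp add: power2_eq_square sum_product algebra_simps)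
  have "((\<lambda>x. \<Sum>j<N. \<Sum>k<N. (a j * a k) * (e j x * e k x)) has_integral
      (\<Sum>j<N. \<Sum>k<N. (a j * a k) * (if j = k then 1/2 else 0))) {0..1}"
    by (intro has_integral_sum has_integral_mult_right assms) auto
  moreover have "(\<Sum>j<N. \<Sum>k<N. (a j * a k) * (if j = k then 1/2 else 0)) = (\<Sum>k<N. (a k)\<^sup>2) / 2"
    by (simp add: power2_eq_square sum_divide_distrib if_distrib[of "\<lambda>z. _ * z"] cong: if_cong)
  ultimately show ?thesis unfolding eq by simp
qed

lemma has_integral_sine_coef:
  assumes "continuous_on {0..1} h"
  shows "((\<lambda>x. h x * mode k x) has_integral sine_coef k h / 2) {0..1}"
  unfolding sine_coef_def
  by (simp, intro integrable_integral integrable_continuous_real continuous_intros assms)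

lemma bessel_inequality:
  assumes "continuous_on {0..1} h"
  shows "(\<Sum>k<N. (sine_coef k h)\<^sup>2) / 2 \<le> integral {0..1} (\<lambda>x. (h x)\<^sup>2)"
proof -
  let ?c = "\<lambda>k. sine_coef k h"
  let ?p = "\<lambda>x. \<Sum>k<N. ?c k * mode k x"
  have ih: "((\<lambda>x. (h x)\<^sup>2) has_integral integral {0..1} (\<lambda>x. (h x)\<^sup>2)) {0..1}"
    by (intro integrable_integral integrable_continuous_real continuous_intros assms)
  note ik = has_integral_sine_coef[OF assms]
  have "((\<lambda>x. \<Sum>k<N. ?c k * (h x * mode k x)) has_integral (\<Sum>k<N. ?c k * (?c k / 2))) {0..1}"
    by (intro has_integral_sum has_integral_mult_right ik) auto
  then have "((\<lambda>x. (h x)\<^sup>2 - 2 * (\<Sum>k<N. ?c k * (h x * mode k x)) + (?p x)\<^sup>2) has_integral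
    integral {0..1} (\<lambda>x. (h x)\<^sup>2) - 2 * (\<Sum>k<N. ?c k * (?c k / 2)) + (\<Sum>k<N. (?c k)\<^sup>2) / 2) {0..1}"
    by (intro has_integral_add has_integral_diff has_integral_mult_right ih
        has_integral_orthogonal_sum_square has_integral_mode_mode)
  moreover have "(h x)\<^sup>2 - 2 * (\<Sum>k<N. ?c k * (h x * mode k x)) + (?p x)\<^sup>2 = (h x - ?p x)\<^sup>2" for x
    by (simp add: power2_diff sum_distrib_left algebra_simps)
  ultimately have "((\<lambda>x. (h x - ?p x)\<^sup>2) has_integral
    integral {0..1} (\<lambda>x. (h x)\<^sup>2) - 2 * (\<Sum>k<N. ?c k * (?c k / 2)) + (\<Sum>k<N. (?c k)\<^sup>2) / 2) {0..1}"
    by simp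
  from has_integral_nonneg[OF this]
  have "0 \<le> integral {0..1} (\<lambda>x. (h x)\<^sup>2) - 2 * (\<Sum>k<N. ?c k * (?c k / 2)) + (\<Sum>k<N. (?c k)\<^sup>2) / 2"
    by simp
  moreover have "(\<Sum>k<N. ?c k * (?c k / 2)) = (\<Sum>k<N. (?c k)\<^sup>2) / 2"
    by (simp add: sum_divide_distrib power2_eq_square)
  ultimately show ?thesis by simp
qed

text \<open>
  Multiplication by \<open>cos (\<pi> x)\<close> maps each mode to half the sum of its two neighbours, so orthogonality
  to all modes survives it.
\<close>

lemma integral_mode_times_cos_power:
  assumes h: "continuous_on {0..1} h"
    and 0: "\<And>k. integral {0..1} (\<lambda>x. h x * mode k x) = 0"
  shows "integral {0..1} (\<lambda>x. h x * mode k x * cos (pi * x) ^ m) = 0"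
proof (induction m arbitrary: k)
  case 0
  then show ?case using assms by simp
next
  case (Suc m)
  have int: "(\<lambda>x. h x * mode k x * cos (pi * x) ^ m) integrable_on {0..1}" for k
    by (intro integrable_continuous_real continuous_intros h)
  show ?case
  proof (cases k)
    case 0
    have "mode 0 x * cos (pi * x) = 1/2 * mode 1 x" for x
      unfolding mode_def using sin_double[of "pi * x"] by (simp add: algebra_simps)
    then have "h x * (mode 0 x * cos (pi * x)) * cos (pi * x) ^ m = h x * (1/2 * mode 1 x) * cos (pi * x) ^ m" for x
      by (rule arg_cong)
    then have "(\<lambda>x. h x * mode k x * cos (pi * x) ^ Suc m) = (\<lambda>x. 1/2 * (h x * mode 1 x * cos (pi * x) ^ m))"
      unfolding 0 by (intro ext) (simp add: mult.assoc)
    then show ?thesis using Suc.IH[of 1] by (simp only: integral_mult_right)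
  next
    case (Suc j)
    have "mode (Suc j) x * cos (pi * x) = 1/2 * (mode (Suc (Suc j)) x + mode j x)" for x
      unfolding mode_def sin_times_cos by (simp add: algebra_simps)
    then have "h x * (mode k x * cos (pi * x)) * cos (pi * x) ^ m
        = h x * (1/2 * (mode (Suc (Suc j)) x + mode j x)) * cos (pi * x) ^ m" for x
      unfolding Suc by (simp only:)
    then have "(\<lambda>x. h x * mode k x * cos (pi * x) ^ Suc m)
        = (\<lambda>x. 1/2 * (h x * mode (Suc (Suc j)) x * cos (pi * x) ^ m) + 1/2 * (h x * mode j x * cos (pi * x) ^ m))"
      by (intro ext) (simp add: algebra_simps)
    then show ?thesis using Suc.IH int by (simp add: integral_add)
  qed
qed

text \<open>
  The modes span all functions \<open>sin (\<pi> x) p (cos (\<pi> x))\<close> with \<open>p\<close> a polynomial.  Writing \<open>h x\<close> as a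
  continuous function of \<open>cos (\<pi> x)\<close> and approximating it by polynomials, orthogonality of \<open>h\<close> to the modes
  forces the integral of \<open>h\<^sup>2 sin (\<pi> x)\<close> to vanish.
\<close>

lemma sine_system_complete:
  assumes h: "continuous_on {0..1} h"
    and 0: "\<And>k. integral {0..1} (\<lambda>x. h x * mode k x) = 0"
    and x: "x \<in> {0..1}"
  shows "h x = 0"
proof -
  \<comment> \<open>\<open>h\<close> as a function of \<open>cos (\<pi> x)\<close>.\<close>
  define q where "q y = h (arccos y / pi)" for y
  have q: "continuous_on {-1..1} q"
    unfolding q_def
    by (rule continuous_on_compose2[OF h])
      (auto intro!: continuous_intros simp: arccos_lbound arccos_ubound)
  have qcos: "q (cos (pi * x)) = h x" if "x \<in> {0..1}" for x
    using that unfolding q_def by (subst arccos_cos) auto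
  obtain H where H: "\<And>x. x \<in> {0..1} \<Longrightarrow> \<bar>h x\<bar> \<le> H"
    using compact_imp_bounded[OF compact_continuous_image[OF h compact_Icc]]
    unfolding bounded_iff by (auto simp del: atLeastAtMost_iff)
  have H0: "0 \<le> H" using H[of 0] by simp
  let ?I = "integral {0..1} (\<lambda>x. (h x)\<^sup>2 * mode 0 x)"
  have small: "\<bar>?I\<bar> \<le> e * H" if e: "e > 0" for e
  proof -
    obtain p where p: "real_polynomial_function p" "\<And>y. y \<in> {-1..1} \<Longrightarrow> \<bar>q y - p y\<bar> < e"
      using Stone_Weierstrass_real_polynomial_function[OF compact_Icc q e] by blast
    obtain a n where pa: "p = (\<lambda>x. \<Sum>i\<le>n. a i * x ^ i)"
      using p(1) unfolding real_polynomial_function_iff_sum by blast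
    have "((\<lambda>x. \<Sum>i\<le>n. a i * (h x * mode 0 x * cos (pi * x) ^ i)) has_integral (\<Sum>i\<le>n. a i * 0)) {0..1}"
    proof (intro has_integral_sum has_integral_mult_right)
      fix i
      show "((\<lambda>x. h x * mode 0 x * cos (pi * x) ^ i) has_integral 0) {0..1}"
        by (subst integral_mode_times_cos_power[OF h 0, of 0 i, symmetric])
          (intro integrable_integral integrable_continuous_real continuous_intros h)
    qed simp
    then have 1: "((\<lambda>x. h x * mode 0 x * p (cos (pi * x))) has_integral 0) {0..1}"
      unfolding pa by (simp add: sum_distrib_left algebra_simps)
    have 2: "((\<lambda>x. (h x)\<^sup>2 * mode 0 x) has_integral ?I) {0..1}"
      by (intro integrable_integral integrable_continuous_real continuous_intros h)
    have 3: "((\<lambda>x. (h x)\<^sup>2 * mode 0 x - h x * mode 0 x * p (cos (pi * x))) has_integral ?I - 0) {0..1}"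
      by (intro has_integral_diff 1 2)
    have "norm (?I - 0) \<le> (e * H) * measure lborel (cbox 0 (1::real))"
    proof (rule has_integral_bound[of _ "\<lambda>x. (h x)\<^sup>2 * mode 0 x - h x * mode 0 x * p (cos (pi * x))"])
      show "0 \<le> e * H" using e H0 by simp
      show "((\<lambda>x. (h x)\<^sup>2 * mode 0 x - h x * mode 0 x * p (cos (pi * x))) has_integral ?I - 0) (cbox 0 1)"
        using 3 by simp
      fix x :: real assume "x \<in> cbox 0 1"
      then have x: "x \<in> {0..1}" by simp
      have "(h x)\<^sup>2 * mode 0 x - h x * mode 0 x * p (cos (pi * x)) = (h x - p (cos (pi * x))) * (h x * mode 0 x)"
        by (simp add: algebra_simps power2_eq_square)
      also have "\<bar>\<dots>\<bar> \<le> e * (H * 1)"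
        unfolding abs_mult using p(2)[of "cos (pi * x)"] qcos[OF x] H[OF x] abs_mode_le_1 e
        by (intro mult_mono) auto
      finally show "norm ((h x)\<^sup>2 * mode 0 x - h x * mode 0 x * p (cos (pi * x))) \<le> e * H" by simp
    qed
    then show ?thesis by simp
  qed
  have "?I = 0"
  proof (rule ccontr)
    assume "?I \<noteq> 0"
    then have "\<bar>?I\<bar> > 0" by simp
    then have "\<bar>?I\<bar> \<le> (\<bar>?I\<bar> / (2 * (H + 1))) * H" using H0 by (intro small) auto
    also have "\<dots> < \<bar>?I\<bar>" using H0 \<open>\<bar>?I\<bar> > 0\<close>
      by (simp add: field_simps add_nonneg_pos del: zero_less_abs_iff)
    finally show False by simp
  qed
  moreover have nn: "0 \<le> (h x)\<^sup>2 * mode 0 x" if "x \<in> {0..1}" for x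
    using that unfolding mode_def by (auto intro!: mult_nonneg_nonneg sin_ge_zero simp: mult_left_le)
  ultimately have z: "(h x)\<^sup>2 * mode 0 x = 0" if "x \<in> {0..1}" for x
    using integral_eq_0_iff[of 0 1 "\<lambda>x. (h x)\<^sup>2 * mode 0 x"] that h
    by (force intro!: continuous_intros)
  have in0: "h x = 0" if "x \<in> {0<..<1}" for x
  proof -
    have "mode 0 x > 0" using that unfolding mode_def by (auto intro!: sin_gt_zero)
    then show ?thesis using z[of x] that by auto
  qed
  show ?thesis
  proof (rule continuous_constant_on_closure[of "{0<..<1::real}" h 0])
    show "continuous_on (closure {0<..<1}) h" using h by simp
    show "x \<in> closure {0<..<1}" using x by simp
  qed (use in0 in auto)
qed

lemma continuous_on_suminf:
  fixes f :: "nat \<Rightarrow> 'a::topological_space \<Rightarrow> real"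
  assumes "\<And>k. continuous_on S (f k)" "\<And>k x. x \<in> S \<Longrightarrow> \<bar>f k x\<bar> \<le> M k" "summable M"
  shows "continuous_on S (\<lambda>x. \<Sum>k. f k x)"
proof (rule uniform_limit_theorem)
  show "uniform_limit S (\<lambda>n x. \<Sum>i<n. f i x) (\<lambda>x. \<Sum>k. f k x) sequentially"
    by (rule Weierstrass_m_test) (use assms in auto)
  show "\<forall>\<^sub>F n in sequentially. continuous_on S (\<lambda>x. \<Sum>i<n. f i x)"
    by (intro always_eventually allI continuous_on_sum assms)
qed simp

lemma continuous_on_sine_series:
  fixes c :: "nat \<Rightarrow> 'a::t2_space \<Rightarrow> real"
  assumes "\<And>k. continuous_on S (c k)" "\<And>k p. p \<in> S \<Longrightarrow> \<bar>c k p\<bar> \<le> M k" "summable M"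
    and "continuous_on S X"
  shows "continuous_on S (\<lambda>p. \<Sum>k. c k p * mode k (X p))"
proof (rule continuous_on_suminf)
  show "\<bar>c k p * mode k (X p)\<bar> \<le> M k" if "p \<in> S" for k p
    using mult_mono[OF assms(2)[OF that] abs_mode_le_1[of k "X p"]] abs_ge_zero assms(2)[OF that, of k]
    by (simp add: abs_mult)
qed (use assms in \<open>auto intro!: continuous_intros\<close>)

lemma sine_coef_uniform_limit:
  assumes lim: "uniform_limit {0..1} h h' sequentially"
    and cont: "\<And>n. continuous_on {0..1} (h n)"
  shows "(\<lambda>n. sine_coef k (h n)) \<longlonglongrightarrow> sine_coef k h'"
proof -
  have b: "bounded (mode k ` {0..1})" unfolding bounded_iff using abs_mode_le_1 by auto
  have c: "continuous_on {0..1} h'"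
    by (rule uniform_limit_theorem[OF _ lim]) (use cont in auto)
  then have b': "bounded (h' ` {0..1})" by (simp add: compact_continuous_image compact_imp_bounded)
  have "uniform_limit {0..1} (\<lambda>n x. h n x * mode k x) (\<lambda>x. h' x * mode k x) sequentially"
    by (intro uniform_lim_mult lim uniform_limit_const b b')
  then obtain I J where I: "\<And>n. ((\<lambda>x. h n x * mode k x) has_integral I n) {0..1}"
     and J: "((\<lambda>x. h' x * mode k x) has_integral J) {0..1}" and lim: "I \<longlonglongrightarrow> J"
    by (rule uniform_limit_integral) (auto intro!: continuous_intros cont)
  show ?thesis unfolding sine_coef_def integral_unique[OF I] integral_unique[OF J]
    by (intro tendsto_intros lim)
qed

lemma sine_coef_sum:
  "sine_coef j (\<lambda>x. \<Sum>k<N. c k * mode k x) = (if j < N then c j else 0)"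
proof -
  have "((\<lambda>x. \<Sum>k<N. c k * (mode k x * mode j x)) has_integral (\<Sum>k<N. c k * (if k = j then 1/2 else 0))) {0..1}"
    by (intro has_integral_sum has_integral_mult_right has_integral_mode_mode) auto
  then have "((\<lambda>x. (\<Sum>k<N. c k * mode k x) * mode j x) has_integral (\<Sum>k<N. c k * (if k = j then 1/2 else 0))) {0..1}"
    by (simp add: sum_distrib_right mult.assoc)
  then have "integral {0..1} (\<lambda>x. (\<Sum>k<N. c k * mode k x) * mode j x) = (\<Sum>k<N. c k * (if k = j then 1/2 else 0))"
    by (rule integral_unique)
  then show ?thesis unfolding sine_coef_def by (simp add: if_distrib[of "\<lambda>z. _ * z"] cong: if_cong)
qed

lemma sine_series_uniform_limit:
  assumes "summable (\<lambda>k. \<bar>c k\<bar>)"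
  shows "uniform_limit S (\<lambda>N x. \<Sum>k<N. c k * mode k x) (\<lambda>x. \<Sum>k. c k * mode k x) sequentially"
  by (rule Weierstrass_m_test[OF _ assms]) (use abs_mode_le_1 in \<open>auto simp: abs_mult intro!: mult_left_le\<close>)

lemma sine_coef_series:
  assumes "summable (\<lambda>k. \<bar>c k\<bar>)"
  shows "sine_coef j (\<lambda>x. \<Sum>k. c k * mode k x) = c j"
proof -
  have "(\<lambda>N. sine_coef j (\<lambda>x. \<Sum>k<N. c k * mode k x)) \<longlonglongrightarrow> sine_coef j (\<lambda>x. \<Sum>k. c k * mode k x)"
    by (rule sine_coef_uniform_limit[OF sine_series_uniform_limit[OF assms]]) (auto intro!: continuous_intros)
  moreover have "(\<lambda>N. sine_coef j (\<lambda>x. \<Sum>k<N. c k * mode k x)) \<longlonglongrightarrow> c j"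
    unfolding sine_coef_sum
    by (rule tendsto_eventually, rule eventually_mono[OF eventually_gt_at_top[of j]]) simp
  ultimately show ?thesis using LIMSEQ_unique by blast
qed

text \<open>
  One half of Parseval's identity, from the orthogonality of the modes and the uniform convergence of
  the partial sums.
\<close>

lemma integral_square_sine_series_le:
  assumes c: "summable (\<lambda>k. \<bar>c k\<bar>)"
    and le: "\<And>N. (\<Sum>k<N. (c k)\<^sup>2) \<le> B"
  shows "integral {0..1} (\<lambda>x. (\<Sum>k. c k * mode k x)\<^sup>2) \<le> B / 2"
proof -
  let ?h = "\<lambda>x. \<Sum>k. c k * mode k x"
  have cont: "continuous_on {0..1} ?h"
    by (rule continuous_on_sine_series[where M="\<lambda>k. \<bar>c k\<bar>"]) (use c in \<open>auto intro!: continuous_intros\<close>)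
  then have b: "bounded (?h ` {0..1})" by (simp add: compact_continuous_image compact_imp_bounded)
  have "uniform_limit {0..1} (\<lambda>N x. (\<Sum>k<N. c k * mode k x) * (\<Sum>k<N. c k * mode k x)) (\<lambda>x. ?h x * ?h x) sequentially"
    by (intro uniform_lim_mult sine_series_uniform_limit c b)
  then obtain I J where I: "\<And>N. ((\<lambda>x. (\<Sum>k<N. c k * mode k x) * (\<Sum>k<N. c k * mode k x)) has_integral I N) {0..1}"
     and J: "((\<lambda>x. ?h x * ?h x) has_integral J) {0..1}" and "I \<longlonglongrightarrow> J"
    by (rule uniform_limit_integral) (auto intro!: continuous_intros)
  moreover have "I N \<le> B / 2" for N
  proof -
    have "I N = (\<Sum>k<N. (c k)\<^sup>2) / 2"
      by (rule has_integral_unique[OF I[of N]])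
        (use has_integral_orthogonal_sum_square[OF has_integral_mode_mode, of c N] in \<open>simp add: power2_eq_square\<close>)
    then show ?thesis using le[of N] by simp
  qed
  ultimately have "J \<le> B / 2" by (meson LIMSEQ_le_const2)
  then show ?thesis using J by (simp add: power2_eq_square integral_unique)
qed

section \<open>Eigenvalues and kernel bounds\<close>

text \<open>
  The eigenvalue of \<open>\<gamma> \<partial>\<^sup>4 - \<partial>\<^sup>2 - 1\<close> on \<open>mode k\<close>.  The modes also satisfy the boundary conditions.  The
  index starts at zero, so \<open>eig \<gamma> 0\<close> is the constant \<open>\<gamma> \<pi>\<^sup>4 + \<pi>\<^sup>2 - 1\<close> of the theorem.
\<close>

definition eig :: "real \<Rightarrow> nat \<Rightarrow> real" where
  "eig \<gamma> k = \<gamma> * freq k ^ 4 + (freq k)\<^sup>2 - 1"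

lemma frequency_ge_1: "1 \<le> freq k"
  using pi_ge_two mult_mono[of 1 "real (Suc k)" 1 pi] by simp

lemma eig_lower:
  "\<gamma> * pi ^ 4 * real (Suc k) ^ 4 \<le> eig \<gamma> k"
proof -
  have "1 \<le> (freq k)\<^sup>2" by (rule one_le_power[OF frequency_ge_1])
  then show ?thesis unfolding eig_def by (simp add: power_mult_distrib mult_ac del: of_nat_Suc)
qed

lemma eig_pos: "\<gamma> > 0 \<Longrightarrow> eig \<gamma> k > 0"
  by (rule less_le_trans[OF _ eig_lower]) simp

lemma eig_Suc_less: "\<gamma> > 0 \<Longrightarrow> eig \<gamma> k < eig \<gamma> (Suc k)"
proof -
  assume "\<gamma> > 0"
  have "freq k < real (Suc (Suc k)) * pi" by simp
  then have "freq k ^ 4 < (real (Suc (Suc k)) * pi) ^ 4" "(freq k)\<^sup>2 < (real (Suc (Suc k)) * pi)\<^sup>2"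
    by (auto intro!: power_strict_mono simp del: of_nat_Suc)
  then show ?thesis unfolding eig_def using \<open>\<gamma> > 0\<close>
    by (smt (verit) mult_strict_left_mono)
qed

lemma eig_ge_eig_0: "\<gamma> > 0 \<Longrightarrow> eig \<gamma> 0 \<le> eig \<gamma> k"
  using lift_Suc_mono_le[of "eig \<gamma>" 0 k] eig_Suc_less[of \<gamma>] less_imp_le by blast

lemma eig_Suc_diff:
  assumes "\<gamma> > 0"
  shows "eig \<gamma> (Suc k) - eig \<gamma> k \<le> (15 * \<gamma> * pi ^ 4 + 3 * pi\<^sup>2) * real (Suc k) ^ 3"
proof -
  define m where "m = real (Suc k)"
  have m: "1 \<le> m" by (simp add: m_def)
  have p: "m \<le> m ^ 3" "m\<^sup>2 \<le> m ^ 3" "1 \<le> m ^ 3"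
    using power_increasing[OF _ m, of 1 3] power_increasing[OF _ m, of 2 3] one_le_power[OF m] by auto
  have "eig \<gamma> (Suc k) - eig \<gamma> k = \<gamma> * ((1 + m) * pi) ^ 4 + ((1 + m) * pi)\<^sup>2 - 1 - (\<gamma> * (m * pi) ^ 4 + (m * pi)\<^sup>2 - 1)"
    unfolding eig_def of_nat_Suc[of "Suc k"] m_def ..
  also have "\<dots> = \<gamma> * pi ^ 4 * (4 * m ^ 3 + 6 * m\<^sup>2 + 4 * m + 1) + pi\<^sup>2 * (2 * m + 1)"
    by (simp add: algebra_simps power2_eq_square power4_eq_xxxx power3_eq_cube)
  also have "\<dots> \<le> \<gamma> * pi ^ 4 * (15 * m ^ 3) + pi\<^sup>2 * (3 * m ^ 3)"
  proof (rule add_mono; rule mult_left_mono)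
    show "4 * m ^ 3 + 6 * m\<^sup>2 + 4 * m + 1 \<le> 15 * m ^ 3" "2 * m + 1 \<le> 3 * m ^ 3"
      using p by linarith+
  qed (use assms in simp_all)
  finally show ?thesis unfolding m_def[symmetric] by (simp add: algebra_simps)
qed

lemma power_times_exp_minus_le:
  assumes "0 \<le> (y::real)"
  shows "y ^ n * exp (- y) \<le> fact n"
proof -
  have "(\<Sum>i\<in>{n}. y ^ i /\<^sub>R fact i) \<le> exp y"
    unfolding exp_def using assms by (intro sum_le_suminf summable_exp_generic) (auto intro!: scaleR_nonneg_nonneg)
  then have "y ^ n / fact n \<le> exp y" by (simp add: divide_inverse mult.commute)
  then show ?thesis by (simp add: exp_minus field_simps)
qed

text \<open>
  Comparison with the integral of \<open>s / (1 + (s z)\<^sup>2)\<close>.  All sums over frequencies in the kernel bound are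
  reduced to this one, which shows that a sum over \<open>k\<close> of a function of \<open>s k\<close> costs one factor \<open>1 / s\<close>.
\<close>

lemma sum_inverse_square_le:
  assumes s: "0 < s"
  shows "(\<Sum>k<N. 1 / (1 + s\<^sup>2 * (real (Suc k))\<^sup>2)) \<le> pi / (2 * s)"
proof -
  have step: "s / (1 + s\<^sup>2 * (real (Suc k))\<^sup>2) \<le> arctan (s * real (Suc k)) - arctan (s * real k)" for k
  proof -
    have "s * real k < s * real (Suc k)" using s by simp
    then obtain z where z: "s * real k < z" "z < s * real (Suc k)"
      "arctan (s * real (Suc k)) - arctan (s * real k) = (s * real (Suc k) - s * real k) * inverse (1 + z\<^sup>2)"
      using MVT2[of "s * real k" "s * real (Suc k)" arctan "\<lambda>z. inverse (1 + z\<^sup>2)"] DERIV_arctan by blast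
    have "0 \<le> s * real k" using s by simp
    with z(1) have "0 \<le> z" by linarith
    then have "z\<^sup>2 \<le> (s * real (Suc k))\<^sup>2" using z s by (intro power_mono) auto
    moreover have "arctan (s * real (Suc k)) - arctan (s * real k) = s / (1 + z\<^sup>2)"
      using z(3) by (simp add: algebra_simps divide_inverse)
    ultimately show ?thesis using s
      by (simp add: power_mult_distrib frac_le add_pos_nonneg del: of_nat_Suc)
  qed
  have "s * (\<Sum>k<N. 1 / (1 + s\<^sup>2 * (real (Suc k))\<^sup>2)) = (\<Sum>k<N. s / (1 + s\<^sup>2 * (real (Suc k))\<^sup>2))"
    by (simp add: sum_distrib_left)
  also have "\<dots> \<le> (\<Sum>k<N. arctan (s * real (Suc k)) - arctan (s * real k))"
    by (intro sum_mono step)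
  also have "\<dots> = arctan (s * real N)" by (subst sum_lessThan_telescope) simp
  also have "\<dots> \<le> pi / 2" using arctan_bounded[of "s * real N"] by simp
  finally show ?thesis using s by (simp add: field_simps)
qed

text \<open>
  Both sides agree at the end points and the sine is concave.
\<close>

lemma sin_half_pi_ge:
  assumes "z \<in> {0..1}"
  shows "z \<le> sin (pi * z / 2)"
proof -
  have "convex_on {0..1} (\<lambda>z. z - sin (pi * z / 2))"
  proof (rule f''_ge0_imp_convex)
    show "((\<lambda>z. z - sin (pi * z / 2)) has_real_derivative 1 - cos (pi * x / 2) * (pi / 2)) (at x)" for x
      by (auto intro!: derivative_eq_intros)
    show "((\<lambda>z. 1 - cos (pi * z / 2) * (pi / 2)) has_real_derivative sin (pi * x / 2) * (pi / 2) * (pi / 2)) (at x)" for x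
      by (auto intro!: derivative_eq_intros)
    show "0 \<le> sin (pi * x / 2) * (pi / 2) * (pi / 2)" if "x \<in> {0..1}" for x
      using that by (intro mult_nonneg_nonneg sin_ge_zero) auto
  qed simp
  from convex_onD[OF this, of z 0 1] assms show ?thesis by simp
qed

text \<open>
  The inequality of arithmetic and geometric means.  It takes the place of the Cauchy-Schwarz inequality
  for integrals below.
\<close>

lemma weighted_square_ge:
  fixes w y :: real
  assumes "0 < w"
  shows "2 * \<bar>y\<bar> \<le> w * y\<^sup>2 + 1 / w"
proof -
  have "0 \<le> (w * \<bar>y\<bar> - 1)\<^sup>2" by simp
  then have "2 * \<bar>y\<bar> * w \<le> w * y\<^sup>2 * w + 1"
    by (simp add: power2_diff power_mult_distrib) (simp add: power2_eq_square mult_ac)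
  then show ?thesis using assms by (simp add: field_simps)
qed

text \<open>
  An \<open>L\<^sup>1\<close> bound of a kernel from \<open>L\<^sup>2\<close> information.  The square integral of the kernel is the sum of the
  squared coefficients, that of the kernel times \<open>2 sin (\<pi> z / 2)\<close> is the sum of the squared differences
  \<open>d\<close>, and the second weight dominates \<open>2 z\<close>.  Together they control the kernel with weight \<open>s\<^sup>2 + z\<^sup>2\<close>,
  whose reciprocal has integral at most \<open>\<pi> / (2 s)\<close>.  The free parameters \<open>s\<close> and \<open>\<eta>\<close> are the width of the
  kernel and the balance between the two terms.  The convention for \<open>d\<close> at \<open>0\<close> and \<open>N\<close> accounts for the two
  ends of the summation by parts.
\<close>

lemma integral_abs_cosine_sum_le:
  assumes s: "0 < s" and \<eta>: "0 < \<eta>"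
    and d_def: "\<And>k. d k = (if k = 0 then 0 else a (k - 1)) - (if k < N then a k else 0)"
  shows "integral {0..1} (\<lambda>z. \<bar>\<Sum>k<N. a k * cos (freq k * z)\<bar>)
    \<le> (\<eta> * (s\<^sup>2 * ((\<Sum>k<N. (a k)\<^sup>2) / 2) + (\<Sum>k<Suc N. (d k)\<^sup>2) / 8) + pi / (2 * \<eta> * s)) / 2"
proof -
  let ?f = "\<lambda>z. \<Sum>k<N. a k * cos (freq k * z)"
  let ?e = "\<lambda>k z. sin ((real k + 1/2) * pi * z)"
  have tw: "2 * sin (pi * z / 2) * ?f z = (\<Sum>k<Suc N. d k * ?e k z)" for z
  proof -
    have t: "2 * sin (pi * z / 2) * cos (freq k * z) = ?e (Suc k) z - ?e k z" for k
    proof -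
      have "pi * z / 2 + freq k * z = (real (Suc k) + 1/2) * pi * z"
        "pi * z / 2 - freq k * z = - ((real k + 1/2) * pi * z)"
        by (simp_all add: field_simps)
      then show ?thesis unfolding mult.assoc[of 2] sin_times_cos by simp
    qed
    have "2 * sin (pi * z / 2) * ?f z = (\<Sum>k<N. a k * (2 * sin (pi * z / 2) * cos (freq k * z)))"
      by (simp only: sum_distrib_left mult_ac)
    also have "\<dots> = (\<Sum>k<N. a k * ?e (Suc k) z) - (\<Sum>k<N. a k * ?e k z)"
      unfolding t by (simp add: right_diff_distrib sum_subtractf)
    also have "(\<Sum>k<N. a k * ?e (Suc k) z) = (\<Sum>k<Suc N. (if k = 0 then 0 else a (k - 1)) * ?e k z)"
      by (subst sum.lessThan_Suc_shift) simp
    also have "(\<Sum>k<N. a k * ?e k z) = (\<Sum>k<Suc N. (if k < N then a k else 0) * ?e k z)"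
      by simp
    also have "(\<Sum>k<Suc N. (if k = 0 then 0 else a (k - 1)) * ?e k z) - (\<Sum>k<Suc N. (if k < N then a k else 0) * ?e k z)
      = (\<Sum>k<Suc N. d k * ?e k z)"
      unfolding d_def left_diff_distrib sum_subtractf by simp
    finally show ?thesis .
  qed
  have i1: "((\<lambda>z. (?f z)\<^sup>2) has_integral (\<Sum>k<N. (a k)\<^sup>2) / 2) {0..1}"
    by (rule has_integral_orthogonal_sum_square[OF has_integral_cosine_cosine])
  have i2: "((\<lambda>z. (2 * sin (pi * z / 2) * ?f z)\<^sup>2) has_integral (\<Sum>k<Suc N. (d k)\<^sup>2) / 2) {0..1}"
    unfolding tw by (rule has_integral_orthogonal_sum_square[OF has_integral_half_mode])
  have i3: "((\<lambda>z. 1 / (s\<^sup>2 + z\<^sup>2)) has_integral arctan (1 / s) / s - arctan (0 / s) / s) {0..1}"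
  proof (rule fundamental_theorem_of_calculus)
    fix z :: real
    have "1 / (s\<^sup>2 + z\<^sup>2) = inverse (1 + (z / s)\<^sup>2) * (1 / s) / s"
    proof -
      have "s\<^sup>2 + z\<^sup>2 \<noteq> 0" "1 + (z / s)\<^sup>2 = (s\<^sup>2 + z\<^sup>2) / s\<^sup>2"
        using s by (auto simp: field_simps sum_power2_eq_zero_iff)
      then show ?thesis using s by (simp add: power2_eq_square)
    qed
    then show "((\<lambda>z. arctan (z / s) / s) has_vector_derivative 1 / (s\<^sup>2 + z\<^sup>2)) (at z within {0..1})"
      unfolding has_real_derivative_iff_has_vector_derivative [symmetric]
      using s by (auto intro!: derivative_eq_intros)
  qed simp
  have ig: "((\<lambda>z. (\<eta> * (s\<^sup>2 * (?f z)\<^sup>2 + (2 * sin (pi * z / 2) * ?f z)\<^sup>2 * (1/4)) + 1 / \<eta> * (1 / (s\<^sup>2 + z\<^sup>2))) * (1/2)) has_integral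
     (\<eta> * (s\<^sup>2 * ((\<Sum>k<N. (a k)\<^sup>2) / 2) + (\<Sum>k<Suc N. (d k)\<^sup>2) / 2 * (1/4)) + 1 / \<eta> * (arctan (1 / s) / s - arctan (0 / s) / s)) * (1/2)) {0..1}"
    by (intro has_integral_add has_integral_mult_right has_integral_mult_left i1 i2 i3)
  have if_: "((\<lambda>z. \<bar>?f z\<bar>) has_integral integral {0..1} (\<lambda>z. \<bar>?f z\<bar>)) {0..1}"
    by (intro integrable_integral integrable_continuous_real continuous_intros)
  have le: "\<bar>?f z\<bar> \<le> (\<eta> * (s\<^sup>2 * (?f z)\<^sup>2 + (2 * sin (pi * z / 2) * ?f z)\<^sup>2 * (1/4)) + 1 / \<eta> * (1 / (s\<^sup>2 + z\<^sup>2))) * (1/2)"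
    if z: "z \<in> {0..1}" for z
  proof -
    let ?w = "\<eta> * (s\<^sup>2 + z\<^sup>2)"
    have w: "0 < ?w" using \<eta> s sum_power2_gt_zero_iff[of s z] by simp
    have "2 * \<bar>?f z\<bar> \<le> ?w * (?f z)\<^sup>2 + 1 / ?w" by (rule weighted_square_ge[OF w])
    moreover have "z\<^sup>2 * (?f z)\<^sup>2 \<le> (sin (pi * z / 2))\<^sup>2 * (?f z)\<^sup>2"
      using z sin_half_pi_ge[OF z] by (intro mult_right_mono power_mono) auto
    then have "?w * (?f z)\<^sup>2 \<le> \<eta> * (s\<^sup>2 * (?f z)\<^sup>2 + (2 * sin (pi * z / 2) * ?f z)\<^sup>2 * (1/4))"
      using \<eta> unfolding power_mult_distrib mult.assoc distrib_right by (intro mult_left_mono) auto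
    ultimately show ?thesis by (simp add: field_simps del: of_nat_Suc)
  qed
  have "integral {0..1} (\<lambda>z. \<bar>?f z\<bar>) \<le>
     (\<eta> * (s\<^sup>2 * ((\<Sum>k<N. (a k)\<^sup>2) / 2) + (\<Sum>k<Suc N. (d k)\<^sup>2) / 2 * (1/4)) + 1 / \<eta> * (arctan (1 / s) / s - arctan (0 / s) / s)) * (1/2)"
    by (rule has_integral_le[OF if_ ig le])
  also have "\<dots> \<le> (\<eta> * (s\<^sup>2 * ((\<Sum>k<N. (a k)\<^sup>2) / 2) + (\<Sum>k<Suc N. (d k)\<^sup>2) / 8) + 1 / \<eta> * (pi / 2 / s)) * (1/2)"
  proof (intro mult_right_mono add_mono)
    show "1 / \<eta> * (arctan (1 / s) / s - arctan (0 / s) / s) \<le> 1 / \<eta> * (pi / 2 / s)"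
      using \<eta> s divide_right_mono[of "arctan (1/s)" "pi/2" s] arctan_bounded[of "1/s"]
      by (intro mult_left_mono) simp_all
  qed simp_all
  finally have fin: "integral {0..1} (\<lambda>z. \<bar>?f z\<bar>)
    \<le> (\<eta> * (s\<^sup>2 * ((\<Sum>k<N. (a k)\<^sup>2) / 2) + (\<Sum>k<Suc N. (d k)\<^sup>2) / 8) + 1 / \<eta> * (pi / 2 / s)) * (1/2)" .
  have "1 / \<eta> * (pi / 2 / s) = pi / (2 * \<eta> * s)" by (simp add: mult_ac)
  then show ?thesis using fin by (simp only: times_divide_eq_right mult_1_right)
qed

text \<open>
  A translated unit interval lies in an interval of length two, which by evenness and periodicity carries
  twice the integral over the unit interval.
\<close>

lemma integral_even_periodic_translate:
  fixes p :: "real \<Rightarrow> real"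
  assumes cont: "continuous_on UNIV p" and nn: "\<And>z. 0 \<le> p z"
    and even: "\<And>z. p (- z) = p z" and per: "\<And>z. p (z + 2) = p z" and x: "x \<in> {0..1}"
  shows "integral {0..1} (\<lambda>y. p (x - y)) \<le> 2 * integral {0..1} p"
    and "integral {0..1} (\<lambda>y. p (x + y)) \<le> 2 * integral {0..1} p"
proof -
  have int: "p integrable_on {a..b}" for a b
    by (intro integrable_continuous_real continuous_on_subset[OF cont]) simp
  have neg: "integral {-1..0} p = integral {0..1} p"
    using Henstock_Kurzweil_Integration.integral_reflect_real[where f=p and a=0 and b=1] even by simp
  have "integral {1..2} p = integral {-1+2..0+2} p" by simp
  also have "\<dots> = integral {-1..0} (p \<circ> (+) 2)" by (rule integral_shift_Icc_real[symmetric])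
  also have "\<dots> = integral {0..1} p" using per neg by (simp add: o_def add.commute)
  finally have pos: "integral {1..2} p = integral {0..1} p" .
  have "p (x - y) = p (- x + y)" for y
    using even[of "x - y"] by simp
  then have "integral {0..1} (\<lambda>y. p (x - y)) = integral {0..1} (p \<circ> (+) (-x))"
    by (simp only: o_def)
  also have "\<dots> = integral {0 + (-x)..1 + (-x)} p" by (rule integral_shift_Icc_real)
  also have "\<dots> \<le> integral {-1..1} p"
    using x nn by (intro integral_subset_le int) auto
  also have "\<dots> = integral {-1..0} p + integral {0..1} p" by (rule Henstock_Kurzweil_Integration.integral_combine[symmetric]) (auto intro: int)
  finally show "integral {0..1} (\<lambda>y. p (x - y)) \<le> 2 * integral {0..1} p" using neg by simp
  have "integral {0..1} (\<lambda>y. p (x + y)) = integral {0..1} (p \<circ> (+) x)" by (simp add: o_def)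
  also have "\<dots> = integral {0 + x..1 + x} p" by (rule integral_shift_Icc_real)
  also have "\<dots> \<le> integral {0..2} p"
    using x nn by (intro integral_subset_le int) auto
  also have "\<dots> = integral {0..1} p + integral {1..2} p" by (rule Henstock_Kurzweil_Integration.integral_combine[symmetric]) (auto intro: int)
  finally show "integral {0..1} (\<lambda>y. p (x + y)) \<le> 2 * integral {0..1} p" using pos by simp
qed

text \<open>
  A multiplier acting on sine series is the integral operator with kernel \<open>\<phi> (x - y) - \<phi> (x + y)\<close>, where \<open>\<phi>\<close>
  is the cosine sum with the same coefficients.  Its norm on bounded functions is therefore controlled by
  the \<open>L\<^sup>1\<close> norm of \<open>\<phi>\<close>.
\<close>

lemma multiplier_bound:
  assumes h: "continuous_on {0..1} h" and H: "\<And>x. x \<in> {0..1} \<Longrightarrow> \<bar>h x\<bar> \<le> H" and x: "x \<in> {0..1}"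
  shows "\<bar>\<Sum>k<N. a k * sine_coef k h * mode k x\<bar>
    \<le> 4 * H * integral {0..1} (\<lambda>z. \<bar>\<Sum>k<N. a k * cos (freq k * z)\<bar>)"
proof -
  let ?f = "\<lambda>z. \<Sum>k<N. a k * cos (freq k * z)"
  have H0: "0 \<le> H" using H[of 0] by simp
  have sc: "((\<lambda>y. 2 * (h y * mode k y)) has_integral sine_coef k h) {0..1}" for k
    using has_integral_mult_right[OF has_integral_sine_coef[OF h, of k], of 2] by simp
  have "((\<lambda>y. \<Sum>k<N. a k * (2 * (h y * mode k y)) * mode k x) has_integral (\<Sum>k<N. a k * sine_coef k h * mode k x)) {0..1}"
    by (intro has_integral_sum has_integral_mult_right has_integral_mult_left sc) simp
  moreover have "(\<Sum>k<N. a k * (2 * (h y * mode k y)) * mode k x) = h y * (?f (x - y) - ?f (x + y))" for y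
  proof -
    have "2 * (mode k y * mode k x) = cos (freq k * (x - y)) - cos (freq k * (x + y))" for k
      unfolding mode_def right_diff_distrib[of "_ * _"] distrib_left[of "_ * _"] cos_diff cos_add by simp
    note this[symmetric]
    moreover have "a k * (2 * (h y * mode k y)) * mode k x = h y * (a k * (2 * (mode k y * mode k x)))" for k
      by (simp only: mult_ac)
    ultimately have "a k * (2 * (h y * mode k y)) * mode k x = h y * (a k * (cos (freq k * (x - y)) - cos (freq k * (x + y))))" for k
      by (simp only:)
    then show ?thesis by (simp only: sum_distrib_left[symmetric] right_diff_distrib sum_subtractf)
  qed
  ultimately have i: "((\<lambda>y. h y * (?f (x - y) - ?f (x + y))) has_integral (\<Sum>k<N. a k * sine_coef k h * mode k x)) {0..1}"
    by (simp only:)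
  have j: "(\<lambda>y. H * (\<bar>?f (x - y)\<bar> + \<bar>?f (x + y)\<bar>)) integrable_on {0..1}"
    by (intro integrable_continuous_real continuous_intros)
  have "norm (integral {0..1} (\<lambda>y. h y * (?f (x - y) - ?f (x + y)))) \<le> integral {0..1} (\<lambda>y. H * (\<bar>?f (x - y)\<bar> + \<bar>?f (x + y)\<bar>))"
  proof (rule integral_norm_bound_integral)
    fix y :: real assume "y \<in> {0..1}"
    then show "norm (h y * (?f (x - y) - ?f (x + y))) \<le> H * (\<bar>?f (x - y)\<bar> + \<bar>?f (x + y)\<bar>)"
      unfolding real_norm_def abs_mult using H H0 by (intro mult_mono) auto
  qed (use i j in auto)
  also have "\<dots> = H * (integral {0..1} (\<lambda>y. \<bar>?f (x - y)\<bar>) + integral {0..1} (\<lambda>y. \<bar>?f (x + y)\<bar>))"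
    by (subst integral_mult_right, subst Henstock_Kurzweil_Integration.integral_add)
      (auto intro!: integrable_continuous_real continuous_intros simp del: of_nat_Suc)
  also have "\<dots> \<le> H * (2 * integral {0..1} (\<lambda>z. \<bar>?f z\<bar>) + 2 * integral {0..1} (\<lambda>z. \<bar>?f z\<bar>))"
  proof -
    have c: "continuous_on UNIV (\<lambda>z. \<bar>?f z\<bar>)" by (intro continuous_intros)
    have even: "\<bar>?f (- z)\<bar> = \<bar>?f z\<bar>" for z by simp
    have "cos (freq k * (z + 2)) = cos (freq k * z)" for k z
    proof -
      have "freq k * (z + 2) = freq k * z + real (Suc k) * (2 * pi)"
        by (simp add: algebra_simps)
      then show ?thesis using cos.plus_of_nat[of "freq k * z" "Suc k"] by simp
    qed
    then have per: "\<bar>?f (z + 2)\<bar> = \<bar>?f z\<bar>" for z by (simp only:)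
    note tr = integral_even_periodic_translate[OF c abs_ge_zero even per x]
    show ?thesis by (intro mult_left_mono add_mono tr H0)
  qed
  finally show ?thesis using i by (simp add: integral_unique)
qed

text \<open>
  The multiplier of \<open>A\<^sup>2 exp (- t A)\<close>, where \<open>A\<close> is the fourth-order operator with eigenvalues
  \<open>eig \<gamma> k\<close>.
\<close>

definition heat2 :: "real \<Rightarrow> real \<Rightarrow> nat \<Rightarrow> real" where
  "heat2 \<gamma> t k = (eig \<gamma> k)\<^sup>2 * exp (- eig \<gamma> k * t)"

text \<open>
  The parabolic scaling \<open>t = s\<^sup>4\<close> of a fourth-order operator: \<open>\<xi> t\<close> dominates the fourth power of \<open>s (k + 1)\<close>.
  Working with \<open>s\<close> keeps all later exponents integral.
\<close>

lemma freq_le_eig: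
  assumes "\<gamma> > 0" "0 < s" "eig \<gamma> k \<le> \<xi>"
  defines "q \<equiv> s\<^sup>2 * (real (Suc k))\<^sup>2"
  shows "q\<^sup>2 \<le> \<xi> * s ^ 4 / (\<gamma> * pi ^ 4)" and "q \<ge> 0"
proof -
  have "\<gamma> * pi ^ 4 * real (Suc k) ^ 4 \<le> \<xi>" using eig_lower assms(3) by (rule order_trans)
  then have "\<gamma> * pi ^ 4 * real (Suc k) ^ 4 * s ^ 4 \<le> \<xi> * s ^ 4" by (rule mult_right_mono) simp
  moreover have "q\<^sup>2 = real (Suc k) ^ 4 * s ^ 4" unfolding q_def by (simp add: power_mult_distrib mult.commute)
  ultimately show "q\<^sup>2 \<le> \<xi> * s ^ 4 / (\<gamma> * pi ^ 4)" using assms(1) by (simp add: pos_le_divide_eq mult_ac)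
  show "q \<ge> 0" unfolding q_def by simp
qed

text \<open>
  With \<open>y = eig \<gamma> k t\<close> the left-hand side is \<open>t\<^sup>-\<^sup>4 y\<^sup>4 exp (- 2 y)\<close>, and the exponential absorbs any power of \<open>y\<close>,
  in particular the factor \<open>1 + s\<^sup>2 (k + 1)\<^sup>2\<close>.
\<close>

lemma heat2_square_le:
  assumes \<gamma>: "\<gamma> > 0" and s: "0 < s"
  shows "(heat2 \<gamma> (s ^ 4) k)\<^sup>2 \<le> (48 + 120 / (\<gamma> * pi ^ 4)) / s ^ 16 * (1 / (1 + s\<^sup>2 * (real (Suc k))\<^sup>2))"
proof -
  define c where "c = \<gamma> * pi ^ 4"
  define y where "y = eig \<gamma> k * s ^ 4"
  define q where "q = s\<^sup>2 * (real (Suc k))\<^sup>2"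
  have c: "c > 0" using \<gamma> by (simp add: c_def)
  have y: "y \<ge> 0" using eig_pos[OF \<gamma>, of k] by (simp add: y_def)
  have q: "q\<^sup>2 \<le> y / c" "0 \<le> q"
    using freq_le_eig[OF \<gamma> s order_refl, of k] unfolding q_def y_def c_def by blast+
  have "0 \<le> (q - 1)\<^sup>2" by simp
  then have "1 + q \<le> 2 + q\<^sup>2" using q by (simp add: power2_diff)
  then have 1: "1 + q \<le> 2 + y / c" using q by linarith
  have "(heat2 \<gamma> (s ^ 4) k)\<^sup>2 * s ^ 16 = y ^ 4 * exp (- y) * exp (- y)"
    unfolding heat2_def y_def by (simp add: power_mult_distrib power2_eq_square[of "exp _"] flip: power_mult)
  also have "\<dots> \<le> y ^ 4 * exp (- y) * 1" using y by (intro mult_left_mono) auto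
  finally have "(heat2 \<gamma> (s ^ 4) k)\<^sup>2 * s ^ 16 \<le> y ^ 4 * exp (- y) * 1" .
  from mult_mono[OF this 1]
  have "(heat2 \<gamma> (s ^ 4) k)\<^sup>2 * s ^ 16 * (1 + q) \<le> y ^ 4 * exp (- y) * (2 + y / c)"
    using q y c by simp
  also have "\<dots> = 2 * (y ^ 4 * exp (- y)) + (y ^ 5 * exp (- y)) / c"
    by (simp add: distrib_left eval_nat_numeral)
  also have "\<dots> \<le> 2 * fact 4 + fact 5 / c"
    using c by (intro add_mono mult_left_mono divide_right_mono power_times_exp_minus_le y) auto
  finally have "(heat2 \<gamma> (s ^ 4) k)\<^sup>2 * s ^ 16 * (1 + q) \<le> 48 + 120 / c"
    by (simp add: fact_numeral)
  moreover have "0 < s ^ 16" "0 < 1 + q" using s q by auto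
  ultimately show ?thesis unfolding q_def[symmetric] c_def[symmetric]
    by (simp add: pos_le_divide_eq mult_ac)
qed

text \<open>
  By the mean value theorem a difference of neighbouring coefficients gains a factor of order
  \<open>(k + 1)\<^sup>3 t\<close>, the ratio of the spacing of the eigenvalues to their natural scale \<open>1 / t\<close>.  Relative to
  \<open>heat2_square_le\<close> this is a gain of \<open>s\<close> per difference.
\<close>

lemma heat2_diff_square_le:
  assumes \<gamma>: "\<gamma> > 0"
  shows "\<exists>C\<ge>0. \<forall>s>0. \<forall>k. (heat2 \<gamma> (s ^ 4) (Suc k) - heat2 \<gamma> (s ^ 4) k)\<^sup>2
    \<le> C / s ^ 14 * (1 / (1 + s\<^sup>2 * (real (Suc k))\<^sup>2))"
proof -
  define c where "c = \<gamma> * pi ^ 4"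
  define D where "D = 15 * \<gamma> * pi ^ 4 + 3 * pi\<^sup>2"
  define K where "K = 8 * fact 3 / c + 2 * fact 5 / c + 16 * fact 4 / c\<^sup>2 + 4 * fact 6 / c\<^sup>2"
  have c: "c > 0" using \<gamma> by (simp add: c_def)
  have D: "D \<ge> 0" using \<gamma> by (simp add: D_def)
  have K: "K \<ge> 0" using c by (simp add: K_def)
  have main: "(heat2 \<gamma> (s ^ 4) (Suc k) - heat2 \<gamma> (s ^ 4) k)\<^sup>2 \<le> D\<^sup>2 * K / s ^ 14 * (1 / (1 + s\<^sup>2 * (real (Suc k))\<^sup>2))"
    if s: "s > 0" for s k
  proof -
    let ?h = "\<lambda>z. z\<^sup>2 * exp (- z * s ^ 4)" and ?h' = "\<lambda>z. (2 * z - z\<^sup>2 * s ^ 4) * exp (- z * s ^ 4)"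
    define m where "m = real (Suc k)"
    have m: "0 \<le> m" by (simp add: m_def)
    have "(?h has_real_derivative ?h' z) (at z)" for z
      by (auto intro!: derivative_eq_intros simp: algebra_simps power2_eq_square)
    then obtain z where z: "eig \<gamma> k < z" "z < eig \<gamma> (Suc k)"
      and mvt: "?h (eig \<gamma> (Suc k)) - ?h (eig \<gamma> k) = (eig \<gamma> (Suc k) - eig \<gamma> k) * ?h' z"
      using MVT2[OF eig_Suc_less[OF \<gamma>], of k ?h ?h'] by blast
    define y where "y = z * s ^ 4"
    define q where "q = s\<^sup>2 * m\<^sup>2"
    have y: "y \<ge> 0" using z eig_pos[OF \<gamma>, of k] s by (simp add: y_def)
    have q: "q\<^sup>2 \<le> y / c" "0 \<le> q"
      using freq_le_eig[OF \<gamma> s less_imp_le[OF z(1)]] unfolding q_def y_def c_def m_def by blast+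
    define L where "L = eig \<gamma> (Suc k) - eig \<gamma> k"
    have L: "0 \<le> L" "L \<le> D * m ^ 3"
      using eig_Suc_less[OF \<gamma>, of k] eig_Suc_diff[OF \<gamma>, of k] unfolding L_def D_def m_def by auto
    have "(heat2 \<gamma> (s ^ 4) (Suc k) - heat2 \<gamma> (s ^ 4) k)\<^sup>2 * s ^ 8 = L\<^sup>2 * (?h' z * s ^ 4)\<^sup>2"
      using mvt unfolding heat2_def L_def by (simp add: power_mult_distrib)
    also have "?h' z * s ^ 4 = (2 * y - y\<^sup>2) * exp (- y)"
      unfolding y_def by (simp add: algebra_simps power2_eq_square)
    also have "L\<^sup>2 * ((2 * y - y\<^sup>2) * exp (- y))\<^sup>2 \<le> (D * m ^ 3)\<^sup>2 * ((8 * y\<^sup>2 + 2 * y ^ 4) * exp (- y))"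
    proof (intro mult_mono power_mono L)
      have "(2 * y - y\<^sup>2)\<^sup>2 \<le> 8 * y\<^sup>2 + 2 * y ^ 4"
      proof -
        have "0 \<le> (2 * y + y\<^sup>2)\<^sup>2" by simp
        then show ?thesis by (simp add: power2_eq_square algebra_simps eval_nat_numeral)
      qed
      then have "(2 * y - y\<^sup>2)\<^sup>2 * (exp (- y) * exp (- y)) \<le> (8 * y\<^sup>2 + 2 * y ^ 4) * (exp (- y) * 1)"
        using y by (intro mult_mono) auto
      then show "((2 * y - y\<^sup>2) * exp (- y))\<^sup>2 \<le> (8 * y\<^sup>2 + 2 * y ^ 4) * exp (- y)"
        by (simp add: power_mult_distrib power2_eq_square[of "exp _"])
    qed (use D m in auto)
    finally have "(heat2 \<gamma> (s ^ 4) (Suc k) - heat2 \<gamma> (s ^ 4) k)\<^sup>2 * s ^ 8 * (s ^ 6 * (1 + q))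
      \<le> (D * m ^ 3)\<^sup>2 * ((8 * y\<^sup>2 + 2 * y ^ 4) * exp (- y)) * (s ^ 6 * (1 + q))"
      using s q by (intro mult_right_mono) auto
    also have "\<dots> = D\<^sup>2 * ((8 * y\<^sup>2 + 2 * y ^ 4) * exp (- y)) * (q ^ 3 * (1 + q))"
      unfolding q_def by (simp add: power_mult_distrib mult_ac flip: power_mult)
    also have "\<dots> \<le> D\<^sup>2 * ((8 * y\<^sup>2 + 2 * y ^ 4) * exp (- y)) * (y / c + 2 * (y / c)\<^sup>2)"
    proof (intro mult_left_mono)
      have "0 \<le> q\<^sup>2 * (q - 1)\<^sup>2" by simp
      moreover have "0 \<le> q * (q * q)" using q by simp
      ultimately have "q ^ 3 * (1 + q) \<le> q\<^sup>2 + 2 * (q\<^sup>2)\<^sup>2"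
        by (simp add: power2_eq_square algebra_simps eval_nat_numeral)
      also have "\<dots> \<le> y / c + 2 * (y / c)\<^sup>2"
        using q by (intro add_mono mult_left_mono power_mono) auto
      finally show "q ^ 3 * (1 + q) \<le> y / c + 2 * (y / c)\<^sup>2" .
    qed (use y in auto)
    also have "\<dots> = D\<^sup>2 * (8 * (y ^ 3 * exp (- y)) / c + 2 * (y ^ 5 * exp (- y)) / c
        + 16 * (y ^ 4 * exp (- y)) / c\<^sup>2 + 4 * (y ^ 6 * exp (- y)) / c\<^sup>2)"
      by (simp add: field_simps eval_nat_numeral)
    also have "\<dots> \<le> D\<^sup>2 * K"
      unfolding K_def using c
      by (intro mult_left_mono add_mono divide_right_mono power_times_exp_minus_le y) auto
    finally have "(heat2 \<gamma> (s ^ 4) (Suc k) - heat2 \<gamma> (s ^ 4) k)\<^sup>2 * s ^ 8 * (s ^ 6 * (1 + q)) \<le> D\<^sup>2 * K" .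
    then have "(heat2 \<gamma> (s ^ 4) (Suc k) - heat2 \<gamma> (s ^ 4) k)\<^sup>2 * (s ^ 14 * (1 + q)) \<le> D\<^sup>2 * K"
      by (simp add: mult_ac flip: power_add)
    moreover have "0 < s ^ 14 * (1 + q)" using s q by auto
    ultimately show ?thesis unfolding m_def[symmetric] q_def[symmetric]
      by (simp add: pos_le_divide_eq)
  qed
  show ?thesis by (rule exI[of _ "D\<^sup>2 * K"]) (use main D K in auto)
qed

text \<open>
  The two coefficient bounds make the sum of squares of order \<open>s\<^sup>-\<^sup>1\<^sup>7\<close> and the sum of squared differences of
  order \<open>s\<^sup>-\<^sup>1\<^sup>5\<close>, so that width \<open>s\<close> and balance \<open>\<eta> = s\<^sup>7\<close> give the order \<open>s\<^sup>-\<^sup>8 = t\<^sup>-\<^sup>2\<close> expected of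
  \<open>A\<^sup>2 exp (- t A)\<close>.  The last coefficient enters because the sum is cut off at \<open>N\<close>; it vanishes as \<open>N\<close> grows.
\<close>

lemma heat2_kernel_L1:
  assumes \<gamma>: "\<gamma> > 0" and S: "S > 0"
  shows "\<exists>C\<ge>0. \<forall>s. 0 < s \<longrightarrow> s \<le> S \<longrightarrow> (\<forall>N.
    integral {0..1} (\<lambda>z. \<bar>\<Sum>k<N. heat2 \<gamma> (s ^ 4) k * cos (freq k * z)\<bar>)
      \<le> C / s ^ 8 + C * (heat2 \<gamma> (s ^ 4) (N - 1))\<^sup>2)"
proof -
  obtain C2 where C2: "C2 \<ge> 0"
    and d2: "\<And>s k. s > 0 \<Longrightarrow> (heat2 \<gamma> (s ^ 4) (Suc k) - heat2 \<gamma> (s ^ 4) k)\<^sup>2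
    \<le> C2 / s ^ 14 * (1 / (1 + s\<^sup>2 * (real (Suc k))\<^sup>2))"
    using heat2_diff_square_le[OF \<gamma>] by blast
  define C1 where "C1 = 48 + 120 / (\<gamma> * pi ^ 4)"
  have C1: "C1 \<ge> 0" using \<gamma> by (simp add: C1_def)
  define e0 where "e0 = (eig \<gamma> 0)\<^sup>2"
  \<comment> \<open>The four terms come from the squares, the first and the remaining differences, and the weight.\<close>
  define C where "C = C1 * pi / 8 + S ^ 15 * e0\<^sup>2 / 16 + C2 * pi / 32 + pi / 4 + S ^ 7 / 16"
  have C: "C \<ge> C1 * pi / 8 + S ^ 15 * e0\<^sup>2 / 16 + C2 * pi / 32 + pi / 4" "C \<ge> S ^ 7 / 16" "C \<ge> 0"
    using C1 C2 S by (auto simp: C_def intro!: add_nonneg_nonneg)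
  have main: "integral {0..1} (\<lambda>z. \<bar>\<Sum>k<N. heat2 \<gamma> (s ^ 4) k * cos (freq k * z)\<bar>)
      \<le> C / s ^ 8 + C * (heat2 \<gamma> (s ^ 4) (N - 1))\<^sup>2" if s: "0 < s" "s \<le> S" for s N
  proof (cases N)
    case 0
    then show ?thesis using C s by simp
  next
    case (Suc n)
    let ?a = "heat2 \<gamma> (s ^ 4)"
    let ?w = "\<lambda>k. 1 / (1 + s\<^sup>2 * (real (Suc k))\<^sup>2)"
    define d where "d k = (if k = 0 then 0 else ?a (k - 1)) - (if k < N then ?a k else 0)" for k
    have "(\<Sum>k<N. (?a k)\<^sup>2) \<le> (\<Sum>k<N. C1 / s ^ 16 * ?w k)"
      unfolding C1_def by (intro sum_mono heat2_square_le \<gamma> s)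
    also have "\<dots> = C1 / s ^ 16 * (\<Sum>k<N. ?w k)" by (rule sum_distrib_left[symmetric])
    also have "\<dots> \<le> C1 / s ^ 16 * (pi / (2 * s))"
      using s C1 by (intro mult_left_mono sum_inverse_square_le) auto
    finally have A: "(\<Sum>k<N. (?a k)\<^sup>2) \<le> C1 / s ^ 16 * (pi / (2 * s))" .
    have "(\<Sum>k<Suc N. (d k)\<^sup>2) = (d 0)\<^sup>2 + (\<Sum>k<Suc n. (d (Suc k))\<^sup>2)"
      unfolding Suc by (rule sum.lessThan_Suc_shift)
    also have "\<dots> = (?a 0)\<^sup>2 + (\<Sum>k<n. (?a (Suc k) - ?a k)\<^sup>2) + (?a n)\<^sup>2"
      by (simp add: d_def Suc power2_commute)
    also have "(\<Sum>k<n. (?a (Suc k) - ?a k)\<^sup>2) \<le> (\<Sum>k<n. C2 / s ^ 14 * ?w k)"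
      by (intro sum_mono d2 s)
    also have "\<dots> = C2 / s ^ 14 * (\<Sum>k<n. ?w k)" by (rule sum_distrib_left[symmetric])
    also have "\<dots> \<le> C2 / s ^ 14 * (pi / (2 * s))"
      using s C2 by (intro mult_left_mono sum_inverse_square_le) auto
    also have "(?a 0)\<^sup>2 \<le> e0\<^sup>2"
      unfolding heat2_def e0_def using eig_pos[OF \<gamma>, of 0] s by (intro power_mono mult_left_le) auto
    finally have B: "(\<Sum>k<Suc N. (d k)\<^sup>2) \<le> e0\<^sup>2 + C2 / s ^ 14 * (pi / (2 * s)) + (?a n)\<^sup>2" by simp
    have "integral {0..1} (\<lambda>z. \<bar>\<Sum>k<N. ?a k * cos (freq k * z)\<bar>)
      \<le> (s ^ 7 * (s\<^sup>2 * ((\<Sum>k<N. (?a k)\<^sup>2) / 2) + (\<Sum>k<Suc N. (d k)\<^sup>2) / 8) + pi / (2 * s ^ 7 * s)) / 2"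
      using s by (intro integral_abs_cosine_sum_le) (auto simp: d_def)
    also have "\<dots> \<le> (s ^ 7 * (s\<^sup>2 * ((C1 / s ^ 16 * (pi / (2 * s))) / 2) + (e0\<^sup>2 + C2 / s ^ 14 * (pi / (2 * s)) + (?a n)\<^sup>2) / 8) + pi / (2 * s ^ 7 * s)) / 2"
      using s A B by (intro divide_right_mono add_mono mult_left_mono) auto
    also have "\<dots> = (C1 * pi / 8 + s ^ 15 * e0\<^sup>2 / 16 + C2 * pi / 32 + pi / 4) / s ^ 8 + s ^ 7 / 16 * (?a n)\<^sup>2"
      using s by (simp add: field_simps eval_nat_numeral)
    also have "\<dots> \<le> C / s ^ 8 + C * (?a n)\<^sup>2"
    proof (intro add_mono divide_right_mono mult_right_mono)
      have "s ^ 15 * e0\<^sup>2 \<le> S ^ 15 * e0\<^sup>2" using s by (intro mult_right_mono power_mono) auto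
      then show "C1 * pi / 8 + s ^ 15 * e0\<^sup>2 / 16 + C2 * pi / 32 + pi / 4 \<le> C" using C by linarith
      have "s ^ 7 \<le> S ^ 7" using s by (intro power_mono) auto
      then show "s ^ 7 / 16 \<le> C" using C by linarith
    qed (use s in auto)
    finally show ?thesis using Suc by simp
  qed
  show ?thesis by (rule exI[of _ C]) (use main C in auto)
qed

text \<open>
  The operator \<open>A\<^sup>2 exp (- t A)\<close> has norm of order \<open>t\<^sup>-\<^sup>2\<close> on bounded functions.  This is the analyticity of the
  semigroup in the supremum norm, which absolute summation of coefficients cannot give; the regularity of
  the time derivative rests on it.
\<close>

lemma heat2_multiplier_bound:
  assumes \<gamma>: "\<gamma> > 0" and T: "T > 0"
  shows "\<exists>C\<ge>0. \<forall>t. 0 < t \<longrightarrow> t \<le> T \<longrightarrow> (\<forall>N h H x. continuous_on {0..1} h \<longrightarrow> (\<forall>y\<in>{0..1}. \<bar>h y\<bar> \<le> H) \<longrightarrow> x \<in> {0..1} \<longrightarrow>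
    \<bar>\<Sum>k<N. heat2 \<gamma> t k * sine_coef k h * mode k x\<bar> \<le> H * (C / t\<^sup>2 + C * (heat2 \<gamma> t (N - 1))\<^sup>2))"
proof -
  have "root 4 T > 0" using T by simp
  from heat2_kernel_L1[OF \<gamma> this] obtain C where C: "C \<ge> 0"
    and b: "\<And>s N. 0 < s \<Longrightarrow> s \<le> root 4 T \<Longrightarrow>
    integral {0..1} (\<lambda>z. \<bar>\<Sum>k<N. heat2 \<gamma> (s ^ 4) k * cos (freq k * z)\<bar>)
      \<le> C / s ^ 8 + C * (heat2 \<gamma> (s ^ 4) (N - 1))\<^sup>2" by blast
  have main: "\<bar>\<Sum>k<N. heat2 \<gamma> t k * sine_coef k h * mode k x\<bar> \<le> H * ((4 * C) / t\<^sup>2 + (4 * C) * (heat2 \<gamma> t (N - 1))\<^sup>2)"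
    if t: "0 < t" "t \<le> T" and h: "continuous_on {0..1} h" "\<forall>y\<in>{0..1}. \<bar>h y\<bar> \<le> H" and x: "x \<in> {0..1}" for t N h H x
  proof -
    define s where "s = root 4 t"
    have s: "0 < s" "s \<le> root 4 T" "s ^ 4 = t" using t by (auto simp: s_def)
    have s8: "s ^ 8 = t\<^sup>2" using s(3) by (auto simp flip: power_mult)
    have H: "0 \<le> H" using h(2) by (metis abs_ge_zero atLeastAtMost_iff order_refl order_trans zero_le_one)
    have "\<bar>\<Sum>k<N. heat2 \<gamma> t k * sine_coef k h * mode k x\<bar>
      \<le> 4 * H * integral {0..1} (\<lambda>z. \<bar>\<Sum>k<N. heat2 \<gamma> t k * cos (freq k * z)\<bar>)"
      by (rule multiplier_bound) (use h x in auto)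
    also have "\<dots> \<le> 4 * H * (C / s ^ 8 + C * (heat2 \<gamma> (s ^ 4) (N - 1))\<^sup>2)"
      using b[OF s(1,2), of N] s(3) H by (intro mult_left_mono) auto
    finally show ?thesis unfolding s8 s(3) by (simp add: algebra_simps)
  qed
  show ?thesis by (rule exI[of _ "4 * C"]) (use main C in auto)
qed

section \<open>Periodic solutions of scalar linear equations\<close>

lemma antiderivative_on_line:
  fixes f :: "real \<Rightarrow> real"
  assumes f: "continuous_on UNIV f"
  shows "\<exists>P. \<forall>t. (P has_real_derivative f t) (at t)"
proof -
  have int: "f integrable_on {a..b}" for a b
    by (intro integrable_continuous_real continuous_on_subset[OF f]) simp
  define P where "P t = (if t \<ge> 0 then integral {0..t} f else - integral {t..0} f)" for t
  have "(P has_real_derivative f t) (at t)" for t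
  proof -
    define a b where "a = min 0 t - 1" and "b = t + 1"
    have ab: "a < t" "t < b" "a < 0" by (auto simp: a_def b_def)
    have P: "P r = integral {a..r} f - integral {a..0} f" if "r \<in> {a..b}" for r
    proof (cases "r \<ge> 0")
      case True
      then have "integral {a..0} f + integral {0..r} f = integral {a..r} f"
        using ab by (intro Henstock_Kurzweil_Integration.integral_combine int) auto
      then show ?thesis using True by (simp add: P_def)
    next
      case False
      then have "integral {a..r} f + integral {r..0} f = integral {a..0} f"
        using that by (intro Henstock_Kurzweil_Integration.integral_combine int) auto
      then show ?thesis using False by (simp add: P_def)
    qed
    have "((\<lambda>r. integral {a..r} f) has_real_derivative f t) (at t within {a..b})"
      by (intro integral_has_real_derivative continuous_on_subset[OF f]) (use ab in auto)
    then have "((\<lambda>r. integral {a..r} f - integral {a..0} f) has_real_derivative f t) (at t within {a..b})"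
      by (auto intro!: derivative_eq_intros)
    then have "(P has_real_derivative f t) (at t within {a..b})"
      by (rule has_field_derivative_transform_within[OF _ zero_less_one]) (use ab P in auto)
    then show ?thesis using ab by (simp add: at_within_Icc_at)
  qed
  then show ?thesis by blast
qed

lemma periodic_int_multiple:
  fixes e :: "real \<Rightarrow> 'a"
  assumes "\<And>t. e (t + \<omega>) = e t"
  shows "e (t + of_int n * \<omega>) = e t"
proof -
  interpret periodic_fun_simple e \<omega> by standard (rule assms)
  show ?thesis by (rule plus_of_int)
qed

lemma periodic_value_in_period:
  fixes e :: "real \<Rightarrow> 'a"
  assumes "\<omega> > 0" "\<And>t. e (t + \<omega>) = e t"
  shows "\<exists>s\<in>{0..\<omega>}. e t = e s"
proof (rule bexI)
  define n where "n = \<lfloor>t / \<omega>\<rfloor>"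
  show "e t = e (t + of_int (- n) * \<omega>)"
    using periodic_int_multiple[of e \<omega>, OF assms(2), of t "- n"] by simp
  have "of_int n \<le> t / \<omega>" "t / \<omega> < of_int n + 1" unfolding n_def by linarith+
  then show "t + of_int (- n) * \<omega> \<in> {0..\<omega>}" using assms(1) by (auto simp: field_simps)
qed

text \<open>
  At a maximum of a periodic function the derivative vanishes.  This maximum principle gives every bound on
  the periodic solutions below, for a single coefficient as well as for sums of squares.
\<close>

lemma periodic_differential_inequality:
  fixes e e' :: "real \<Rightarrow> real"
  assumes \<omega>: "\<omega> > 0" and per: "\<And>t. e (t + \<omega>) = e t"
    and der: "\<And>t. (e has_real_derivative e' t) (at t)"
    and a: "a > 0" and le: "\<And>t. e' t \<le> - a * e t + b"
  shows "e t \<le> b / a"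
proof -
  have "continuous_on {0..\<omega>} e"
    using der by (meson DERIV_isCont continuous_at_imp_continuous_on)
  then obtain m where m: "m \<in> {0..\<omega>}" "\<And>s. s \<in> {0..\<omega>} \<Longrightarrow> e s \<le> e m"
    using continuous_attains_sup[of "{0..\<omega>}" e] \<omega> by auto
  have max: "e s \<le> e m" for s
    using periodic_value_in_period[of \<omega> e, OF \<omega> per, of s] m(2) by auto
  have "e' m = 0" by (rule DERIV_local_max[OF der zero_less_one]) (use max in auto)
  with le[of m] have "a * e m \<le> b" by simp
  then have "e m \<le> b / a" using a by (simp add: pos_le_divide_eq mult.commute)
  then show ?thesis using max[of t] by linarith
qed

text \<open>
  The constant of integration is chosen so that the solution has equal values at \<open>0\<close> and \<open>\<omega>\<close>.  The difference
  of the solution and its translate solves the homogeneous equation and vanishes at \<open>0\<close>, hence everywhere.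
\<close>

lemma periodic_linear_ode:
  fixes p :: "real \<Rightarrow> real"
  assumes \<omega>: "\<omega> > 0" and l: "l > 0" and p: "continuous_on UNIV p" and per: "\<And>t. p (t + \<omega>) = p t"
  shows "\<exists>q. (\<forall>t. q (t + \<omega>) = q t) \<and> (\<forall>t. (q has_real_derivative p t - l * q t) (at t))"
proof -
  obtain P where P: "\<And>t. (P has_real_derivative exp (l * t) * p t) (at t)"
  proof -
    have "continuous_on UNIV (\<lambda>t. exp (l * t) * p t)" by (intro continuous_intros p)
    then show ?thesis using antiderivative_on_line that by blast
  qed
  define E where "E = exp (- l * \<omega>)"
  have E: "E < 1" using l \<omega> by (simp add: E_def)
  define c where "c = (E * P \<omega> - P 0) / (1 - E)"
  define q where "q t = exp (- l * t) * (P t + c)" for t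
  have dq: "(q has_real_derivative p t - l * q t) (at t)" for t
  proof -
    have "(q has_real_derivative - l * exp (- l * t) * (P t + c) + exp (- l * t) * (exp (l * t) * p t)) (at t)"
      unfolding q_def by (auto intro!: derivative_eq_intros P)
    moreover have "- l * exp (- l * t) * (P t + c) + exp (- l * t) * (exp (l * t) * p t) = p t - l * q t"
      by (simp add: q_def exp_minus field_simps)
    ultimately show ?thesis by (simp only:)
  qed
  have "(P 0 + c) * (1 - E) = E * (P \<omega> - P 0)"
    using E unfolding c_def by (simp add: field_simps)
  then have q0: "q \<omega> = q 0" unfolding q_def E_def[symmetric] by (simp add: algebra_simps)
  \<comment> \<open>The homogeneous equation makes this product constant.\<close>
  let ?z = "\<lambda>t. exp (l * t) * (q (t + \<omega>) - q t)"
  have "(?z has_real_derivative 0) (at t)" for t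
  proof -
    have "((\<lambda>t. q (t + \<omega>)) has_real_derivative p t - l * q (t + \<omega>)) (at t)"
      using dq[of "t + \<omega>"] by (simp add: DERIV_shift per)
    then show ?thesis by (auto intro!: derivative_eq_intros dq simp: algebra_simps)
  qed
  then have "?z t = ?z 0" for t using DERIV_isconst_all by blast
  then have "q (t + \<omega>) = q t" for t using q0 by simp
  with dq show ?thesis by blast
qed

section \<open>Forcing terms and sine series of solutions\<close>

definition admissible :: "real \<Rightarrow> (real \<Rightarrow> real \<Rightarrow> real) \<Rightarrow> bool" where
  "admissible \<omega> F \<longleftrightarrow> continuous_on (UNIV \<times> {0..1}) (\<lambda>(t, x). F t x) \<and> time_periodic \<omega> F"

lemma admissible_continuous_x:
  assumes "admissible \<omega> F" shows "continuous_on {0..1} (F t)"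
proof -
  have "continuous_on {0..1} (\<lambda>x. (\<lambda>(t, x). F t x) (t, x))"
    by (rule continuous_on_compose2[of "UNIV \<times> {0..1}"])
      (use assms in \<open>auto simp: admissible_def intro!: continuous_intros\<close>)
  then show ?thesis by simp
qed

lemma admissible_bounded:
  assumes \<omega>: "\<omega> > 0" and F: "admissible \<omega> F"
  shows "\<exists>M>0. \<forall>t. \<forall>x\<in>{0..1}. \<bar>F t x\<bar> \<le> M"
proof -
  have "continuous_on ({0..\<omega>} \<times> {0..1}) (\<lambda>(t, x). F t x)"
    by (rule continuous_on_subset[of "UNIV \<times> {0..1}"]) (use F in \<open>auto simp: admissible_def\<close>)
  then have "compact ((\<lambda>(t, x). F t x) ` ({0..\<omega>} \<times> {0..1}))"
    by (intro compact_continuous_image compact_Times compact_Icc)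
  from compact_imp_bounded[OF this] obtain M where M0: "M > 0"
    and M': "\<forall>y\<in>(\<lambda>(t, x). F t x) ` ({0..\<omega>} \<times> {0..1}). norm y \<le> M"
    unfolding bounded_pos by blast
  have M: "\<bar>F t x\<bar> \<le> M" if "t \<in> {0..\<omega>}" "x \<in> {0..1}" for t x
    using bspec[OF M' imageI[of "(t, x)"]] that by simp
  have "\<bar>F t x\<bar> \<le> M" if x: "x \<in> {0..1}" for t x
  proof -
    have "\<And>t. (\<lambda>t. F t x) (t + \<omega>) = (\<lambda>t. F t x) t" using F x by (simp add: admissible_def time_periodic_def)
    from periodic_value_in_period[of \<omega> "\<lambda>t. F t x", OF \<omega> this, of t]
    obtain s where "s \<in> {0..\<omega>}" "F t x = F s x" by auto
    then show ?thesis using M x by simp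
  qed
  then show ?thesis using M0 by blast
qed

lemma sine_coef_cong: "(\<And>x. x \<in> {0..1} \<Longrightarrow> f x = g x) \<Longrightarrow> sine_coef k f = sine_coef k g"
  unfolding sine_coef_def by (auto intro!: Henstock_Kurzweil_Integration.integral_cong)

lemma sine_coef_diff:
  assumes "continuous_on {0..1} f" "continuous_on {0..1} g"
  shows "sine_coef k (\<lambda>x. f x - g x) = sine_coef k f - sine_coef k g"
  unfolding sine_coef_def left_diff_distrib
  by (subst Henstock_Kurzweil_Integration.integral_diff)
    (auto intro!: integrable_continuous_real continuous_intros assms)

lemma abs_sine_coef_le:
  assumes f: "continuous_on {0..1} f" and M: "\<And>x. x \<in> {0..1} \<Longrightarrow> \<bar>f x\<bar> \<le> M"
  shows "\<bar>sine_coef k f\<bar> \<le> 2 * M"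
proof -
  have "norm (integral {0..1} (\<lambda>x. f x * mode k x)) \<le> integral {0..1} (\<lambda>x::real. M)"
  proof (rule integral_norm_bound_integral)
    fix x :: real assume "x \<in> {0..1}"
    then show "norm (f x * mode k x) \<le> M"
      using mult_mono[OF M abs_mode_le_1[of k x]] M[of x] by (simp add: abs_mult)
  qed (auto intro!: integrable_continuous_real continuous_intros f)
  then show ?thesis unfolding sine_coef_def by simp
qed

lemma admissible_sine_coef:
  assumes F: "admissible \<omega> F"
  shows "continuous_on UNIV (\<lambda>t. sine_coef k (F t))" and "sine_coef k (F (t + \<omega>)) = sine_coef k (F t)"
proof -
  have "continuous_on (UNIV \<times> cbox 0 1) (\<lambda>p. (\<lambda>(t, x). F t x) p * mode k (snd p))"
    using F by (intro continuous_intros) (auto simp: admissible_def)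
  then have "continuous_on (UNIV \<times> cbox 0 1) (\<lambda>(t, x). F t x * mode k x)"
    by (simp add: case_prod_unfold)
  from integral_continuous_on_param[OF this]
  show "continuous_on UNIV (\<lambda>t. sine_coef k (F t))"
    unfolding sine_coef_def by (intro continuous_intros) simp
  show "sine_coef k (F (t + \<omega>)) = sine_coef k (F t)"
    using F by (intro sine_coef_cong) (simp add: admissible_def time_periodic_def)
qed

lemma summable_inverse_Suc_square: "summable (\<lambda>k. 1 / (real (Suc k))\<^sup>2)"
proof -
  have "summable (\<lambda>k. inverse ((real k)\<^sup>2))" by (rule inverse_power_summable) simp
  then show ?thesis by (subst (asm) summable_Suc_iff[symmetric]) (simp only: inverse_eq_divide)
qed

lemma summable_frequency_square_over_eig:
  assumes \<gamma>: "\<gamma> > 0"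
  shows "summable (\<lambda>k. (freq k)\<^sup>2 / eig \<gamma> k)"
proof (rule summable_comparison_test')
  show "summable (\<lambda>k. 1 / (\<gamma> * pi\<^sup>2) * (1 / (real (Suc k))\<^sup>2))"
    by (intro summable_mult summable_inverse_Suc_square)
  fix k :: nat
  have "(freq k)\<^sup>2 / eig \<gamma> k \<le> (freq k)\<^sup>2 / (\<gamma> * pi ^ 4 * real (Suc k) ^ 4)"
    using \<gamma> eig_lower[of \<gamma> k] by (intro divide_left_mono) (auto intro!: mult_pos_pos eig_pos simp del: of_nat_Suc)
  also have "\<dots> = 1 / (\<gamma> * pi\<^sup>2) * (1 / (real (Suc k))\<^sup>2)"
    by (simp add: field_simps eval_nat_numeral del: of_nat_Suc)
  finally show "norm ((freq k)\<^sup>2 / eig \<gamma> k) \<le> 1 / (\<gamma> * pi\<^sup>2) * (1 / (real (Suc k))\<^sup>2)"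
    using eig_pos[OF \<gamma>, of k] by simp
qed

lemma summable_power_over_eig:
  assumes \<gamma>: "\<gamma> > 0" and n: "n \<le> 2"
  shows "summable (\<lambda>k. freq k ^ n / eig \<gamma> k)"
proof (rule summable_comparison_test'[OF summable_frequency_square_over_eig[OF \<gamma>]])
  fix k :: nat
  have "freq k ^ n \<le> (freq k)\<^sup>2"
    by (rule power_increasing[OF n frequency_ge_1])
  then show "norm (freq k ^ n / eig \<gamma> k) \<le> (freq k)\<^sup>2 / eig \<gamma> k"
    using eig_pos[OF \<gamma>, of k] by (simp add: divide_right_mono abs_mult del: of_nat_Suc)
qed

lemma summable_inverse_eig: "\<gamma> > 0 \<Longrightarrow> summable (\<lambda>k. 1 / eig \<gamma> k)"
  using summable_power_over_eig[of \<gamma> 0] by simp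

text \<open>
  The \<open>k\<close>-th coefficient of the periodic solution of \<open>u\<^sub>t + A u = F\<close>, obtained by projecting the equation on
  \<open>mode k\<close>.
\<close>

definition sol_coef :: "real \<Rightarrow> real \<Rightarrow> (real \<Rightarrow> real \<Rightarrow> real) \<Rightarrow> nat \<Rightarrow> real \<Rightarrow> real" where
  "sol_coef \<gamma> \<omega> F k = (SOME q. (\<forall>t. q (t + \<omega>) = q t) \<and>
     (\<forall>t. (q has_real_derivative sine_coef k (F t) - eig \<gamma> k * q t) (at t)))"

text \<open>
  The periodic solution of \<open>u\<^sub>t + A u = F\<close>.  The series converges absolutely for every continuous forcing;
  Hoelder continuity of the forcing in time makes it a classical solution.
\<close>

definition sol :: "real \<Rightarrow> real \<Rightarrow> (real \<Rightarrow> real \<Rightarrow> real) \<Rightarrow> real \<Rightarrow> real \<Rightarrow> real" where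
  "sol \<gamma> \<omega> F t x = (\<Sum>k. sol_coef \<gamma> \<omega> F k t * mode k x)"

lemma term_by_term_derivative:
  fixes f f' :: "nat \<Rightarrow> real \<Rightarrow> real"
  assumes "\<And>k x. (f k has_real_derivative f' k x) (at x)" "\<And>k x. \<bar>f' k x\<bar> \<le> M k" "summable M"
    and "summable (\<lambda>k. f k x0)"
  shows "((\<lambda>x. \<Sum>k. f k x) has_real_derivative (\<Sum>k. f' k x)) (at x)"
proof (rule has_field_derivative_series'[where S=UNIV])
  show "uniformly_convergent_on UNIV (\<lambda>n x. \<Sum>i<n. f' i x)"
    by (rule Weierstrass_m_test') (use assms in auto)
qed (use assms in auto)

definition sol_coef_dt :: "real \<Rightarrow> real \<Rightarrow> (real \<Rightarrow> real \<Rightarrow> real) \<Rightarrow> nat \<Rightarrow> real \<Rightarrow> real" where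
  "sol_coef_dt \<gamma> \<omega> F k t = sine_coef k (F t) - eig \<gamma> k * sol_coef \<gamma> \<omega> F k t"

definition sol_x :: "real \<Rightarrow> real \<Rightarrow> (real \<Rightarrow> real \<Rightarrow> real) \<Rightarrow> real \<Rightarrow> real \<Rightarrow> real" where
  "sol_x \<gamma> \<omega> F t x = (\<Sum>k. sol_coef \<gamma> \<omega> F k t * (freq k * cos (freq k * x)))"

definition sol_xx :: "real \<Rightarrow> real \<Rightarrow> (real \<Rightarrow> real \<Rightarrow> real) \<Rightarrow> real \<Rightarrow> real \<Rightarrow> real" where
  "sol_xx \<gamma> \<omega> F t x = (\<Sum>k. - (freq k)\<^sup>2 * sol_coef \<gamma> \<omega> F k t * mode k x)"

text \<open>
  The time derivative of the solution regularised by the semigroup, \<open>exp (- \<epsilon> A) u\<^sub>t\<close>.  For \<open>\<epsilon> = 0\<close> the series need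
  not converge absolutely.
\<close>

definition smooth_dt :: "real \<Rightarrow> real \<Rightarrow> (real \<Rightarrow> real \<Rightarrow> real) \<Rightarrow> real \<Rightarrow> real \<Rightarrow> real \<Rightarrow> real" where
  "smooth_dt \<gamma> \<omega> F \<epsilon> t x = (\<Sum>k. exp (- \<epsilon> * eig \<gamma> k) * sol_coef_dt \<gamma> \<omega> F k t * mode k x)"

lemma exp_minus_le_inverse:
  assumes "y > (0::real)" shows "exp (- y) \<le> 1 / y" "y * exp (- y) \<le> 2 / y" "y\<^sup>2 * exp (- y) \<le> 6 / y"
proof -
  have "y ^ n * exp (- y) \<le> fact (Suc n) / y" for n
    using power_times_exp_minus_le[of y "Suc n"] assms by (simp add: pos_le_divide_eq mult_ac)
  from this[of 0] this[of 1] this[of 2]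
  show "exp (- y) \<le> 1 / y" "y * exp (- y) \<le> 2 / y" "y\<^sup>2 * exp (- y) \<le> 6 / y"
    by (simp_all add: fact_numeral eval_nat_numeral)
qed

lemma summable_inverse_sqrt_eig:
  assumes \<gamma>: "\<gamma> > 0" shows "summable (\<lambda>k. 1 / sqrt (eig \<gamma> k))"
proof (rule summable_comparison_test')
  show "summable (\<lambda>k. 1 / (sqrt \<gamma> * pi\<^sup>2) * (1 / (real (Suc k))\<^sup>2))"
    by (intro summable_mult summable_inverse_Suc_square)
  fix k :: nat
  have "sqrt (\<gamma> * pi ^ 4 * real (Suc k) ^ 4) \<le> sqrt (eig \<gamma> k)" using eig_lower by (rule real_sqrt_le_mono)
  also have "sqrt (\<gamma> * pi ^ 4 * real (Suc k) ^ 4) = sqrt \<gamma> * pi\<^sup>2 * (real (Suc k))\<^sup>2"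
  proof -
    have "pi ^ 4 * real (Suc k) ^ 4 = (pi\<^sup>2 * (real (Suc k))\<^sup>2)\<^sup>2" by (simp add: power_mult_distrib)
    then show ?thesis by (simp add: real_sqrt_mult mult.assoc del: of_nat_Suc)
  qed
  finally have "1 / sqrt (eig \<gamma> k) \<le> 1 / (sqrt \<gamma> * pi\<^sup>2 * (real (Suc k))\<^sup>2)"
    using \<gamma> by (intro divide_left_mono) (auto intro!: mult_pos_pos eig_pos simp del: of_nat_Suc)
  then show "norm (1 / sqrt (eig \<gamma> k)) \<le> 1 / (sqrt \<gamma> * pi\<^sup>2) * (1 / (real (Suc k))\<^sup>2)"
    using eig_pos[OF \<gamma>, of k] by simp
qed

text \<open>
  Integration of a bound of a derivative, in the form in which power singularities at \<open>0\<close> occur below.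
\<close>

lemma powr_comparison_bound:
  fixes f f' :: "real \<Rightarrow> real"
  assumes ab: "0 < a" "a < b" and p: "p \<noteq> -1" and der: "\<And>x. a \<le> x \<Longrightarrow> x \<le> b \<Longrightarrow> (f has_real_derivative f' x) (at x)"
    and le: "\<And>x. a < x \<Longrightarrow> x < b \<Longrightarrow> \<bar>f' x\<bar> \<le> K * x powr p + R"
  shows "\<bar>f b - f a\<bar> \<le> K * (b powr (p + 1) - a powr (p + 1)) / (p + 1) + R * (b - a)"
proof -
  let ?g = "\<lambda>x. K * x powr (p + 1) / (p + 1) + R * x"
  have g: "(?g has_real_derivative K * x powr p + R) (at x)" if "a \<le> x" for x
  proof -
    have "((\<lambda>x. x powr (p + 1)) has_real_derivative (p + 1) * x powr p) (at x)"
      using has_real_derivative_powr[of x "p + 1"] ab that by simp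
    then have "(?g has_real_derivative K * ((p + 1) * x powr p) / (p + 1) + R * 1) (at x)"
      by (intro DERIV_add DERIV_cdivide DERIV_cmult DERIV_ident)
    moreover have "p + 1 \<noteq> 0" using p by simp
    ultimately show ?thesis by simp
  qed
  have "norm (f b - f a) \<le> ?g b - ?g a"
  proof (rule differentiable_bound_general[OF ab(2)])
    show "continuous_on {a..b} f" using der by (meson DERIV_isCont atLeastAtMost_iff continuous_at_imp_continuous_on)
    show "continuous_on {a..b} ?g" using g by (meson DERIV_isCont atLeastAtMost_iff continuous_at_imp_continuous_on)
    show "(f has_vector_derivative f' x) (at x)" if "a < x" "x < b" for x
      using der[of x] that by (simp add: has_real_derivative_iff_has_vector_derivative)
    show "(?g has_vector_derivative K * x powr p + R) (at x)" if "a < x" "x < b" for x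
      using g[of x] that by (simp add: has_real_derivative_iff_has_vector_derivative)
    show "norm (f' x) \<le> K * x powr p + R" if "a < x" "x < b" for x
      using le that by simp
  qed
  then show ?thesis by (simp add: algebra_simps diff_divide_distrib)
qed

lemma heat2_antimono: "s \<le> t \<Longrightarrow> \<gamma> > 0 \<Longrightarrow> heat2 \<gamma> t k \<le> heat2 \<gamma> s k"
  unfolding heat2_def using eig_pos[of \<gamma> k] by (intro mult_left_mono) auto

lemma heat2_nonneg: "0 \<le> heat2 \<gamma> t k"
  unfolding heat2_def by simp

lemma heat2_tendsto_0:
  assumes \<gamma>: "\<gamma> > 0" and t: "t > 0"
  shows "heat2 \<gamma> t \<longlonglongrightarrow> 0"
proof (rule summable_LIMSEQ_zero, rule summable_comparison_test'[OF summable_mult[OF summable_inverse_eig[OF \<gamma>], of "6 / t ^ 3"]])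
  fix k
  have "(eig \<gamma> k * t)\<^sup>2 * exp (- (eig \<gamma> k * t)) \<le> 6 / (eig \<gamma> k * t)"
    using eig_pos[OF \<gamma>, of k] t by (intro exp_minus_le_inverse) simp
  then have "heat2 \<gamma> t k * t\<^sup>2 \<le> 6 / (eig \<gamma> k * t)"
    unfolding heat2_def by (simp add: power_mult_distrib mult_ac)
  then have "heat2 \<gamma> t k \<le> 6 / (eig \<gamma> k * t) / t\<^sup>2"
    using t by (subst pos_le_divide_eq) auto
  then show "norm (heat2 \<gamma> t k) \<le> 6 / t ^ 3 * (1 / eig \<gamma> k)"
    using heat2_nonneg[of \<gamma> t k] by (simp add: eval_nat_numeral mult_ac)
qed

section \<open>Classical solutions from explicit derivatives\<close>

lemma continuous_on_slice:
  fixes h :: "real \<Rightarrow> real \<Rightarrow> real"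
  assumes "continuous_on (T \<times> S) (\<lambda>(t, x). h t x)" "t \<in> T"
  shows "continuous_on S (h t)"
proof -
  have "continuous_on S (\<lambda>x. (t, x))" by (intro continuous_intros)
  from continuous_on_compose2[OF assms(1) this] show ?thesis using assms(2) by auto
qed

text \<open>
  Let \<open>P\<close> be the second antiderivative of \<open>G\<close> that vanishes at both end points.  Integration by parts shows that
  it has the same sine coefficients as \<open>w\<close>, so \<open>w = P\<close> by completeness.  This recovers the fourth space derivative
  of the solution without any convergence of its formal series.
\<close>

lemma second_derivative_from_sine_coefs:
  assumes G: "continuous_on {0..1} G" and w: "continuous_on {0..1} w"
    and coef: "\<And>k. - (freq k)\<^sup>2 * sine_coef k w = sine_coef k G"
  shows "\<exists>w'. \<forall>x\<in>{0..1}. (w has_real_derivative w' x) (at x within {0..1}) \<and>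
    (w' has_real_derivative G x) (at x within {0..1})"
proof -
  define I1 where "I1 x = integral {0..x} G" for x
  have I1: "(I1 has_real_derivative G x) (at x within {0..1})" if "x \<in> {0..1}" for x
    unfolding I1_def[abs_def] by (rule integral_has_real_derivative[OF G that])
  have cI1: "continuous_on {0..1} I1" using I1 by (rule DERIV_continuous_on)
  define I2 where "I2 x = integral {0..x} I1" for x
  have I2: "(I2 has_real_derivative I1 x) (at x within {0..1})" if "x \<in> {0..1}" for x
    unfolding I2_def[abs_def] by (rule integral_has_real_derivative[OF cI1 that])
  define P where "P x = I2 x - I2 1 * x" for x
  define P' where "P' x = I1 x - I2 1" for x
  have P: "(P has_real_derivative P' x) (at x within {0..1})" if "x \<in> {0..1}" for x
    unfolding P_def[abs_def] P'_def by (auto intro!: derivative_eq_intros I2 that)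
  have P': "(P' has_real_derivative G x) (at x within {0..1})" if "x \<in> {0..1}" for x
    unfolding P'_def[abs_def] by (auto intro!: derivative_eq_intros I1 that)
  have cP: "continuous_on {0..1} P" using P by (rule DERIV_continuous_on)
  have P0: "P 0 = 0" "P 1 = 0" by (simp_all add: P_def I2_def)
  have "integral {0..1} (\<lambda>x. (w x - P x) * mode k x) = 0" for k
  proof -
    define m where "m = freq k"
    have m: "m > 0" by (simp add: m_def)
    have sin1: "sin m = 0" unfolding m_def by (rule sin_npi)
    have i: "((\<lambda>x. G x * mode k x + m\<^sup>2 * (P x * mode k x)) has_integral
        (P' 1 * sin (m * 1) - m * P 1 * cos (m * 1)) - (P' 0 * sin (m * 0) - m * P 0 * cos (m * 0))) {0..1}"
    proof (rule fundamental_theorem_of_calculus)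
      fix x :: real assume x: "x \<in> {0..1}"
      show "((\<lambda>x. P' x * sin (m * x) - m * P x * cos (m * x)) has_vector_derivative G x * mode k x + m\<^sup>2 * (P x * mode k x)) (at x within {0..1})"
        unfolding has_real_derivative_iff_has_vector_derivative [symmetric] mode_def m_def[symmetric]
        by (auto intro!: derivative_eq_intros P[OF x] P'[OF x] simp: algebra_simps power2_eq_square)
    qed simp
    have "((\<lambda>x. G x * mode k x + m\<^sup>2 * (P x * mode k x)) has_integral sine_coef k G / 2 + m\<^sup>2 * (sine_coef k P / 2)) {0..1}"
      by (intro has_integral_add has_integral_mult_right has_integral_sine_coef G cP)
    from has_integral_unique[OF this i] have "sine_coef k G + m\<^sup>2 * sine_coef k P = 0"
      by (simp add: P0 sin1)
    then have "m\<^sup>2 * (sine_coef k w - sine_coef k P) = 0"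
      using coef[of k] unfolding m_def[symmetric] right_diff_distrib by linarith
    then have "sine_coef k w - sine_coef k P = 0" using m by simp
    then have "sine_coef k (\<lambda>x. w x - P x) = 0" by (simp add: sine_coef_diff w cP)
    then show ?thesis by (simp add: sine_coef_def)
  qed
  then have eq: "w x - P x = 0" if "x \<in> {0..1}" for x
    using sine_system_complete[of "\<lambda>x. w x - P x" x] that w cP by (auto intro!: continuous_intros)
  have "(w has_real_derivative P' x) (at x within {0..1})" if x: "x \<in> {0..1}" for x
    by (rule has_field_derivative_transform_within[OF P[OF x] zero_less_one x]) (use eq in force)
  with P' show ?thesis by blast
qed

lemma Dx_eq:
  assumes eq: "\<And>y. y \<in> {0..1} \<Longrightarrow> v y = w y" and w: "(w has_real_derivative d) (at x within {0..1})" and x: "x \<in> {0..1}"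
  shows "Dx v x = d" and "v differentiable (at x within {0..1})"
proof -
  have v: "(v has_real_derivative d) (at x within {0..1})"
    by (rule has_field_derivative_transform_within[OF w zero_less_one x]) (use eq in auto)
  then show "v differentiable (at x within {0..1})"
    by (meson differentiableI has_field_derivative_def)
  from v have "(v has_vector_derivative d) (at x within {0..1})"
    by (simp add: has_real_derivative_iff_has_vector_derivative)
  from vector_derivative_within_closed_interval[OF zero_less_one x this]
  show "Dx v x = d" unfolding Dx_def .
qed

lemma efk_classical_solutionI:
  fixes u ut ux uxx u3 u4 :: "real \<Rightarrow> real \<Rightarrow> real"
  assumes ut: "\<And>t x. x \<in> {0..1} \<Longrightarrow> ((\<lambda>s. u s x) has_real_derivative ut t x) (at t)"
    and ux: "\<And>t x. x \<in> {0..1} \<Longrightarrow> (u t has_real_derivative ux t x) (at x within {0..1})"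
    and uxx: "\<And>t x. x \<in> {0..1} \<Longrightarrow> (ux t has_real_derivative uxx t x) (at x within {0..1})"
    and u3: "\<And>t x. x \<in> {0..1} \<Longrightarrow> (uxx t has_real_derivative u3 t x) (at x within {0..1})"
    and u4: "\<And>t x. x \<in> {0..1} \<Longrightarrow> (u3 t has_real_derivative u4 t x) (at x within {0..1})"
    and cu: "continuous_on (UNIV \<times> {0..1}) (\<lambda>(t, x). u t x)"
    and cut: "continuous_on (UNIV \<times> {0..1}) (\<lambda>(t, x). ut t x)"
    and cux: "continuous_on (UNIV \<times> {0..1}) (\<lambda>(t, x). ux t x)"
    and cuxx: "continuous_on (UNIV \<times> {0..1}) (\<lambda>(t, x). uxx t x)"
    and pde: "\<And>t x. x \<in> {0<..<1} \<Longrightarrow> ut t x + \<gamma> * u4 t x - uxx t x - u t x = g t x + f (\<chi> k. u (t - \<tau> k) x)"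
    and bc: "\<And>t. u t 0 = 0" "\<And>t. u t 1 = 0" "\<And>t. uxx t 0 = 0" "\<And>t. uxx t 1 = 0"
  shows "efk_classical_solution UNIV \<gamma> \<tau> f g u"
proof -
  have Dt: "Dt UNIV u t x = ut t x" "(\<lambda>s. u s x) differentiable (at t)" if "x \<in> {0..1}" for t x
    using ut[OF that, of t] unfolding Dt_def
    by (auto simp: has_real_derivative_iff_has_vector_derivative vector_derivative_at intro: differentiableI_vector)
  have D1: "Dx (u t) x = ux t x" "u t differentiable (at x within {0..1})" if "x \<in> {0..1}" for t x
    using Dx_eq[OF refl ux[OF that] that] by blast+
  have D2: "(Dx ^^ 2) (u t) x = uxx t x" "Dx (u t) differentiable (at x within {0..1})" if "x \<in> {0..1}" for t x
    using Dx_eq[OF D1(1) uxx[OF that] that] by (simp_all add: numeral_2_eq_2)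
  have D3: "(Dx ^^ 3) (u t) x = u3 t x" "(Dx ^^ 2) (u t) differentiable (at x within {0..1})" if "x \<in> {0..1}" for t x
    using Dx_eq[OF D2(1) u3[OF that] that] by (simp_all add: numeral_3_eq_3 numeral_2_eq_2)
  have D4: "(Dx ^^ 4) (u t) x = u4 t x" "(Dx ^^ 3) (u t) differentiable (at x within {0..1})" if "x \<in> {0..1}" for t x
    using Dx_eq[OF D3(1) u4[OF that] that] by (simp_all add: eval_nat_numeral)
  have interior: "at x within {0..1} = at x" if "x \<in> {0<..<1}" for x :: real
    using that by (simp add: at_within_Icc_at)
  show ?thesis
    unfolding efk_classical_solution_def C12_def
  proof (intro conjI ballI)
    fix t x :: real assume x: "x \<in> {0..1}"
    show "(\<lambda>s. u s x) differentiable at t" by (rule Dt(2)[OF x])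
    show "u t differentiable at x within {0..1}" by (rule D1(2)[OF x])
    show "Dx (u t) differentiable at x within {0..1}" by (rule D2(2)[OF x])
  next
    show "continuous_on (UNIV \<times> {0..1}) (\<lambda>(t, x). u t x)" by (rule cu)
    show "continuous_on (UNIV \<times> {0..1}) (\<lambda>(t, x). Dt UNIV u t x)"
      by (rule continuous_on_eq[OF cut]) (auto simp: Dt)
    show "continuous_on (UNIV \<times> {0..1}) (\<lambda>(t, x). Dx (u t) x)"
      by (rule continuous_on_eq[OF cux]) (auto simp: D1)
    show "continuous_on (UNIV \<times> {0..1}) (\<lambda>(t, x). (Dx ^^ 2) (u t) x)"
      by (rule continuous_on_eq[OF cuxx]) (auto simp: D2)
  next
    fix t x :: real assume x: "x \<in> {0<..<1}"
    then have x': "x \<in> {0..1}" by simp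
    show "(Dx ^^ 2) (u t) differentiable at x" using D3(2)[OF x'] interior[OF x] by simp
    show "(Dx ^^ 3) (u t) differentiable at x" using D4(2)[OF x'] interior[OF x] by simp
    show "Dt UNIV u t x + \<gamma> * (Dx ^^ 4) (u t) x - (Dx ^^ 2) (u t) x - u t x = g t x + f (\<chi> k. u (t - \<tau> k) x)"
      unfolding Dt(1)[OF x'] D2(1)[OF x'] D4(1)[OF x'] by (rule pde[OF x])
  next
    fix t :: real
    show "u t 0 = 0" "u t 1 = 0" by (rule bc)+
    show "(Dx ^^ 2) (u t) 0 = 0" "(Dx ^^ 2) (u t) 1 = 0" using bc by (simp_all add: D2)
  qed
qed

section \<open>The periodic solution operator and its fixed points\<close>

context
  fixes \<gamma> \<omega> :: real
  assumes \<gamma>: "\<gamma> > 0" and \<omega>: "\<omega> > 0"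
begin

lemma sol_coef:
  assumes "admissible \<omega> F"
  shows sol_coef_periodic: "sol_coef \<gamma> \<omega> F k (t + \<omega>) = sol_coef \<gamma> \<omega> F k t"
    and sol_coef_derivative: "(sol_coef \<gamma> \<omega> F k has_real_derivative
      sine_coef k (F t) - eig \<gamma> k * sol_coef \<gamma> \<omega> F k t) (at t)"
proof -
  have "\<exists>q. (\<forall>t. q (t + \<omega>) = q t) \<and>
     (\<forall>t. (q has_real_derivative sine_coef k (F t) - eig \<gamma> k * q t) (at t))"
    by (rule periodic_linear_ode[OF \<omega> eig_pos[OF \<gamma>]]) (use admissible_sine_coef[OF assms] in auto)
  from someI_ex[OF this] show "sol_coef \<gamma> \<omega> F k (t + \<omega>) = sol_coef \<gamma> \<omega> F k t"
    and "(sol_coef \<gamma> \<omega> F k has_real_derivative sine_coef k (F t) - eig \<gamma> k * sol_coef \<gamma> \<omega> F k t) (at t)"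
    unfolding sol_coef_def by blast+
qed

lemma sol_coef_diff_bound:
  assumes F: "admissible \<omega> F" and G: "admissible \<omega> G"
    and D: "\<And>t. \<bar>sine_coef k (F t) - sine_coef k (G t)\<bar> \<le> D"
  shows "\<bar>sol_coef \<gamma> \<omega> F k t - sol_coef \<gamma> \<omega> G k t\<bar> \<le> D / eig \<gamma> k"
proof (rule abs_leI)
  let ?F = "sol_coef \<gamma> \<omega> F k" and ?G = "sol_coef \<gamma> \<omega> G k"
  show "?F t - ?G t \<le> D / eig \<gamma> k"
  proof (rule periodic_differential_inequality[where e="\<lambda>t. ?F t - ?G t"
        and e'="\<lambda>t. (sine_coef k (F t) - eig \<gamma> k * ?F t) - (sine_coef k (G t) - eig \<gamma> k * ?G t)", OF \<omega> _ _ eig_pos[OF \<gamma>]])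
    show "?F (t + \<omega>) - ?G (t + \<omega>) = ?F t - ?G t" for t using F G by (simp add: sol_coef_periodic)
    show "((\<lambda>t. ?F t - ?G t) has_real_derivative (sine_coef k (F t) - eig \<gamma> k * ?F t) - (sine_coef k (G t) - eig \<gamma> k * ?G t)) (at t)" for t
      by (intro DERIV_diff sol_coef_derivative F G)
    show "(sine_coef k (F t) - eig \<gamma> k * ?F t) - (sine_coef k (G t) - eig \<gamma> k * ?G t) \<le> - eig \<gamma> k * (?F t - ?G t) + D" for t
      using D[of t] by (simp add: algebra_simps)
  qed
  have "?G t - ?F t \<le> D / eig \<gamma> k"
  proof (rule periodic_differential_inequality[where e="\<lambda>t. ?G t - ?F t"
        and e'="\<lambda>t. (sine_coef k (G t) - eig \<gamma> k * ?G t) - (sine_coef k (F t) - eig \<gamma> k * ?F t)", OF \<omega> _ _ eig_pos[OF \<gamma>]])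
    show "?G (t + \<omega>) - ?F (t + \<omega>) = ?G t - ?F t" for t using F G by (simp add: sol_coef_periodic)
    show "((\<lambda>t. ?G t - ?F t) has_real_derivative (sine_coef k (G t) - eig \<gamma> k * ?G t) - (sine_coef k (F t) - eig \<gamma> k * ?F t)) (at t)" for t
      by (intro DERIV_diff sol_coef_derivative F G)
    show "(sine_coef k (G t) - eig \<gamma> k * ?G t) - (sine_coef k (F t) - eig \<gamma> k * ?F t) \<le> - eig \<gamma> k * (?G t - ?F t) + D" for t
      using D[of t] by (simp add: algebra_simps)
  qed
  then show "- (?F t - ?G t) \<le> D / eig \<gamma> k" by simp
qed

lemma sol_coef_bound:
  assumes F: "admissible \<omega> F" and M: "\<And>t x. x \<in> {0..1} \<Longrightarrow> \<bar>F t x\<bar> \<le> M"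
  shows "\<bar>sol_coef \<gamma> \<omega> F k t\<bar> \<le> 2 * M / eig \<gamma> k"
proof -
  let ?F = "sol_coef \<gamma> \<omega> F k"
  have c: "\<bar>sine_coef k (F t)\<bar> \<le> 2 * M" for t
    by (rule abs_sine_coef_le[OF admissible_continuous_x[OF F] M])
  have "?F t \<le> 2 * M / eig \<gamma> k"
    by (rule periodic_differential_inequality[where e="?F", OF \<omega> sol_coef_periodic[OF F] sol_coef_derivative[OF F] eig_pos[OF \<gamma>]])
      (use c in \<open>simp add: abs_le_iff\<close>)
  moreover have "- ?F t \<le> 2 * M / eig \<gamma> k"
    by (rule periodic_differential_inequality[where e="\<lambda>t. - ?F t", OF \<omega> _ DERIV_minus[OF sol_coef_derivative[OF F]] eig_pos[OF \<gamma>]])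
      (use c in \<open>simp_all add: abs_le_iff sol_coef_periodic[OF F] minus_le_iff\<close>)
  ultimately show ?thesis by (simp add: abs_le_iff)
qed

lemma summable_sol_coef:
  assumes F: "admissible \<omega> F"
  shows "summable (\<lambda>k. \<bar>sol_coef \<gamma> \<omega> F k t\<bar>)"
proof -
  obtain M where M: "\<forall>t. \<forall>x\<in>{0..1}. \<bar>F t x\<bar> \<le> M" using admissible_bounded[OF \<omega> F] by blast
  show ?thesis
  proof (rule summable_comparison_test')
    show "summable (\<lambda>k. 2 * M * (1 / eig \<gamma> k))" by (intro summable_mult summable_inverse_eig \<gamma>)
    show "norm \<bar>sol_coef \<gamma> \<omega> F k t\<bar> \<le> 2 * M * (1 / eig \<gamma> k)" for k
      using sol_coef_bound[OF F, of M k t] M by simp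
  qed
qed

lemma admissible_sol:
  assumes F: "admissible \<omega> F"
  shows "continuous_on UNIV (\<lambda>(t, x). sol \<gamma> \<omega> F t x)" and "admissible \<omega> (sol \<gamma> \<omega> F)"
proof -
  obtain M where M: "\<forall>t. \<forall>x\<in>{0..1}. \<bar>F t x\<bar> \<le> M" using admissible_bounded[OF \<omega> F] by blast
  have c: "continuous_on UNIV (sol_coef \<gamma> \<omega> F k)" for k
    using sol_coef_derivative[OF F] by (meson DERIV_isCont continuous_at_imp_continuous_on)
  have "continuous_on UNIV (\<lambda>p. \<Sum>k. sol_coef \<gamma> \<omega> F k (fst p) * mode k (snd p))"
  proof (rule continuous_on_sine_series)
    show "summable (\<lambda>k. 2 * M * (1 / eig \<gamma> k))" by (intro summable_mult summable_inverse_eig \<gamma>)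
    show "\<bar>sol_coef \<gamma> \<omega> F k (fst p)\<bar> \<le> 2 * M * (1 / eig \<gamma> k)" for k and p :: "real \<times> real"
      using sol_coef_bound[OF F, of M k] M by simp
    show "continuous_on UNIV (\<lambda>p. sol_coef \<gamma> \<omega> F k (fst p))" for k
      by (rule continuous_on_compose2[OF c]) (auto intro!: continuous_intros)
  qed (auto intro!: continuous_intros)
  then show 1: "continuous_on UNIV (\<lambda>(t, x). sol \<gamma> \<omega> F t x)"
    by (simp add: sol_def case_prod_unfold)
  show "admissible \<omega> (sol \<gamma> \<omega> F)"
    unfolding admissible_def time_periodic_def
  proof
    show "continuous_on (UNIV \<times> {0..1}) (\<lambda>(t, x). sol \<gamma> \<omega> F t x)" by (rule continuous_on_subset[OF 1]) simp
  qed (simp add: sol_def sol_coef_periodic[OF F])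
qed

lemma sol_diff:
  assumes F: "admissible \<omega> F" and G: "admissible \<omega> G"
  shows "sol \<gamma> \<omega> F t x - sol \<gamma> \<omega> G t x = (\<Sum>k. (sol_coef \<gamma> \<omega> F k t - sol_coef \<gamma> \<omega> G k t) * mode k x)"
proof -
  have s: "summable (\<lambda>k. sol_coef \<gamma> \<omega> F k t * mode k x)" if "admissible \<omega> F" for F
    by (rule summable_comparison_test'[OF summable_sol_coef[OF that]])
      (use abs_mode_le_1 in \<open>auto simp: abs_mult intro!: mult_left_le\<close>)
  show ?thesis unfolding sol_def left_diff_distrib by (rule suminf_diff[OF s[OF F] s[OF G]])
qed

lemma sol_diff_sup:
  assumes F: "admissible \<omega> F" and G: "admissible \<omega> G"
    and D: "\<And>t k. \<bar>sine_coef k (F t) - sine_coef k (G t)\<bar> \<le> D"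
  shows "\<bar>sol \<gamma> \<omega> F t x - sol \<gamma> \<omega> G t x\<bar> \<le> D * (\<Sum>k. 1 / eig \<gamma> k)"
proof -
  have s: "summable (\<lambda>k. D * (1 / eig \<gamma> k))" by (intro summable_mult summable_inverse_eig \<gamma>)
  have "norm (\<Sum>k. (sol_coef \<gamma> \<omega> F k t - sol_coef \<gamma> \<omega> G k t) * mode k x) \<le> (\<Sum>k. D * (1 / eig \<gamma> k))"
  proof (rule norm_suminf_le[OF _ s])
    fix k
    have "\<bar>(sol_coef \<gamma> \<omega> F k t - sol_coef \<gamma> \<omega> G k t)\<bar> * \<bar>mode k x\<bar> \<le> D / eig \<gamma> k * 1"
      using sol_coef_diff_bound[OF F G D, of k t] abs_mode_le_1 by (intro mult_mono) auto
    then show "norm ((sol_coef \<gamma> \<omega> F k t - sol_coef \<gamma> \<omega> G k t) * mode k x) \<le> D * (1 / eig \<gamma> k)"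
      by (simp add: abs_mult)
  qed
  then show ?thesis unfolding sol_diff[OF F G]
    by (simp only: suminf_mult[OF summable_inverse_eig[OF \<gamma>]] real_norm_def)
qed

lemma bessel_diff:
  assumes F: "admissible \<omega> F" and G: "admissible \<omega> G"
    and Q: "L2_dist_sq F G t \<le> Q"
  shows "(\<Sum>k<N. (sine_coef k (F t) - sine_coef k (G t))\<^sup>2) \<le> 2 * Q"
proof -
  have "(\<Sum>k<N. (sine_coef k (\<lambda>x. F t x - G t x))\<^sup>2) / 2 \<le> Q"
    by (rule order_trans[OF bessel_inequality Q])
      (intro continuous_intros admissible_continuous_x[OF F] admissible_continuous_x[OF G])
  then show ?thesis
    using sine_coef_diff[OF admissible_continuous_x[OF F] admissible_continuous_x[OF G]] by simp
qed

text \<open>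
  The energy estimate for the difference of two solutions, done on partial sums, where it is a statement about
  finitely many ordinary differential equations.  The smallest eigenvalue yields the sharp constant \<open>1 / eig \<gamma> 0\<close> for the \<open>L\<^sup>2\<close> norm, which
  is what makes the smallness condition of the theorem sufficient.
\<close>

lemma sol_diff_L2:
  assumes F: "admissible \<omega> F" and G: "admissible \<omega> G"
    and Q: "\<And>t. L2_dist_sq F G t \<le> Q"
  shows "integral {0..1} (\<lambda>x. (sol \<gamma> \<omega> F t x - sol \<gamma> \<omega> G t x)\<^sup>2) \<le> Q / (eig \<gamma> 0)\<^sup>2"
proof -
  define l where "l = eig \<gamma> 0"
  have l: "l > 0" using eig_pos[OF \<gamma>] by (simp add: l_def)
  let ?d = "\<lambda>k t. sol_coef \<gamma> \<omega> F k t - sol_coef \<gamma> \<omega> G k t"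
  let ?c = "\<lambda>k t. sine_coef k (F t) - sine_coef k (G t)"
  have "(\<Sum>k<N. (?d k t)\<^sup>2) \<le> (2 * Q / l) / l" for N t
  proof (rule periodic_differential_inequality[where e="\<lambda>t. \<Sum>k<N. (?d k t)\<^sup>2"
        and e'="\<lambda>t. \<Sum>k<N. 2 * ?d k t * (?c k t - eig \<gamma> k * ?d k t)", OF \<omega> _ _ l])
    show "(\<Sum>k<N. (?d k (t + \<omega>))\<^sup>2) = (\<Sum>k<N. (?d k t)\<^sup>2)" for t
      using F G by (simp add: sol_coef_periodic)
    have dd: "(?d k has_real_derivative ?c k t - eig \<gamma> k * ?d k t) (at t)" for k t
      by (rule DERIV_cong[OF DERIV_diff[OF sol_coef_derivative[OF F] sol_coef_derivative[OF G]]])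
        (simp add: algebra_simps)
    show "((\<lambda>t. \<Sum>k<N. (?d k t)\<^sup>2) has_real_derivative (\<Sum>k<N. 2 * ?d k t * (?c k t - eig \<gamma> k * ?d k t))) (at t)" for t
    proof (rule DERIV_sum)
      fix k
      show "((\<lambda>t. (?d k t)\<^sup>2) has_real_derivative 2 * ?d k t * (?c k t - eig \<gamma> k * ?d k t)) (at t)"
        by (rule DERIV_cong[OF DERIV_power[OF dd]]) simp
    qed
    show "(\<Sum>k<N. 2 * ?d k t * (?c k t - eig \<gamma> k * ?d k t)) \<le> - l * (\<Sum>k<N. (?d k t)\<^sup>2) + 2 * Q / l" for t
    proof -
      have "2 * d * (c - e * d) \<le> - l * d\<^sup>2 + c\<^sup>2 / l" if "l \<le> e" for d c e :: real
      proof -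
        have "0 \<le> (l * d - c)\<^sup>2 / l" using l by simp
        also have "\<dots> = l * d\<^sup>2 - 2 * d * c + c\<^sup>2 / l"
          using l by (simp add: power2_diff power_mult_distrib diff_divide_distrib add_divide_distrib power2_eq_square[of l])
        finally have "2 * d * c \<le> l * d\<^sup>2 + c\<^sup>2 / l" by simp
        moreover have "l * d\<^sup>2 \<le> e * d\<^sup>2" using that by (rule mult_right_mono) simp
        ultimately show ?thesis by (simp add: algebra_simps power2_eq_square)
      qed
      from this[OF eig_ge_eig_0[OF \<gamma>, folded l_def]]
      have "(\<Sum>k<N. 2 * ?d k t * (?c k t - eig \<gamma> k * ?d k t)) \<le> (\<Sum>k<N. - l * (?d k t)\<^sup>2 + (?c k t)\<^sup>2 / l)"
        by (intro sum_mono)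
      also have "\<dots> = - l * (\<Sum>k<N. (?d k t)\<^sup>2) + (\<Sum>k<N. (?c k t)\<^sup>2) / l"
        by (simp only: sum.distrib sum_distrib_left sum_divide_distrib)
      also have "\<dots> \<le> - l * (\<Sum>k<N. (?d k t)\<^sup>2) + 2 * Q / l"
        using bessel_diff[OF F G Q[of t], of N] l by (intro add_left_mono divide_right_mono) auto
      finally show ?thesis .
    qed
  qed
  then have "integral {0..1} (\<lambda>x. (\<Sum>k. ?d k t * mode k x)\<^sup>2) \<le> (2 * Q / l) / l / 2"
    by (intro integral_square_sine_series_le)
      (rule summable_comparison_test'[OF summable_add[OF summable_sol_coef[OF F, of t] summable_sol_coef[OF G, of t]]], simp)
  then show ?thesis unfolding sol_diff[OF F G] l_def by (simp add: power2_eq_square)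
qed

text \<open>
  The solution operator smooths from \<open>L\<^sup>2\<close> to bounded functions, since the inverse eigenvalues are summable.
\<close>

lemma sol_diff_sup_L2:
  assumes F: "admissible \<omega> F" and G: "admissible \<omega> G"
    and Q: "\<And>t. L2_dist_sq F G t \<le> Q"
  shows "\<bar>sol \<gamma> \<omega> F t x - sol \<gamma> \<omega> G t x\<bar> \<le> sqrt (2 * Q) * (\<Sum>k. 1 / eig \<gamma> k)"
proof (rule sol_diff_sup[OF F G])
  fix t k
  have "(sine_coef k (F t) - sine_coef k (G t))\<^sup>2 \<le> (\<Sum>j<Suc k. (sine_coef j (F t) - sine_coef j (G t))\<^sup>2)"
    by (rule member_le_sum) auto
  also have "\<dots> \<le> 2 * Q" by (rule bessel_diff[OF F G Q])
  finally show "\<bar>sine_coef k (F t) - sine_coef k (G t)\<bar> \<le> sqrt (2 * Q)"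
    by (rule real_le_rsqrt[of "\<bar>_\<bar>", simplified])
qed

text \<open>
  The map \<open>u \<mapsto> sol (\<Phi> u)\<close> contracts the \<open>L\<^sup>2\<close> distance by the factor \<open>B / eig \<gamma> 0\<close>, but in general not the supremum
  distance.  By the smoothing property the iterates nevertheless converge geometrically in the supremum norm,
  so the limit is continuous.
\<close>

lemma sol_fixed_point:
  fixes \<Phi> :: "(real \<Rightarrow> real \<Rightarrow> real) \<Rightarrow> real \<Rightarrow> real \<Rightarrow> real"
  assumes adm: "\<And>u. admissible \<omega> u \<Longrightarrow> admissible \<omega> (\<Phi> u)"
    and B: "0 \<le> B" "B < eig \<gamma> 0"
    and L2: "\<And>u v Q t. admissible \<omega> u \<Longrightarrow> admissible \<omega> v \<Longrightarrow> (\<And>t. L2_dist_sq u v t \<le> Q)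
      \<Longrightarrow> integral {0..1} (\<lambda>x. (\<Phi> u t x - \<Phi> v t x)\<^sup>2) \<le> B\<^sup>2 * Q"
    and sup: "\<And>u v \<delta> t x. admissible \<omega> u \<Longrightarrow> admissible \<omega> v \<Longrightarrow> (\<And>t x. x \<in> {0..1} \<Longrightarrow> \<bar>u t x - v t x\<bar> \<le> \<delta>)
      \<Longrightarrow> x \<in> {0..1} \<Longrightarrow> \<bar>\<Phi> u t x - \<Phi> v t x\<bar> \<le> B * \<delta>"
  shows "\<exists>u. admissible \<omega> u \<and> (\<forall>t. \<forall>x\<in>{0..1}. u t x = sol \<gamma> \<omega> (\<Phi> u) t x)"
proof -
  define l where "l = eig \<gamma> 0"
  define K where "K = (\<Sum>k. 1 / eig \<gamma> k)"
  have l: "l > 0" using eig_pos[OF \<gamma>] by (simp add: l_def)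
  have K: "K \<ge> 0" unfolding K_def using eig_pos[OF \<gamma>] by (intro suminf_nonneg summable_inverse_eig \<gamma>) (simp add: less_imp_le)
  define U where "U n = ((\<lambda>u. sol \<gamma> \<omega> (\<Phi> u)) ^^ n) (\<lambda>t x. 0)" for n
  have USuc: "U (Suc n) = sol \<gamma> \<omega> (\<Phi> (U n))" for n by (simp add: U_def)
  have aU: "admissible \<omega> (U n)" for n
  proof (induction n)
    case 0
    then show ?case by (simp add: U_def admissible_def time_periodic_def case_prod_unfold)
  next
    case (Suc n)
    then show ?case unfolding USuc by (intro admissible_sol adm)
  qed
  obtain M where M: "M > 0" "\<And>t x. x \<in> {0..1} \<Longrightarrow> \<bar>U 1 t x\<bar> \<le> M"
    using admissible_bounded[OF \<omega> aU[of 1]] by blast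
  have cU: "continuous_on {0..1} (U n t)" for n t by (rule admissible_continuous_x[OF aU])
  have l2: "integral {0..1} (\<lambda>x. (U (Suc n) t x - U n t x)\<^sup>2) \<le> M\<^sup>2 * ((B / l)\<^sup>2) ^ n" for n t
  proof (induction n arbitrary: t)
    case 0
    have "integral {0..1} (\<lambda>x. (U (Suc 0) t x - U 0 t x)\<^sup>2) \<le> integral {0..1} (\<lambda>x::real. M\<^sup>2)"
    proof (rule integral_le)
      fix x :: real assume "x \<in> {0..1}"
      then have "\<bar>U 1 t x\<bar>\<^sup>2 \<le> M\<^sup>2" using M by (intro power_mono) auto
      then show "(U (Suc 0) t x - U 0 t x)\<^sup>2 \<le> M\<^sup>2" by (simp add: U_def)
    qed (auto intro!: integrable_continuous_real continuous_intros cU)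
    then show ?case by simp
  next
    case (Suc n)
    have "integral {0..1} (\<lambda>x. (U (Suc (Suc n)) t x - U (Suc n) t x)\<^sup>2) \<le> (B\<^sup>2 * (M\<^sup>2 * ((B / l)\<^sup>2) ^ n)) / l\<^sup>2"
      unfolding USuc[of "Suc n"] USuc[of n] l_def
      by (intro sol_diff_L2 adm aU[of "Suc n", unfolded USuc] aU L2 Suc[unfolded USuc l_def])
    then show ?case by (simp add: power_divide mult_ac)
  qed
  define r where "r = B / l"
  have r: "0 \<le> r" "r < 1" using B l by (auto simp: r_def l_def)
  have step: "\<bar>U (Suc (Suc n)) t x - U (Suc n) t x\<bar> \<le> K * sqrt (2 * B\<^sup>2 * M\<^sup>2) * r ^ n" for n t x
  proof -
    have "\<bar>U (Suc (Suc n)) t x - U (Suc n) t x\<bar> \<le> sqrt (2 * (B\<^sup>2 * (M\<^sup>2 * (r\<^sup>2) ^ n))) * K"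
      unfolding USuc[of "Suc n"] USuc[of n] K_def r_def
      by (intro sol_diff_sup_L2 adm aU[of "Suc n", unfolded USuc] aU L2 l2[unfolded USuc])
    also have "sqrt (2 * (B\<^sup>2 * (M\<^sup>2 * (r\<^sup>2) ^ n))) = sqrt (2 * B\<^sup>2 * M\<^sup>2) * sqrt ((r ^ n)\<^sup>2)"
      by (simp add: real_sqrt_mult mult_ac flip: power_mult)
    also have "sqrt ((r ^ n)\<^sup>2) = r ^ n" using r by simp
    finally show ?thesis by (simp add: mult_ac)
  qed
  \<comment> \<open>The first iterate is the start of the telescoping series, because only later increments are images under the solution operator of a small difference.\<close>
  define u where "u t x = U 1 t x + (\<Sum>n. U (Suc (Suc n)) t x - U (Suc n) t x)" for t x
  have sumr: "summable (\<lambda>n. K * sqrt (2 * B\<^sup>2 * M\<^sup>2) * r ^ n)"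
    using r by (intro summable_mult summable_geometric) auto
  have ul0: "uniform_limit UNIV (\<lambda>N p. \<Sum>n<N. U (Suc (Suc n)) (fst p) (snd p) - U (Suc n) (fst p) (snd p))
      (\<lambda>p. \<Sum>n. U (Suc (Suc n)) (fst p) (snd p) - U (Suc n) (fst p) (snd p)) sequentially"
    by (rule Weierstrass_m_test[OF _ sumr]) (use step in auto)
  have telescope: "(\<Sum>n<N. U (Suc (Suc n)) t x - U (Suc n) t x) = U (Suc N) t x - U 1 t x" for N t x
    by (induction N) auto
  from uniform_limit_add[OF uniform_limit_const[where c="\<lambda>p. U 1 (fst p) (snd p)"] ul0]
  have ul: "uniform_limit UNIV (\<lambda>N p. U (Suc N) (fst p) (snd p)) (\<lambda>p. u (fst p) (snd p)) sequentially"
    unfolding u_def by (simp add: telescope)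
  have lim: "(\<lambda>N. U (Suc N) t x) \<longlonglongrightarrow> u t x" for t x
    using tendsto_uniform_limitI[OF ul, of "(t, x)"] by simp
  have au: "admissible \<omega> u"
    unfolding admissible_def
  proof
    have "continuous_on (UNIV \<times> {0..1}) (\<lambda>p. u (fst p) (snd p))"
    proof (rule uniform_limit_theorem)
      show "uniform_limit (UNIV \<times> {0..1}) (\<lambda>N p. U (Suc N) (fst p) (snd p)) (\<lambda>p. u (fst p) (snd p)) sequentially"
        by (rule uniform_limit_on_subset[OF ul]) simp
      show "\<forall>\<^sub>F n in sequentially. continuous_on (UNIV \<times> {0..1}) (\<lambda>p. U (Suc n) (fst p) (snd p))"
        using aU by (simp add: admissible_def case_prod_unfold)
    qed simp
    then show "continuous_on (UNIV \<times> {0..1}) (\<lambda>(t, x). u t x)" by (simp add: case_prod_unfold)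
    show "time_periodic \<omega> u"
      unfolding time_periodic_def
    proof (intro allI ballI)
      fix t x :: real assume "x \<in> {0..1}"
      then have "(\<lambda>N. U (Suc N) (t + \<omega>) x) = (\<lambda>N. U (Suc N) t x)"
        using aU by (simp add: admissible_def time_periodic_def)
      then show "u (t + \<omega>) x = u t x" using lim LIMSEQ_unique by metis
    qed
  qed
  have "u t x = sol \<gamma> \<omega> (\<Phi> u) t x" for t x
  proof -
    have "(\<lambda>N. U (Suc (Suc N)) t x) \<longlonglongrightarrow> sol \<gamma> \<omega> (\<Phi> u) t x"
    proof (rule LIMSEQ_I)
      fix e :: real assume e: "e > 0"
      define \<delta> where "\<delta> = e / (2 * B * K + 1)"
      have \<delta>: "\<delta> > 0" using e B K by (simp add: \<delta>_def add_nonneg_pos)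
      from uniform_limitD[OF ul \<delta>] obtain N0 where
        N0: "\<And>N t x. N \<ge> N0 \<Longrightarrow> \<bar>U (Suc N) t x - u t x\<bar> < \<delta>"
        unfolding eventually_sequentially dist_real_def by auto
      have "norm (U (Suc (Suc N)) t x - sol \<gamma> \<omega> (\<Phi> u) t x) < e" if N: "N \<ge> N0" for N
      proof -
        have "\<bar>sine_coef k (\<Phi> (U (Suc N)) t) - sine_coef k (\<Phi> u t)\<bar> \<le> 2 * (B * \<delta>)" for k t
        proof -
          have "\<bar>sine_coef k (\<lambda>x. \<Phi> (U (Suc N)) t x - \<Phi> u t x)\<bar> \<le> 2 * (B * \<delta>)"
            by (intro abs_sine_coef_le continuous_intros admissible_continuous_x[OF adm] aU au sup less_imp_le[OF N0[OF N]])
          then show ?thesis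
            by (simp add: sine_coef_diff admissible_continuous_x[OF adm] aU au)
        qed
        from sol_diff_sup[OF adm[OF aU] adm[OF au] this]
        have "\<bar>U (Suc (Suc N)) t x - sol \<gamma> \<omega> (\<Phi> u) t x\<bar> \<le> 2 * (B * \<delta>) * K"
          unfolding USuc[of "Suc N"] K_def .
        also have "\<dots> = e * (2 * B * K / (2 * B * K + 1))" by (simp add: \<delta>_def)
        also have "\<dots> < e * 1"
          using e B K by (intro mult_strict_left_mono) (auto simp: pos_divide_less_eq add_nonneg_pos)
        finally show ?thesis by simp
      qed
      then show "\<exists>N0. \<forall>N\<ge>N0. norm (U (Suc (Suc N)) t x - sol \<gamma> \<omega> (\<Phi> u) t x) < e" by blast
    qed
    moreover have "(\<lambda>N. U (Suc (Suc N)) t x) \<longlonglongrightarrow> u t x"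
      using LIMSEQ_Suc[OF lim[of t x]] .
    ultimately show ?thesis using LIMSEQ_unique by blast
  qed
  with au show ?thesis by blast
qed

section \<open>Regularity of the periodic solution\<close>

context
  fixes M :: real and F :: "real \<Rightarrow> real \<Rightarrow> real"
  assumes F: "admissible \<omega> F" and M: "\<And>t x. x \<in> {0..1} \<Longrightarrow> \<bar>F t x\<bar> \<le> M"
begin

abbreviation (input) "U \<equiv> sol_coef \<gamma> \<omega> F"
abbreviation (input) "U' \<equiv> sol_coef_dt \<gamma> \<omega> F"
abbreviation (input) "V \<equiv> smooth_dt \<gamma> \<omega> F"

lemma M_nonneg: "0 \<le> M"
  using M[of 0 0] by simp

lemma sol_coef_le: "\<bar>U k t\<bar> \<le> 2 * M / eig \<gamma> k"
  by (rule sol_coef_bound[OF F M])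

lemma sol_coef_has_derivative: "(U k has_real_derivative U' k t) (at t)"
  unfolding sol_coef_dt_def by (rule sol_coef_derivative[OF F])

text \<open>
  Two times occur because the bound of the regularised time derivative compares the forcing at \<open>t\<close> with the
  solution at earlier times.
\<close>

lemma forcing_minus_relaxed_bound: "\<bar>sine_coef k (F t) - eig \<gamma> k * U k s\<bar> \<le> 4 * M"
proof -
  have "\<bar>sine_coef k (F t)\<bar> \<le> 2 * M"
    by (rule abs_sine_coef_le[OF admissible_continuous_x[OF F] M])
  moreover have "eig \<gamma> k * \<bar>U k s\<bar> \<le> 2 * M"
    using sol_coef_le[of k s] eig_pos[OF \<gamma>, of k] by (simp add: pos_le_divide_eq mult.commute)
  then have "\<bar>eig \<gamma> k * U k s\<bar> \<le> 2 * M" using eig_pos[OF \<gamma>, of k] by (simp add: abs_mult)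
  ultimately show ?thesis by linarith
qed

lemma sol_coef_dt_bound: "\<bar>U' k t\<bar> \<le> 4 * M"
  unfolding sol_coef_dt_def by (rule forcing_minus_relaxed_bound)

lemma continuous_sol_coef: "continuous_on S (U k)"
  using sol_coef_has_derivative by (meson DERIV_isCont continuous_at_imp_continuous_on)

lemma continuous_sol_coef_dt: "continuous_on S (U' k)"
  unfolding sol_coef_dt_def
  by (intro continuous_intros continuous_sol_coef continuous_on_subset[OF admissible_sine_coef(1)[OF F]]) simp

text \<open>
  An increment of a coefficient is bounded both by a multiple of \<open>|t - s|\<close> and by a multiple of the inverse
  eigenvalue, hence by the geometric mean of the two, which is summable over the modes.
\<close>

lemma sol_hoelder_half:
  "\<bar>sol \<gamma> \<omega> F t x - sol \<gamma> \<omega> F s x\<bar> \<le> 4 * M * (\<Sum>k. 1 / sqrt (eig \<gamma> k)) * sqrt \<bar>t - s\<bar>"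
proof -
  have S: "summable (\<lambda>k. 4 * M * sqrt \<bar>t - s\<bar> * (1 / sqrt (eig \<gamma> k)))"
    by (intro summable_mult summable_inverse_sqrt_eig \<gamma>)
  have su: "summable (\<lambda>k. U k t * mode k x)" for t
    by (rule summable_comparison_test'[OF summable_sol_coef[OF F, of t]])
      (use abs_mode_le_1 in \<open>auto simp: abs_mult intro!: mult_left_le\<close>)
  have "\<bar>U k t - U k s\<bar> \<le> 4 * M * sqrt \<bar>t - s\<bar> * (1 / sqrt (eig \<gamma> k))" for k
  proof -
    have 1: "\<bar>U k t - U k s\<bar> \<le> 4 * M * \<bar>t - s\<bar>"
      using field_differentiable_bound[of UNIV "U k" "U' k" "4 * M" t s] sol_coef_has_derivative sol_coef_dt_bound by auto
    have 2: "\<bar>U k t - U k s\<bar> \<le> 4 * M / eig \<gamma> k"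
      using sol_coef_le[of k t] sol_coef_le[of k s] by simp
    have "\<bar>U k t - U k s\<bar> = sqrt (\<bar>U k t - U k s\<bar> * \<bar>U k t - U k s\<bar>)" by simp
    also have "\<dots> \<le> sqrt ((4 * M * \<bar>t - s\<bar>) * (4 * M / eig \<gamma> k))"
      by (intro real_sqrt_le_mono mult_mono 1 2) (use M_nonneg in auto)
    also have "(4 * M * \<bar>t - s\<bar>) * (4 * M / eig \<gamma> k) = (4 * M)\<^sup>2 * \<bar>t - s\<bar> / eig \<gamma> k"
      by (simp add: power2_eq_square)
    also have "sqrt \<dots> = 4 * M * sqrt \<bar>t - s\<bar> * (1 / sqrt (eig \<gamma> k))"
      using M_nonneg by (simp add: real_sqrt_mult real_sqrt_divide)
    finally show ?thesis .
  qed
  then have "norm ((U k t - U k s) * mode k x) \<le> 4 * M * sqrt \<bar>t - s\<bar> * (1 / sqrt (eig \<gamma> k))" for k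
    using mult_mono[OF _ abs_mode_le_1[of k x], of "\<bar>U k t - U k s\<bar>"] M_nonneg eig_pos[OF \<gamma>, of k]
    by (simp add: abs_mult)
  from norm_suminf_le[OF this S]
  have "\<bar>\<Sum>k. (U k t - U k s) * mode k x\<bar> \<le> (\<Sum>k. 4 * M * sqrt \<bar>t - s\<bar> * (1 / sqrt (eig \<gamma> k)))" by simp
  also have "(\<Sum>k. (U k t - U k s) * mode k x) = sol \<gamma> \<omega> F t x - sol \<gamma> \<omega> F s x"
    unfolding sol_def left_diff_distrib by (rule suminf_diff[OF su su, symmetric])
  also have "(\<Sum>k. 4 * M * sqrt \<bar>t - s\<bar> * (1 / sqrt (eig \<gamma> k))) = 4 * M * sqrt \<bar>t - s\<bar> * (\<Sum>k. 1 / sqrt (eig \<gamma> k))"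
    by (rule suminf_mult[OF summable_inverse_sqrt_eig[OF \<gamma>]])
  finally show ?thesis by (simp only: mult_ac)
qed

lemma summable_majorant: "n \<le> 2 \<Longrightarrow> summable (\<lambda>k. 2 * M * (freq k ^ n / eig \<gamma> k))"
  by (intro summable_mult summable_power_over_eig \<gamma>)

lemma sol_coef_times_frequency_le:
  "\<bar>freq k ^ n * U k t\<bar> \<le> 2 * M * (freq k ^ n / eig \<gamma> k)"
  using mult_left_mono[OF sol_coef_le[of k t], of "freq k ^ n"]
  by (simp add: abs_mult mult_ac del: of_nat_Suc)

lemma sol_x_derivative: "(sol \<gamma> \<omega> F t has_real_derivative sol_x \<gamma> \<omega> F t x) (at x)"
proof -
  have "((\<lambda>x. \<Sum>k. U k t * mode k x) has_real_derivative (\<Sum>k. U k t * (freq k * cos (freq k * x)))) (at x)"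
  proof (rule term_by_term_derivative)
    show "((\<lambda>x. U k t * mode k x) has_real_derivative U k t * (freq k * cos (freq k * x))) (at x)" for k x
      unfolding mode_def by (auto intro!: derivative_eq_intros simp del: of_nat_Suc)
    show "\<bar>U k t * (freq k * cos (freq k * x))\<bar> \<le> 2 * M * (freq k ^ 1 / eig \<gamma> k)" for k x
      using mult_mono[OF sol_coef_times_frequency_le[of k 1 t] abs_cos_le_one[of "freq k * x"]] M_nonneg eig_pos[OF \<gamma>, of k]
      by (simp add: abs_mult mult_ac del: of_nat_Suc)
    show "summable (\<lambda>k. 2 * M * (freq k ^ 1 / eig \<gamma> k))" by (rule summable_majorant) simp
    show "summable (\<lambda>k. U k t * mode k 0)" by simp
  qed
  then show ?thesis unfolding sol_def[abs_def] sol_x_def .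
qed

lemma summable_sol_x: "summable (\<lambda>k. U k t * (freq k * cos (freq k * x)))"
proof (rule summable_comparison_test'[OF summable_majorant[of 1]])
  show "norm (U k t * (freq k * cos (freq k * x))) \<le> 2 * M * (freq k ^ 1 / eig \<gamma> k)" for k
    using mult_mono[OF sol_coef_times_frequency_le[of k 1 t] abs_cos_le_one[of "freq k * x"]] M_nonneg eig_pos[OF \<gamma>, of k]
    by (simp add: abs_mult mult_ac del: of_nat_Suc)
qed simp

lemma sol_xx_derivative: "(sol_x \<gamma> \<omega> F t has_real_derivative sol_xx \<gamma> \<omega> F t x) (at x)"
proof -
  have "((\<lambda>x. \<Sum>k. U k t * (freq k * cos (freq k * x))) has_real_derivative
    (\<Sum>k. - (freq k)\<^sup>2 * U k t * mode k x)) (at x)"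
  proof (rule term_by_term_derivative)
    show "((\<lambda>x. U k t * (freq k * cos (freq k * x))) has_real_derivative - (freq k)\<^sup>2 * U k t * mode k x) (at x)" for k x
      unfolding mode_def by (auto intro!: derivative_eq_intros simp: power2_eq_square simp del: of_nat_Suc)
    show "\<bar>- (freq k)\<^sup>2 * U k t * mode k x\<bar> \<le> 2 * M * ((freq k)\<^sup>2 / eig \<gamma> k)" for k x
      using mult_mono[OF sol_coef_times_frequency_le[of k 2 t] abs_mode_le_1[of k x]] M_nonneg eig_pos[OF \<gamma>, of k]
      by (simp add: abs_mult mult_ac del: of_nat_Suc)
    show "summable (\<lambda>k. 2 * M * ((freq k)\<^sup>2 / eig \<gamma> k))" by (rule summable_majorant) simp
    show "summable (\<lambda>k. U k t * (freq k * cos (freq k * 0)))" by (rule summable_sol_x)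
  qed
  then show ?thesis unfolding sol_x_def[abs_def] sol_xx_def .
qed

lemma continuous_sol_x: "continuous_on UNIV (\<lambda>(t, x). sol_x \<gamma> \<omega> F t x)"
proof -
  have "continuous_on UNIV (\<lambda>p. \<Sum>k. U k (fst p) * (freq k * cos (freq k * snd p)))"
  proof (rule continuous_on_suminf)
    show "continuous_on UNIV (\<lambda>p. U k (fst p) * (freq k * cos (freq k * snd p)))" for k
      by (intro continuous_intros continuous_on_compose2[OF continuous_sol_coef[of UNIV]]) auto
    show "summable (\<lambda>k. 2 * M * (freq k ^ 1 / eig \<gamma> k))" by (rule summable_majorant) simp
    show "\<bar>U k (fst p) * (freq k * cos (freq k * snd p))\<bar> \<le> 2 * M * (freq k ^ 1 / eig \<gamma> k)" for k and p :: "real \<times> real"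
      using mult_mono[OF sol_coef_times_frequency_le[of k 1 "fst p"] abs_cos_le_one[of "freq k * snd p"]] M_nonneg eig_pos[OF \<gamma>, of k]
      by (simp add: abs_mult mult_ac del: of_nat_Suc)
  qed
  then show ?thesis by (simp add: sol_x_def case_prod_unfold)
qed

lemma continuous_sol_xx: "continuous_on UNIV (\<lambda>(t, x). sol_xx \<gamma> \<omega> F t x)"
proof -
  have "continuous_on UNIV (\<lambda>p. \<Sum>k. - (freq k)\<^sup>2 * U k (fst p) * mode k (snd p))"
  proof (rule continuous_on_sine_series)
    show "continuous_on UNIV (\<lambda>p. - (freq k)\<^sup>2 * U k (fst p))" for k
      by (intro continuous_intros continuous_on_compose2[OF continuous_sol_coef[of UNIV]]) auto
    show "summable (\<lambda>k. 2 * M * ((freq k)\<^sup>2 / eig \<gamma> k))" by (rule summable_majorant) simp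
    show "\<bar>- (freq k)\<^sup>2 * U k (fst p)\<bar> \<le> 2 * M * ((freq k)\<^sup>2 / eig \<gamma> k)" for k and p :: "real \<times> real"
      using sol_coef_times_frequency_le[of k 2 "fst p"] by simp
  qed (intro continuous_intros)
  then show ?thesis by (simp add: sol_xx_def case_prod_unfold)
qed

lemma sine_coef_sol: "sine_coef k (sol \<gamma> \<omega> F t) = U k t"
  unfolding sol_def[abs_def] by (rule sine_coef_series[OF summable_sol_coef[OF F]])

lemma sine_coef_sol_xx: "sine_coef k (sol_xx \<gamma> \<omega> F t) = - (freq k)\<^sup>2 * U k t"
  unfolding sol_xx_def[abs_def]
  by (rule sine_coef_series, rule summable_comparison_test'[OF summable_majorant[of 2]])
    (use sol_coef_times_frequency_le[of _ 2 t] in auto)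

lemma summable_exp_eig:
  assumes "\<epsilon> > 0" shows "summable (\<lambda>k. exp (- \<epsilon> * eig \<gamma> k))"
proof (rule summable_comparison_test'[OF summable_mult[OF summable_inverse_eig[OF \<gamma>], of "1/\<epsilon>"]])
  show "norm (exp (- \<epsilon> * eig \<gamma> k)) \<le> 1 / \<epsilon> * (1 / eig \<gamma> k)" for k
    using exp_minus_le_inverse(1)[of "\<epsilon> * eig \<gamma> k"] assms eig_pos[OF \<gamma>, of k] by simp
qed

lemma smooth_dt_summable:
  assumes "\<epsilon> > 0" shows "summable (\<lambda>k. \<bar>exp (- \<epsilon> * eig \<gamma> k) * U' k t\<bar>)"
  by (rule summable_comparison_test'[OF summable_mult[OF summable_exp_eig[OF assms], of "4 * M"]])
    (use sol_coef_dt_bound in \<open>auto simp: abs_mult mult.commute intro!: mult_left_mono\<close>)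

lemma continuous_smooth_dt:
  assumes "\<epsilon> > 0" shows "continuous_on UNIV (\<lambda>p. V \<epsilon> (fst p) (snd p))"
  unfolding smooth_dt_def
proof (rule continuous_on_sine_series)
  show "continuous_on UNIV (\<lambda>p. exp (- \<epsilon> * eig \<gamma> k) * U' k (fst p))" for k
    by (intro continuous_intros continuous_on_compose2[OF continuous_sol_coef_dt[of UNIV]]) auto
  show "\<bar>exp (- \<epsilon> * eig \<gamma> k) * U' k (fst p)\<bar> \<le> 4 * M * exp (- \<epsilon> * eig \<gamma> k)" for k and p :: "real \<times> real"
    using sol_coef_dt_bound[of k "fst p"] by (simp add: abs_mult mult.commute)
qed (intro continuous_intros summable_mult summable_exp_eig assms)+

lemma sine_coef_smooth_dt:
  "\<epsilon> > 0 \<Longrightarrow> sine_coef k (V \<epsilon> t) = exp (- \<epsilon> * eig \<gamma> k) * U' k t"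
  unfolding smooth_dt_def[abs_def] by (rule sine_coef_series[OF smooth_dt_summable])

lemma smoothed_sol_derivative:
  assumes \<epsilon>: "\<epsilon> > 0"
  shows "((\<lambda>t. \<Sum>k. exp (- \<epsilon> * eig \<gamma> k) * U k t * mode k x) has_real_derivative V \<epsilon> t x) (at t)"
  unfolding smooth_dt_def
proof (rule term_by_term_derivative)
  show "((\<lambda>t. exp (- \<epsilon> * eig \<gamma> k) * U k t * mode k x) has_real_derivative exp (- \<epsilon> * eig \<gamma> k) * U' k t * mode k x) (at t)" for k t
    by (intro DERIV_cmult DERIV_cmult_right sol_coef_has_derivative)
  show "\<bar>exp (- \<epsilon> * eig \<gamma> k) * U' k t * mode k x\<bar> \<le> 4 * M * exp (- \<epsilon> * eig \<gamma> k)" for k t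
    using mult_mono[OF sol_coef_dt_bound[of k t] abs_mode_le_1[of k x]] M_nonneg by (simp add: abs_mult)
  show "summable (\<lambda>k. 4 * M * exp (- \<epsilon> * eig \<gamma> k))" by (intro summable_mult summable_exp_eig \<epsilon>)
  show "summable (\<lambda>k. exp (- \<epsilon> * eig \<gamma> k) * U k 0 * mode k x)"
  proof (rule summable_comparison_test'[OF summable_sol_coef[OF F, of 0]])
    show "norm (exp (- \<epsilon> * eig \<gamma> k) * U k 0 * mode k x) \<le> \<bar>U k 0\<bar>" for k
    proof -
      have "\<bar>U k 0\<bar> * (exp (- \<epsilon> * eig \<gamma> k) * \<bar>mode k x\<bar>) \<le> \<bar>U k 0\<bar> * (1 * 1)"
        using \<epsilon> eig_pos[OF \<gamma>, of k] abs_mode_le_1[of k x] by (intro mult_left_mono mult_mono) auto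
      then show ?thesis by (simp add: abs_mult mult_ac)
    qed
  qed
qed

lemma smoothed_sol_tendsto:
  assumes \<epsilon>: "\<And>n. \<epsilon> n \<ge> 0" "\<epsilon> \<longlonglongrightarrow> 0"
  shows "(\<lambda>n. \<Sum>k. exp (- \<epsilon> n * eig \<gamma> k) * U k t * mode k x) \<longlonglongrightarrow> sol \<gamma> \<omega> F t x"
proof -
  have "continuous_on {0..} (\<lambda>e. \<Sum>k. exp (- e * eig \<gamma> k) * U k t * mode k x)"
  proof (rule continuous_on_sine_series[OF _ _ summable_sol_coef[OF F, of t]])
    show "\<bar>exp (- e * eig \<gamma> k) * U k t\<bar> \<le> \<bar>U k t\<bar>" if "e \<in> {0..}" for k and e :: real
      using that eig_pos[OF \<gamma>, of k] by (simp add: abs_mult mult_left_le_one_le)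
  qed (intro continuous_intros)+
  from continuous_on_tendsto_compose[OF this \<epsilon>(2)] \<epsilon>(1)
  show ?thesis by (simp add: sol_def)
qed

context
  fixes \<alpha> L :: real
  assumes \<alpha>: "0 < \<alpha>" "\<alpha> < 1" and L: "0 \<le> L"
    and hoelder: "\<And>t s x. x \<in> {0..1} \<Longrightarrow> \<bar>F t x - F s x\<bar> \<le> L * \<bar>t - s\<bar> powr \<alpha>"
begin

text \<open>
  The sum is, up to sign, the derivative of the regularised time derivative with respect to \<open>\<epsilon>\<close>, that is
  \<open>A exp (- \<epsilon> A) u\<^sub>t\<close>.  Follow \<open>\<psi> r = A exp (- r A) (F t - A u (t + \<epsilon> - r))\<close> from \<open>r = \<epsilon>\<close>, where it is the
  quantity in question, to \<open>r = \<epsilon> + 1\<close>, where the exponential makes it harmless.  By the equation, its derivative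
  is \<open>A\<^sup>2 exp (- r A)\<close> applied to the increment \<open>F (t + \<epsilon> - r) - F t\<close>, of order \<open>r\<^sup>-\<^sup>2 r\<^sup>\<alpha>\<close> by the kernel bound and
  Hoelder continuity, and the integral of \<open>r\<^sup>\<alpha>\<^sup>-\<^sup>2\<close> from \<open>\<epsilon>\<close> is of order \<open>\<epsilon>\<^sup>\<alpha>\<^sup>-\<^sup>1\<close>.
\<close>

lemma smooth_dt_partial_derivative_bound:
  "\<exists>K\<ge>0. \<forall>\<epsilon>. 0 < \<epsilon> \<longrightarrow> \<epsilon> \<le> 1 \<longrightarrow> (\<forall>N t x. x \<in> {0..1} \<longrightarrow>
     \<bar>\<Sum>k<N. eig \<gamma> k * exp (- \<epsilon> * eig \<gamma> k) * U' k t * mode k x\<bar>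
     \<le> K * \<epsilon> powr (\<alpha> - 1) + K * (heat2 \<gamma> \<epsilon> (N - 1))\<^sup>2)"
proof -
  obtain C where C: "C \<ge> 0" and kernel: "\<And>t N h H x. 0 < t \<Longrightarrow> t \<le> 2 \<Longrightarrow> continuous_on {0..1} h \<Longrightarrow>
      (\<forall>y\<in>{0..1}. \<bar>h y\<bar> \<le> H) \<Longrightarrow> x \<in> {0..1} \<Longrightarrow>
    \<bar>\<Sum>k<N. heat2 \<gamma> t k * sine_coef k h * mode k x\<bar> \<le> H * (C / t\<^sup>2 + C * (heat2 \<gamma> t (N - 1))\<^sup>2)"
    using heat2_multiplier_bound[OF \<gamma>, of 2] by auto
  note M0 = M_nonneg
  define S where "S = (\<Sum>k. 1 / eig \<gamma> k)"
  have S: "S \<ge> 0" unfolding S_def using eig_pos[OF \<gamma>] by (intro suminf_nonneg summable_inverse_eig \<gamma>) (simp add: less_imp_le)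
  define A where "A = 4 * L * C / (1 - \<alpha>)"
  define B where "B = 4 * L * C"
  define K where "K = 8 * M * S + A + B"
  have AB: "A \<ge> 0" "B \<ge> 0" using L C \<alpha> by (auto simp: A_def B_def)
  have K: "K \<ge> 0" "K \<ge> B" "K \<ge> 8 * M * S + A" using AB M0 S by (auto simp: K_def)
  have main: "\<bar>\<Sum>k<N. eig \<gamma> k * exp (- \<epsilon> * eig \<gamma> k) * U' k t * mode k x\<bar>
     \<le> K * \<epsilon> powr (\<alpha> - 1) + K * (heat2 \<gamma> \<epsilon> (N - 1))\<^sup>2"
    if \<epsilon>: "0 < \<epsilon>" "\<epsilon> \<le> 1" and x: "x \<in> {0..1}" for \<epsilon> N t x
  proof -
    \<comment> \<open>At \<open>r = \<epsilon>\<close> the bracket is \<open>F t - A u t\<close>, the time derivative at \<open>t\<close>.\<close>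
    let ?\<psi> = "\<lambda>r. \<Sum>k<N. eig \<gamma> k * exp (- r * eig \<gamma> k) * (sine_coef k (F t) - eig \<gamma> k * U k (t + \<epsilon> - r)) * mode k x"
    let ?\<psi>' = "\<lambda>r. \<Sum>k<N. heat2 \<gamma> r k * sine_coef k (\<lambda>y. F (t + \<epsilon> - r) y - F t y) * mode k x"
    have d: "(?\<psi> has_real_derivative ?\<psi>' r) (at r)" for r
    proof (rule DERIV_sum)
      fix k
      have u: "((\<lambda>r. U k (t + \<epsilon> - r)) has_real_derivative - (sine_coef k (F (t + \<epsilon> - r)) - eig \<gamma> k * U k (t + \<epsilon> - r))) (at r)"
        by (rule DERIV_cong[OF DERIV_chain'[OF _ sol_coef_derivative[OF F]]])
          (auto intro!: derivative_eq_intros)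
      have c: "sine_coef k (\<lambda>y. F (t + \<epsilon> - r) y - F t y) = sine_coef k (F (t + \<epsilon> - r)) - sine_coef k (F t)"
        by (intro sine_coef_diff admissible_continuous_x[OF F])
      have "((\<lambda>r. eig \<gamma> k * exp (- r * eig \<gamma> k) * (sine_coef k (F t) - eig \<gamma> k * U k (t + \<epsilon> - r)) * mode k x) has_real_derivative
        (eig \<gamma> k * (exp (- r * eig \<gamma> k) * (- eig \<gamma> k)) * (sine_coef k (F t) - eig \<gamma> k * U k (t + \<epsilon> - r))
         + eig \<gamma> k * exp (- r * eig \<gamma> k) * (eig \<gamma> k * (sine_coef k (F (t + \<epsilon> - r)) - eig \<gamma> k * U k (t + \<epsilon> - r)))) * mode k x) (at r)"
        by (rule derivative_eq_intros u refl)+ (simp add: algebra_simps)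
      then show "((\<lambda>r. eig \<gamma> k * exp (- r * eig \<gamma> k) * (sine_coef k (F t) - eig \<gamma> k * U k (t + \<epsilon> - r)) * mode k x) has_real_derivative
        heat2 \<gamma> r k * sine_coef k (\<lambda>y. F (t + \<epsilon> - r) y - F t y) * mode k x) (at r)"
        unfolding c heat2_def by (rule DERIV_cong) (simp add: algebra_simps power2_eq_square)
    qed
    let ?a = "heat2 \<gamma> \<epsilon> (N - 1)"
    have b: "\<bar>?\<psi>' r\<bar> \<le> (L * C) * r powr (\<alpha> - 2) + B * ?a\<^sup>2" if r: "\<epsilon> < r" "r < \<epsilon> + 1" for r
    proof -
      have h: "\<forall>y\<in>{0..1}. \<bar>F (t + \<epsilon> - r) y - F t y\<bar> \<le> L * r powr \<alpha>"
      proof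
        fix y :: real assume "y \<in> {0..1}"
        from hoelder[OF this, of "t + \<epsilon> - r" t]
        have "\<bar>F (t + \<epsilon> - r) y - F t y\<bar> \<le> L * (r - \<epsilon>) powr \<alpha>" using r by (simp add: abs_if)
        also have "\<dots> \<le> L * r powr \<alpha>" using r \<epsilon> \<alpha> L by (intro mult_left_mono powr_mono2) auto
        finally show "\<bar>F (t + \<epsilon> - r) y - F t y\<bar> \<le> L * r powr \<alpha>" .
      qed
      have "\<bar>?\<psi>' r\<bar> \<le> L * r powr \<alpha> * (C / r\<^sup>2 + C * (heat2 \<gamma> r (N - 1))\<^sup>2)"
        by (rule kernel[OF _ _ _ h x]) (use r \<epsilon> in \<open>auto intro!: continuous_intros admissible_continuous_x[OF F]\<close>)
      also have "\<dots> = (L * C) * (r powr \<alpha> / r\<^sup>2) + (L * C * r powr \<alpha>) * (heat2 \<gamma> r (N - 1))\<^sup>2"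
        by (simp add: algebra_simps)
      also have "r powr \<alpha> / r\<^sup>2 = r powr (\<alpha> - 2)"
        using r \<epsilon> by (simp add: powr_diff)
      also have "(L * C * r powr \<alpha>) * (heat2 \<gamma> r (N - 1))\<^sup>2 \<le> B * ?a\<^sup>2"
      proof (intro mult_mono power_mono heat2_antimono heat2_nonneg)
        have "r powr \<alpha> \<le> 2 powr \<alpha>" using r \<epsilon> \<alpha> by (intro powr_mono2) auto
        also have "\<dots> \<le> 2 powr 1" using \<alpha> by (intro powr_mono) auto
        finally have "L * C * r powr \<alpha> \<le> L * C * 4" using L C by (intro mult_left_mono) auto
        then show "L * C * r powr \<alpha> \<le> B" by (simp add: B_def)
      qed (use r \<gamma> AB in auto)
      finally show ?thesis by simp
    qed
    have "\<bar>?\<psi> (\<epsilon> + 1) - ?\<psi> \<epsilon>\<bar> \<le> (L * C) * ((\<epsilon> + 1) powr (\<alpha> - 2 + 1) - \<epsilon> powr (\<alpha> - 2 + 1)) / (\<alpha> - 2 + 1) + B * ?a\<^sup>2 * (\<epsilon> + 1 - \<epsilon>)"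
      by (rule powr_comparison_bound[OF \<epsilon>(1) _ _ d b]) (use \<alpha> in auto)
    also have "\<dots> = (L * C) / (1 - \<alpha>) * (\<epsilon> powr (\<alpha> - 1) - (\<epsilon> + 1) powr (\<alpha> - 1)) + B * ?a\<^sup>2"
      using \<alpha> by (simp add: field_simps)
    also have "\<dots> \<le> A * \<epsilon> powr (\<alpha> - 1) + B * ?a\<^sup>2"
      unfolding A_def using L C \<alpha> powr_mono2'[of "\<alpha> - 1" \<epsilon> "\<epsilon> + 1"] \<epsilon>
      by (intro add_right_mono mult_mono divide_right_mono) auto
    finally have 1: "\<bar>?\<psi> (\<epsilon> + 1) - ?\<psi> \<epsilon>\<bar> \<le> A * \<epsilon> powr (\<alpha> - 1) + B * ?a\<^sup>2" .
    have "\<bar>?\<psi> (\<epsilon> + 1)\<bar> \<le> (\<Sum>k<N. 8 * M * (1 / eig \<gamma> k))"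
    proof (rule order_trans[OF sum_abs sum_mono])
      fix k
      let ?e = "eig \<gamma> k"
      have e: "?e > 0" by (rule eig_pos[OF \<gamma>])
      have "- (\<epsilon> + 1) * ?e \<le> - ?e" using e \<epsilon> by (simp add: algebra_simps)
      then have "?e * exp (- (\<epsilon> + 1) * ?e) \<le> ?e * exp (- ?e)" using e by (intro mult_left_mono) auto
      also have "\<dots> \<le> 2 / ?e" by (rule exp_minus_le_inverse[OF e])
      finally have "(?e * exp (- (\<epsilon> + 1) * ?e)) * \<bar>sine_coef k (F t) - ?e * U k (t + \<epsilon> - (\<epsilon> + 1))\<bar> * \<bar>mode k x\<bar> \<le> (2 / ?e) * (4 * M) * 1"
        using e M0 forcing_minus_relaxed_bound abs_mode_le_1 by (intro mult_mono) auto
      then show "\<bar>?e * exp (- (\<epsilon> + 1) * ?e) * (sine_coef k (F t) - ?e * U k (t + \<epsilon> - (\<epsilon> + 1))) * mode k x\<bar> \<le> 8 * M * (1 / ?e)"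
        using e by (simp add: abs_mult)
    qed
    also have "\<dots> = 8 * M * (\<Sum>k<N. 1 / eig \<gamma> k)" by (rule sum_distrib_left[symmetric])
    also have "\<dots> \<le> 8 * M * S"
      unfolding S_def using M0 eig_pos[OF \<gamma>]
      by (intro mult_left_mono sum_le_suminf summable_inverse_eig \<gamma>) (auto simp: less_imp_le)
    also have "\<dots> \<le> 8 * M * S * \<epsilon> powr (\<alpha> - 1)"
    proof -
      have "1 powr (\<alpha> - 1) \<le> \<epsilon> powr (\<alpha> - 1)" using \<epsilon> \<alpha> by (intro powr_mono2') auto
      then show ?thesis using M0 S mult_left_mono[of 1 "\<epsilon> powr (\<alpha> - 1)" "8 * M * S"] by simp
    qed
    finally have 2: "\<bar>?\<psi> (\<epsilon> + 1)\<bar> \<le> 8 * M * S * \<epsilon> powr (\<alpha> - 1)" .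
    have "\<bar>?\<psi> \<epsilon>\<bar> \<le> (8 * M * S + A) * \<epsilon> powr (\<alpha> - 1) + B * ?a\<^sup>2"
      using 1 2 unfolding distrib_right by linarith
    also have "\<dots> \<le> K * \<epsilon> powr (\<alpha> - 1) + K * ?a\<^sup>2"
      using K by (intro add_mono mult_right_mono) auto
    finally show ?thesis by (simp add: sol_coef_dt_def)
  qed
  show ?thesis by (rule exI[of _ K]) (use main K in auto)
qed

text \<open>
  Since \<open>\<epsilon>\<^sup>\<alpha>\<^sup>-\<^sup>1\<close> is integrable at \<open>0\<close>, the regularised time derivatives converge uniformly as \<open>\<epsilon>\<close> tends to \<open>0\<close>.  The
  estimate is made on partial sums, where the truncation error disappears in the limit.
\<close>

lemma smooth_dt_Cauchy:
  "\<exists>K\<ge>0. \<forall>\<epsilon>1 \<epsilon>2. 0 < \<epsilon>1 \<longrightarrow> \<epsilon>1 < \<epsilon>2 \<longrightarrow> \<epsilon>2 \<le> 1 \<longrightarrow> (\<forall>t x. x \<in> {0..1} \<longrightarrow>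
     \<bar>V \<epsilon>2 t x - V \<epsilon>1 t x\<bar> \<le> K * \<epsilon>2 powr \<alpha>)"
proof -
  obtain K where K: "K \<ge> 0" and Z: "\<And>\<epsilon> N t x. 0 < \<epsilon> \<Longrightarrow> \<epsilon> \<le> 1 \<Longrightarrow> x \<in> {0..1} \<Longrightarrow>
     \<bar>\<Sum>k<N. eig \<gamma> k * exp (- \<epsilon> * eig \<gamma> k) * U' k t * mode k x\<bar>
     \<le> K * \<epsilon> powr (\<alpha> - 1) + K * (heat2 \<gamma> \<epsilon> (N - 1))\<^sup>2"
    using smooth_dt_partial_derivative_bound by blast
  have main: "\<bar>V \<epsilon>2 t x - V \<epsilon>1 t x\<bar> \<le> K / \<alpha> * \<epsilon>2 powr \<alpha>"
    if \<epsilon>: "0 < \<epsilon>1" "\<epsilon>1 < \<epsilon>2" "\<epsilon>2 \<le> 1" and x: "x \<in> {0..1}" for \<epsilon>1 \<epsilon>2 t x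
  proof -
    let ?P = "\<lambda>N \<epsilon>. \<Sum>k<N. exp (- \<epsilon> * eig \<gamma> k) * U' k t * mode k x"
    have partial: "\<bar>?P (Suc n) \<epsilon>2 - ?P (Suc n) \<epsilon>1\<bar> \<le> K / \<alpha> * \<epsilon>2 powr \<alpha> + K * (heat2 \<gamma> \<epsilon>1 n)\<^sup>2" for n
    proof -
      have "\<bar>?P (Suc n) \<epsilon>2 - ?P (Suc n) \<epsilon>1\<bar>
        \<le> K * (\<epsilon>2 powr (\<alpha> - 1 + 1) - \<epsilon>1 powr (\<alpha> - 1 + 1)) / (\<alpha> - 1 + 1) + K * (heat2 \<gamma> \<epsilon>1 n)\<^sup>2 * (\<epsilon>2 - \<epsilon>1)"
      proof (rule powr_comparison_bound[OF \<epsilon>(1,2)])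
        fix r
        show "(?P (Suc n) has_real_derivative (\<Sum>k<Suc n. - (eig \<gamma> k * exp (- r * eig \<gamma> k) * U' k t * mode k x))) (at r)"
          by (rule DERIV_sum) (auto intro!: derivative_eq_intros)
        assume r: "\<epsilon>1 < r" "r < \<epsilon>2"
        have "\<bar>\<Sum>k<Suc n. - (eig \<gamma> k * exp (- r * eig \<gamma> k) * U' k t * mode k x)\<bar>
            \<le> K * r powr (\<alpha> - 1) + K * (heat2 \<gamma> r n)\<^sup>2"
          unfolding sum_negf abs_minus_cancel using Z[OF _ _ x, of r t "Suc n"] r \<epsilon> by simp
        also have "K * (heat2 \<gamma> r n)\<^sup>2 \<le> K * (heat2 \<gamma> \<epsilon>1 n)\<^sup>2"
          using K r \<gamma> by (intro mult_left_mono power_mono heat2_antimono heat2_nonneg) auto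
        finally show "\<bar>\<Sum>k<Suc n. - (eig \<gamma> k * exp (- r * eig \<gamma> k) * U' k t * mode k x)\<bar>
            \<le> K * r powr (\<alpha> - 1) + K * (heat2 \<gamma> \<epsilon>1 n)\<^sup>2" by simp
      qed (use \<alpha> in auto)
      also have "\<dots> \<le> K / \<alpha> * \<epsilon>2 powr \<alpha> + K * (heat2 \<gamma> \<epsilon>1 n)\<^sup>2"
      proof (rule add_mono)
        have "K * (\<epsilon>2 powr \<alpha> - \<epsilon>1 powr \<alpha>) \<le> K * \<epsilon>2 powr \<alpha>" using K by (intro mult_left_mono) auto
        then show "K * (\<epsilon>2 powr (\<alpha> - 1 + 1) - \<epsilon>1 powr (\<alpha> - 1 + 1)) / (\<alpha> - 1 + 1) \<le> K / \<alpha> * \<epsilon>2 powr \<alpha>"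
          using \<alpha> by (simp add: divide_right_mono)
        show "K * (heat2 \<gamma> \<epsilon>1 n)\<^sup>2 * (\<epsilon>2 - \<epsilon>1) \<le> K * (heat2 \<gamma> \<epsilon>1 n)\<^sup>2"
          using K \<epsilon> by (intro mult_left_le) auto
      qed
      finally show ?thesis .
    qed
    have lim: "(\<lambda>n. ?P (Suc n) \<epsilon>) \<longlonglongrightarrow> V \<epsilon> t x" if "\<epsilon> > 0" for \<epsilon>
    proof -
      have "uniform_limit UNIV (\<lambda>N x. \<Sum>k<N. (exp (- \<epsilon> * eig \<gamma> k) * U' k t) * mode k x) (V \<epsilon> t) sequentially"
        unfolding smooth_dt_def[abs_def]
        by (rule sine_series_uniform_limit[OF smooth_dt_summable[OF that]])
      from tendsto_uniform_limitI[OF this, of x] show ?thesis by (intro LIMSEQ_Suc) simp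
    qed
    have "(\<lambda>n. \<bar>?P (Suc n) \<epsilon>2 - ?P (Suc n) \<epsilon>1\<bar>) \<longlonglongrightarrow> \<bar>V \<epsilon>2 t x - V \<epsilon>1 t x\<bar>"
      using \<epsilon> by (intro tendsto_intros lim) auto
    moreover have "(\<lambda>n. K / \<alpha> * \<epsilon>2 powr \<alpha> + K * (heat2 \<gamma> \<epsilon>1 n)\<^sup>2) \<longlonglongrightarrow> K / \<alpha> * \<epsilon>2 powr \<alpha> + K * 0\<^sup>2"
      by (intro tendsto_intros heat2_tendsto_0 \<gamma> \<epsilon>)
    ultimately have "\<bar>V \<epsilon>2 t x - V \<epsilon>1 t x\<bar> \<le> K / \<alpha> * \<epsilon>2 powr \<alpha> + K * 0\<^sup>2"
      by (rule LIMSEQ_le) (use partial in blast)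
    then show ?thesis by simp
  qed
  show ?thesis by (rule exI[of _ "K / \<alpha>"]) (use main K \<alpha> in auto)
qed

text \<open>
  The uniform limit of the regularised derivatives is the derivative of the limit.  Its sine coefficients are
  recorded because they identify the fourth space derivative later.
\<close>

lemma sol_t_derivative:
  "\<exists>v. continuous_on (UNIV \<times> {0..1}) (\<lambda>(t, x). v t x) \<and>
     (\<forall>t. \<forall>x\<in>{0..1}. ((\<lambda>t. sol \<gamma> \<omega> F t x) has_real_derivative v t x) (at t)) \<and>
     (\<forall>k t. sine_coef k (v t) = U' k t)"
proof -
  define \<epsilon> where "\<epsilon> n = 1 / real (Suc n)" for n
  have \<epsilon>: "0 < \<epsilon> n" "\<epsilon> n \<le> 1" for n by (auto simp: \<epsilon>_def)
  have \<epsilon>_lim: "\<epsilon> \<longlonglongrightarrow> 0" unfolding \<epsilon>_def by (rule LIMSEQ_Suc[OF lim_1_over_n])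
  obtain K where K: "K \<ge> 0" and Cauchy: "\<And>\<epsilon>1 \<epsilon>2 t x. 0 < \<epsilon>1 \<Longrightarrow> \<epsilon>1 < \<epsilon>2 \<Longrightarrow> \<epsilon>2 \<le> 1 \<Longrightarrow> x \<in> {0..1} \<Longrightarrow>
     \<bar>V \<epsilon>2 t x - V \<epsilon>1 t x\<bar> \<le> K * \<epsilon>2 powr \<alpha>" using smooth_dt_Cauchy by blast
  have close: "\<bar>V (\<epsilon> m) t x - V (\<epsilon> n) t x\<bar> \<le> K * \<epsilon> m powr \<alpha>" if "m < n" "x \<in> {0..1}" for m n t x
    using Cauchy[of "\<epsilon> n" "\<epsilon> m" x t] \<epsilon> that by (auto simp: \<epsilon>_def frac_less2)
  have K\<epsilon>: "(\<lambda>n. K * \<epsilon> n powr \<alpha>) \<longlonglongrightarrow> 0"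
  proof -
    have "(\<lambda>n. \<epsilon> n powr \<alpha>) \<longlonglongrightarrow> 0 powr \<alpha>"
      by (intro tendsto_powr' \<epsilon>_lim tendsto_const) (use \<alpha> \<epsilon> in \<open>auto simp: less_imp_le\<close>)
    from tendsto_mult_left[OF this, of K] show ?thesis by simp
  qed
  let ?W = "\<lambda>n p. V (\<epsilon> n) (fst p) (snd p)"
  have "uniformly_Cauchy_on (UNIV \<times> {0..1}) ?W"
  proof (rule uniformly_Cauchy_onI')
    fix e :: real assume "e > 0"
    with K\<epsilon> obtain N where N: "\<And>n. n \<ge> N \<Longrightarrow> norm (K * \<epsilon> n powr \<alpha> - 0) < e"
      by (meson LIMSEQ_D)
    have "dist (?W m p) (?W n p) < e" if "m \<ge> N" "n > m" "p \<in> UNIV \<times> {0..1}" for m n p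
    proof -
      have "\<bar>?W m p - ?W n p\<bar> \<le> K * \<epsilon> m powr \<alpha>" using that by (intro close) auto
      also have "\<dots> < e" using N[OF that(1)] by simp
      finally show ?thesis by (simp add: dist_real_def)
    qed
    then show "\<exists>N. \<forall>p\<in>UNIV \<times> {0..1}. \<forall>m\<ge>N. \<forall>n>m. dist (?W m p) (?W n p) < e" by blast
  qed
  then have "uniformly_convergent_on (UNIV \<times> {0..1}) ?W"
    by (rule Cauchy_uniformly_convergent)
  then obtain v0 where v0: "uniform_limit (UNIV \<times> {0..1}) ?W v0 sequentially"
    unfolding uniformly_convergent_on_def by blast
  define v where "v t x = v0 (t, x)" for t x
  have ulim: "uniform_limit (UNIV \<times> {0..1}) ?W (\<lambda>p. v (fst p) (snd p)) sequentially"
    using v0 by (simp add: v_def)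
  have cW: "continuous_on S (?W n)" for n S
    by (rule continuous_on_subset[OF continuous_smooth_dt[OF \<epsilon>(1)]]) auto
  have cont: "continuous_on (UNIV \<times> {0..1}) (\<lambda>(t, x). v t x)"
    using uniform_limit_theorem[OF _ ulim] cW by (simp add: case_prod_unfold)
  have der: "((\<lambda>t. sol \<gamma> \<omega> F t x) has_real_derivative v t x) (at t)" if x: "x \<in> {0..1}" for t x
  proof -
    let ?f = "\<lambda>n t. \<Sum>k. exp (- \<epsilon> n * eig \<gamma> k) * U k t * mode k x"
    have lim: "(\<lambda>n. ?f n t) \<longlonglongrightarrow> sol \<gamma> \<omega> F t x" for t
      by (rule smoothed_sol_tendsto[OF _ \<epsilon>_lim]) (use \<epsilon> in \<open>auto simp: less_imp_le\<close>)
    have "\<exists>g. \<forall>t\<in>UNIV. (\<lambda>n. ?f n t) \<longlonglongrightarrow> g t \<and> (g has_derivative (\<lambda>h. v t x * h)) (at t within UNIV)"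
    proof (rule has_derivative_sequence[OF convex_UNIV])
      show "(?f n has_derivative (\<lambda>h. V (\<epsilon> n) t x * h)) (at t within UNIV)" for n t
        using smoothed_sol_derivative[OF \<epsilon>(1)[of n], of x t] by (simp add: has_field_derivative_def)
      show "\<forall>\<^sub>F n in sequentially. \<forall>t\<in>UNIV. \<forall>h. norm (V (\<epsilon> n) t x * h - v t x * h) \<le> e * norm h" if "e > 0" for e
        using uniform_limitD[OF ulim that]
      proof eventually_elim
        case (elim n)
        have "norm (V (\<epsilon> n) t x * h - v t x * h) \<le> e * norm h" for t h
        proof -
          have "\<bar>V (\<epsilon> n) t x - v t x\<bar> \<le> e" using bspec[OF elim, of "(t, x)"] x by (simp add: dist_real_def)
          then have "\<bar>V (\<epsilon> n) t x - v t x\<bar> * \<bar>h\<bar> \<le> e * \<bar>h\<bar>" by (rule mult_right_mono) simp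
          then show ?thesis by (simp add: abs_mult flip: left_diff_distrib)
        qed
        then show ?case by blast
      qed
      show "(\<lambda>n. ?f n 0) \<longlonglongrightarrow> sol \<gamma> \<omega> F 0 x" by (rule lim)
    qed simp
    then obtain g where g: "\<And>t. (\<lambda>n. ?f n t) \<longlonglongrightarrow> g t" "\<And>t. (g has_derivative (\<lambda>h. v t x * h)) (at t)" by auto
    have "g = (\<lambda>t. sol \<gamma> \<omega> F t x)" using g(1) lim LIMSEQ_unique by blast
    then show ?thesis using g(2)[of t] by (simp add: has_field_derivative_def)
  qed
  have coef: "sine_coef k (v t) = U' k t" for k t
  proof -
    have "uniform_limit {0..1} (\<lambda>n x. V (\<epsilon> n) t x) (v t) sequentially"
      using uniform_limit_compose'[OF ulim, of "\<lambda>x. (t, x)" "{0..1}"] by simp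
    then have "(\<lambda>n. sine_coef k (V (\<epsilon> n) t)) \<longlonglongrightarrow> sine_coef k (v t)"
    proof (rule sine_coef_uniform_limit)
      show "continuous_on {0..1} (V (\<epsilon> n) t)" for n
      proof -
        have "continuous_on {0..1} (\<lambda>x. (t, x))" by (intro continuous_intros)
        from continuous_on_compose2[OF cW[of UNIV n] this] show ?thesis by simp
      qed
    qed
    then have 1: "(\<lambda>n. exp (- \<epsilon> n * eig \<gamma> k) * U' k t) \<longlonglongrightarrow> sine_coef k (v t)"
      by (simp only: sine_coef_smooth_dt[OF \<epsilon>(1)])
    have 2: "(\<lambda>n. exp (- \<epsilon> n * eig \<gamma> k) * U' k t) \<longlonglongrightarrow> exp (- 0 * eig \<gamma> k) * U' k t"
      by (intro tendsto_intros \<epsilon>_lim)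
    show ?thesis using LIMSEQ_unique[OF 1 2] by simp
  qed
  show ?thesis using cont der coef by blast
qed

text \<open>
  Existence and continuity of \<open>u\<^sub>t\<close>, \<open>u\<^sub>x\<close> and \<open>u\<^sub>x\<^sub>x\<close> are already known.  Put \<open>G = F - u\<^sub>t + u\<^sub>x\<^sub>x + u\<close>, which is what the
  equation requires \<open>\<gamma> u\<^sub>x\<^sub>x\<^sub>x\<^sub>x\<close> to be.  A comparison of sine coefficients shows that \<open>G\<close> is the second derivative of
  \<open>\<gamma> u\<^sub>x\<^sub>x\<close>.
\<close>

lemma sol_is_classical:
  fixes \<tau> :: "'n::finite \<Rightarrow> real"
  assumes eq: "\<And>t x. x \<in> {0..1} \<Longrightarrow> F t x = g t x + f (\<chi> k. sol \<gamma> \<omega> F (t - \<tau> k) x)"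
  shows "efk_classical_solution UNIV \<gamma> \<tau> f g (sol \<gamma> \<omega> F)"
proof -
  let ?u = "sol \<gamma> \<omega> F" and ?uxx = "sol_xx \<gamma> \<omega> F"
  obtain v where cv: "continuous_on (UNIV \<times> {0..1}) (\<lambda>(t, x). v t x)"
    and v: "\<And>t x. x \<in> {0..1} \<Longrightarrow> ((\<lambda>t. ?u t x) has_real_derivative v t x) (at t)"
    and coef_v: "\<And>k t. sine_coef k (v t) = U' k t"
    using sol_t_derivative by blast
  note cu = admissible_sol(1)[OF F] and cux = continuous_sol_x and cuxx = continuous_sol_xx
  have sub: "continuous_on (UNIV \<times> {0..1}) (\<lambda>(t, x). h t x)" if "continuous_on UNIV (\<lambda>(t, x). h t x)" for h :: "real \<Rightarrow> real \<Rightarrow> real"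
    by (rule continuous_on_subset[OF that]) simp
  define G where "G t x = F t x - v t x + ?uxx t x + ?u t x" for t x
  note cF = admissible_continuous_x[OF F] and cvt = continuous_on_slice[OF cv UNIV_I]
    and cxxt = continuous_on_slice[OF sub[OF cuxx] UNIV_I] and cut = continuous_on_slice[OF sub[OF cu] UNIV_I]
  have cG: "continuous_on {0..1} (G t)" for t
    unfolding G_def[abs_def] by (intro continuous_intros cF cvt cxxt cut)
  have coef: "- (freq k)\<^sup>2 * sine_coef k (\<lambda>x. \<gamma> * ?uxx t x) = sine_coef k (G t)" for k t
  proof -
    define m where "m = freq k"
    define c where "c = U k t"
    have "((\<lambda>x. F t x * mode k x - v t x * mode k x + ?uxx t x * mode k x + ?u t x * mode k x) has_integral
      sine_coef k (F t) / 2 - sine_coef k (v t) / 2 + sine_coef k (?uxx t) / 2 + sine_coef k (?u t) / 2) {0..1}"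
      by (intro has_integral_add has_integral_diff has_integral_sine_coef cF cvt cxxt cut)
    moreover have "((\<lambda>x. F t x * mode k x - v t x * mode k x + ?uxx t x * mode k x + ?u t x * mode k x) has_integral
      sine_coef k (G t) / 2) {0..1}"
      using has_integral_sine_coef[OF cG, of t k] by (simp add: G_def distrib_right left_diff_distrib)
    ultimately have "sine_coef k (G t) / 2 = sine_coef k (F t) / 2 - sine_coef k (v t) / 2 + sine_coef k (?uxx t) / 2 + sine_coef k (?u t) / 2"
      by (blast intro: has_integral_unique)
    then have "sine_coef k (G t) = sine_coef k (F t) - sine_coef k (v t) + sine_coef k (?uxx t) + sine_coef k (?u t)"
      by simp
    also have "sine_coef k (?u t) = c"
      unfolding c_def by (rule sine_coef_sol)
    also have "sine_coef k (?uxx t) = - m\<^sup>2 * c"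
      unfolding c_def m_def by (rule sine_coef_sol_xx)
    also have "sine_coef k (F t) - sine_coef k (v t) + - m\<^sup>2 * c + c = eig \<gamma> k * c - m\<^sup>2 * c + c"
      by (simp add: coef_v sol_coef_dt_def c_def)
    also have "\<dots> = \<gamma> * m ^ 4 * c" unfolding eig_def m_def[symmetric] by (simp add: algebra_simps)
    also have "\<dots> = - m\<^sup>2 * (\<gamma> * (- m\<^sup>2 * c))" by (simp add: algebra_simps eval_nat_numeral)
    also have "\<gamma> * (- m\<^sup>2 * c) = sine_coef k (\<lambda>x. \<gamma> * ?uxx t x)"
    proof -
      have "sine_coef k (?uxx t) = - m\<^sup>2 * c"
        unfolding c_def m_def by (rule sine_coef_sol_xx)
      moreover have "sine_coef k (\<lambda>x. \<gamma> * ?uxx t x) = \<gamma> * sine_coef k (?uxx t)"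
        by (simp add: sine_coef_def mult.assoc)
      ultimately show ?thesis by simp
    qed
    finally show ?thesis by (simp add: m_def)
  qed
  have "\<exists>w'. \<forall>x\<in>{0..1}. ((\<lambda>x. \<gamma> * ?uxx t x) has_real_derivative w' x) (at x within {0..1}) \<and>
    (w' has_real_derivative G t x) (at x within {0..1})" for t
    by (intro second_derivative_from_sine_coefs cG continuous_intros cxxt coef)
  then obtain w' where w': "\<And>t x. x \<in> {0..1} \<Longrightarrow> ((\<lambda>x. \<gamma> * ?uxx t x) has_real_derivative w' t x) (at x within {0..1})"
    "\<And>t x. x \<in> {0..1} \<Longrightarrow> (w' t has_real_derivative G t x) (at x within {0..1})" by metis
  show ?thesis
  proof (rule efk_classical_solutionI[where ut=v and ux="sol_x \<gamma> \<omega> F" and uxx="?uxx"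
        and ?u3.0="\<lambda>t x. w' t x / \<gamma>" and ?u4.0="\<lambda>t x. G t x / \<gamma>"])
    fix t x :: real assume x: "x \<in> {0..1}"
    show "((\<lambda>s. ?u s x) has_real_derivative v t x) (at t)" by (rule v[OF x])
    show "(?u t has_real_derivative sol_x \<gamma> \<omega> F t x) (at x within {0..1})"
      by (rule has_field_derivative_at_within[OF sol_x_derivative])
    show "(sol_x \<gamma> \<omega> F t has_real_derivative ?uxx t x) (at x within {0..1})"
      by (rule has_field_derivative_at_within[OF sol_xx_derivative])
    have "((\<lambda>x. (\<gamma> * ?uxx t x) / \<gamma>) has_real_derivative w' t x / \<gamma>) (at x within {0..1})"
      by (rule DERIV_cdivide[OF w'(1)[OF x]])
    then show "(?uxx t has_real_derivative w' t x / \<gamma>) (at x within {0..1})" using \<gamma> by simp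
    show "((\<lambda>x. w' t x / \<gamma>) has_real_derivative G t x / \<gamma>) (at x within {0..1})"
      by (rule DERIV_cdivide[OF w'(2)[OF x]])
  next
    fix t x :: real assume "x \<in> {0<..<1}"
    then have "F t x = g t x + f (\<chi> k. ?u (t - \<tau> k) x)" by (intro eq) simp
    then show "v t x + \<gamma> * (G t x / \<gamma>) - ?uxx t x - ?u t x = g t x + f (\<chi> k. ?u (t - \<tau> k) x)"
      using \<gamma> by (simp add: G_def)
  qed (rule sub[OF cu] cv sub[OF cux] sub[OF cuxx] | simp add: sol_def sol_xx_def)+
qed

end

end

end

section \<open>Energy dissipation and the Halanay inequality\<close>

lemma bounded_on_unit_interval:
  fixes h :: "real \<Rightarrow> real"
  assumes "continuous_on {0..1} h"
  shows "\<exists>C>0. \<forall>x\<in>{0..1}. \<bar>h x\<bar> \<le> C"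
proof -
  have "compact (h ` {0..1})" by (intro compact_continuous_image assms compact_Icc)
  then obtain C where "C > 0" "\<forall>y\<in>h ` {0..1}. norm y \<le> C"
    using compact_imp_bounded[of "h ` {0..1}"] unfolding bounded_pos by blast
  then show ?thesis by (intro exI[of _ C]) auto
qed

lemma sin_pi_ge:
  assumes "x \<in> {0..1}" shows "2 * x * (1 - x) \<le> sin (pi * x)"
proof (cases "x \<le> 1/2")
  case True
  then have "2 * x \<le> sin (pi * (2 * x) / 2)" using assms by (intro sin_half_pi_ge) auto
  moreover have "2 * x * (1 - x) \<le> 2 * x" using assms by (intro mult_left_le) auto
  ultimately show ?thesis by simp
next
  case False
  then have "2 * (1 - x) \<le> sin (pi * (2 * (1 - x)) / 2)" using assms by (intro sin_half_pi_ge) auto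
  also have "pi * (2 * (1 - x)) / 2 = pi - pi * x" by (simp add: right_diff_distrib)
  also have "sin (pi - pi * x) = sin (pi * x)" by simp
  finally have "2 * (1 - x) \<le> sin (pi * x)" .
  moreover have "x * (2 * (1 - x)) \<le> 1 * (2 * (1 - x))" using assms by (intro mult_right_mono) auto
  moreover have "2 * x * (1 - x) = x * (2 * (1 - x))" by (simp only: mult_ac)
  ultimately show ?thesis by linarith
qed

text \<open>
  The function \<open>q = \<pi> cot (\<pi> x) w\<^sup>2\<close> vanishes at both end points, and its derivative is
  \<open>w'\<^sup>2 - \<pi>\<^sup>2 w\<^sup>2 - (w' - \<pi> cot (\<pi> x) w)\<^sup>2\<close>.
\<close>

lemma wirtinger_inequality:
  assumes w: "\<And>x. x \<in> {0..1} \<Longrightarrow> (w has_real_derivative w1 x) (at x within {0..1})"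
    and w1: "continuous_on {0..1} w1" and w0: "w 0 = 0" "w 1 = 0"
  shows "pi\<^sup>2 * integral {0..1} (\<lambda>x. (w x)\<^sup>2) \<le> integral {0..1} (\<lambda>x. (w1 x)\<^sup>2)"
proof -
  have cw: "continuous_on {0..1} w" using w by (rule DERIV_continuous_on)
  obtain C where C: "C > 0" "\<forall>x\<in>{0..1}. \<bar>w1 x\<bar> \<le> C" using bounded_on_unit_interval[OF w1] by blast
  have lip: "\<bar>w x - w y\<bar> \<le> C * \<bar>x - y\<bar>" if "x \<in> {0..1}" "y \<in> {0..1}" for x y
    using field_differentiable_bound[of "{0..1}" w w1 C x y] w C that by auto
  define q where "q x = pi * cos (pi * x) * ((w x)\<^sup>2 / sin (pi * x))" for x
  have sinpos: "sin (pi * x) > 0" if "x \<in> {0<..<1}" for x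
    using that by (intro sin_gt_zero) auto
  have qle: "\<bar>q x\<bar> \<le> 2 * pi * C\<^sup>2 * (x * (1 - x))" if x: "x \<in> {0..1}" for x
  proof (cases "x \<in> {0<..<1}")
    case False
    then have "x = 0 \<or> x = 1" using x by auto
    then show ?thesis by (auto simp: q_def w0)
  next
    case True
    have "\<bar>w x\<bar> \<le> C * x" "\<bar>w x\<bar> \<le> C * (1 - x)"
      using lip[OF x, of 0] lip[OF x, of 1] x w0 by (auto simp: abs_if split: if_splits)
    have "\<bar>w x\<bar> \<le> C * (2 * (x * (1 - x)))"
    proof (cases "x \<le> 1/2")
      case True
      have "x * 1 \<le> x * (2 * (1 - x))" using x True by (intro mult_left_mono) auto
      then have "x \<le> 2 * (x * (1 - x))" by (simp only: mult_1_right mult.left_commute[of x])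
      then have "C * x \<le> C * (2 * (x * (1 - x)))" using C by (intro mult_left_mono) auto
      then show ?thesis using \<open>\<bar>w x\<bar> \<le> C * x\<close> by linarith
    next
      case False
      have "1 * (1 - x) \<le> (2 * x) * (1 - x)" using x False by (intro mult_right_mono) auto
      then have "1 - x \<le> 2 * (x * (1 - x))" by (simp only: mult_1 mult.assoc)
      then have "C * (1 - x) \<le> C * (2 * (x * (1 - x)))" using C by (intro mult_left_mono) auto
      then show ?thesis using \<open>\<bar>w x\<bar> \<le> C * (1 - x)\<close> by linarith
    qed
    then have "\<bar>w x\<bar>\<^sup>2 \<le> (C * (2 * (x * (1 - x))))\<^sup>2" by (intro power_mono) auto
    then have "(w x)\<^sup>2 \<le> C\<^sup>2 * (2 * (x * (1 - x))) * (2 * x * (1 - x))"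
      by (simp add: power2_eq_square mult_ac)
    also have "\<dots> \<le> C\<^sup>2 * (2 * (x * (1 - x))) * sin (pi * x)"
      using sin_pi_ge[OF x] x C by (intro mult_left_mono) auto
    finally have "(w x)\<^sup>2 / sin (pi * x) \<le> C\<^sup>2 * (2 * (x * (1 - x)))"
      using sinpos[OF True] by (simp add: pos_divide_le_eq)
    then have "\<bar>cos (pi * x)\<bar> * ((w x)\<^sup>2 / sin (pi * x)) \<le> 1 * (C\<^sup>2 * (2 * (x * (1 - x))))"
      using sinpos[OF True] by (intro mult_mono) auto
    then have le: "pi * (\<bar>cos (pi * x)\<bar> * ((w x)\<^sup>2 / sin (pi * x))) \<le> pi * (1 * (C\<^sup>2 * (2 * (x * (1 - x)))))"
      by (intro mult_left_mono) auto
    have "\<bar>q x\<bar> = pi * (\<bar>cos (pi * x)\<bar> * ((w x)\<^sup>2 / sin (pi * x)))"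
      using sinpos[OF True] by (simp add: q_def abs_mult)
    also note le
    also have "pi * (1 * (C\<^sup>2 * (2 * (x * (1 - x))))) = 2 * pi * C\<^sup>2 * (x * (1 - x))"
      by (simp only: mult_ac mult_1)
    finally show ?thesis .
  qed
  have q0: "q 0 = 0" "q 1 = 0" by (simp_all add: q_def w0)
  let ?q' = "\<lambda>x. (w1 x)\<^sup>2 - pi\<^sup>2 * (w x)\<^sup>2 - (w1 x - pi * (cos (pi * x) / sin (pi * x)) * w x)\<^sup>2"
  have dq: "(q has_real_derivative ?q' x) (at x)" if x: "x \<in> {0<..<1}" for x
  proof -
    define s c where "s = sin (pi * x)" and "c = cos (pi * x)"
    have s: "s > 0" using sinpos[OF x] by (simp add: s_def)
    have sc: "s\<^sup>2 + c\<^sup>2 = 1" by (simp add: s_def c_def)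
    have dw: "(w has_real_derivative w1 x) (at x)"
      using w[of x] x by (simp add: at_within_Icc_at)
    have d1: "((\<lambda>x. (w x)\<^sup>2) has_real_derivative 2 * w x * w1 x) (at x)"
      using DERIV_power[OF dw, of 2] by (simp add: mult_ac)
    have d2: "((\<lambda>x. sin (pi * x)) has_real_derivative c * pi) (at x)"
      unfolding c_def by (auto intro!: derivative_eq_intros)
    have d3: "((\<lambda>x. pi * cos (pi * x)) has_real_derivative - pi * s * pi) (at x)"
      unfolding s_def by (auto intro!: derivative_eq_intros)
    have "sin (pi * x) \<noteq> 0" using s by (simp add: s_def)
    from DERIV_mult[OF d3 DERIV_divide[OF d1 d2 this]]
    have "(q has_real_derivative - pi * s * pi * ((w x)\<^sup>2 / s) + (2 * w x * w1 x * s - (w x)\<^sup>2 * (c * pi)) / (s * s) * (pi * c)) (at x)"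
      unfolding q_def[abs_def] s_def c_def .
    moreover have "- pi * s * pi * ((w x)\<^sup>2 / s) + (2 * w x * w1 x * s - (w x)\<^sup>2 * (c * pi)) / (s * s) * (pi * c) = ?q' x"
      unfolding s_def[symmetric] c_def[symmetric] using s
      by (simp add: field_simps power2_eq_square)
    ultimately show ?thesis by (simp only:)
  qed
  have "continuous (at x within {0..1}) q" if x: "x \<in> {0..1}" for x
  proof (cases "x \<in> {0<..<1}")
    case True
    then show ?thesis using DERIV_isCont[OF dq[OF True]] by (simp add: continuous_at_imp_continuous_at_within)
  next
    case False
    then have e: "x = 0 \<or> x = 1" using x by auto
    have "(q \<longlongrightarrow> 0) (at x within {0..1})"
    proof (rule Lim_null_comparison)
      show "\<forall>\<^sub>F y in at x within {0..1}. norm (q y) \<le> 2 * pi * C\<^sup>2 * (y * (1 - y))"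
        unfolding eventually_at_filter using qle by (auto intro!: always_eventually)
      have "((\<lambda>y. 2 * pi * C\<^sup>2 * (y * (1 - y))) \<longlongrightarrow> 2 * pi * C\<^sup>2 * (x * (1 - x))) (at x within {0..1})"
        by (intro tendsto_intros)
      then show "((\<lambda>y. 2 * pi * C\<^sup>2 * (y * (1 - y))) \<longlongrightarrow> 0) (at x within {0..1})" using e by auto
    qed
    then show ?thesis using e q0 by (auto simp: continuous_within)
  qed
  then have cq: "continuous_on {0..1} q" by (simp add: continuous_on_eq_continuous_within)
  have "(?q' has_integral (q 1 - q 0)) {0..1}"
    by (rule fundamental_theorem_of_calculus_interior[OF _ cq])
      (use dq in \<open>auto simp: has_real_derivative_iff_has_vector_derivative\<close>)
  moreover have "((\<lambda>x. (w1 x)\<^sup>2 - pi\<^sup>2 * (w x)\<^sup>2) has_integral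
      integral {0..1} (\<lambda>x. (w1 x)\<^sup>2) - pi\<^sup>2 * integral {0..1} (\<lambda>x. (w x)\<^sup>2)) {0..1}"
    by (intro has_integral_diff has_integral_mult_right integrable_integral integrable_continuous_real continuous_intros w1 cw)
  ultimately have "q 1 - q 0 \<le> integral {0..1} (\<lambda>x. (w1 x)\<^sup>2) - pi\<^sup>2 * integral {0..1} (\<lambda>x. (w x)\<^sup>2)"
    by (rule has_integral_le) simp
  then show ?thesis by (simp add: q0)
qed

text \<open>
  For a classical solution the third derivative need not extend to the boundary, so the boundary terms of the
  integration by parts are controlled along suitable points only.  By the mean value theorem, an interval of
  length \<open>\<delta>\<close> within distance \<open>2 \<delta>\<close> of the end point contains a point where \<open>\<delta> w\<^sub>x\<^sub>x\<^sub>x\<close> is small, while \<open>w\<close> is of order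
  \<open>\<delta>\<close> there.
\<close>

lemma boundary_flux_small:
  assumes w: "\<And>x. x \<in> {0..1} \<Longrightarrow> (w has_real_derivative w1 x) (at x within {0..1})"
    and w1: "continuous_on {0..1} w1" and w2: "continuous_on {0..1} w2"
    and w3: "\<And>x. x \<in> {0<..<1} \<Longrightarrow> (w2 has_real_derivative w3 x) (at x)"
    and p: "p = 0 \<or> p = 1" "w p = 0" "w2 p = 0" and e: "e > 0"
  shows "\<exists>z\<in>{0<..<1}. \<bar>z - p\<bar> < e \<and> \<bar>w z * w3 z - w1 z * w2 z\<bar> < e"
proof -
  obtain C where C: "C > 0" "\<forall>x\<in>{0..1}. \<bar>w1 x\<bar> \<le> C" using bounded_on_unit_interval[OF w1] by blast
  define e' where "e' = e / (6 * C)"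
  have e': "e' > 0" using e C by (simp add: e'_def)
  have "p \<in> {0..1}" using p by auto
  then obtain d where d: "d > 0" "\<And>y. y \<in> {0..1} \<Longrightarrow> \<bar>y - p\<bar> < d \<Longrightarrow> \<bar>w2 y\<bar> < e'"
    using w2 e' p(3) unfolding continuous_on_iff dist_real_def by (metis diff_zero)
  define \<delta> where "\<delta> = min d (min e 1) / 4"
  have \<delta>: "\<delta> > 0" "2 * \<delta> < d" "2 * \<delta> < e" "2 * \<delta> < 1" using d e by (auto simp: \<delta>_def)
  \<comment> \<open>The interval from \<open>l\<close> to \<open>l + \<delta>\<close> lies inside the unit interval, between the distances \<open>\<delta>\<close> and \<open>2 \<delta>\<close> from \<open>p\<close>.\<close>
  define l where "l = (if p = 0 then \<delta> else 1 - 2 * \<delta>)"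
  have l: "0 < l" "l + \<delta> < 1" "\<And>y. l \<le> y \<Longrightarrow> y \<le> l + \<delta> \<Longrightarrow> \<bar>y - p\<bar> \<le> 2 * \<delta>"
    using \<delta> p(1) by (auto simp: l_def abs_if)
  obtain z where z: "l < z" "z < l + \<delta>" "w2 (l + \<delta>) - w2 l = (l + \<delta> - l) * w3 z"
    using MVT2[of l "l + \<delta>" w2 w3] w3 l \<delta> by force
  have zI: "z \<in> {0<..<1}" "z \<in> {0..1}" using z l by auto
  have zp: "\<bar>z - p\<bar> \<le> 2 * \<delta>" using z by (intro l(3)) auto
  have "\<bar>\<delta> * w3 z\<bar> \<le> \<bar>w2 (l + \<delta>)\<bar> + \<bar>w2 l\<bar>" using z(3) by simp
  also have "\<dots> \<le> e' + e'"
    using d(2)[of "l + \<delta>"] d(2)[of l] l(1,2) l(3)[of l] l(3)[of "l + \<delta>"] \<delta> by (intro add_mono) auto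
  finally have f3: "\<delta> * \<bar>w3 z\<bar> \<le> 2 * e'" using \<delta> by (simp add: abs_mult)
  have "\<bar>w z - w p\<bar> \<le> C * \<bar>z - p\<bar>"
    using field_differentiable_bound[of "{0..1}" w w1 C z p] w C zI(2) \<open>p \<in> {0..1}\<close> by auto
  also have "\<dots> \<le> C * (2 * \<delta>)" using zp C by (intro mult_left_mono) auto
  finally have "\<bar>w z\<bar> \<le> 2 * C * \<delta>" using p by simp
  then have "\<bar>w z\<bar> * \<bar>w3 z\<bar> \<le> 2 * C * \<delta> * \<bar>w3 z\<bar>" by (rule mult_right_mono) simp
  also have "\<dots> \<le> 2 * C * (2 * e')" using f3 C by (simp only: mult.assoc) (intro mult_left_mono, auto)
  finally have 1: "\<bar>w z * w3 z\<bar> \<le> 4 * C * e'" by (simp add: abs_mult)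
  have "\<bar>w1 z\<bar> * \<bar>w2 z\<bar> \<le> C * e'"
    using C zI d(2)[OF zI(2)] zp \<delta> by (intro mult_mono) auto
  then have "\<bar>w1 z * w2 z\<bar> \<le> C * e'" by (simp add: abs_mult)
  with 1 have "\<bar>w z * w3 z - w1 z * w2 z\<bar> \<le> 5 * (C * e')" by linarith
  also have "\<dots> < e" using C e by (simp add: e'_def)
  finally show ?thesis using zI zp \<delta> by (intro bexI[of _ z]) auto
qed

text \<open>
  The energy estimate at a fixed time.  Two integrations by parts turn \<open>- \<gamma> w w\<^sub>x\<^sub>x\<^sub>x\<^sub>x\<close> into \<open>- \<gamma> w\<^sub>x\<^sub>x\<^sup>2\<close>, and one turns
  \<open>w w\<^sub>x\<^sub>x\<close> into \<open>- w\<^sub>x\<^sup>2\<close>.  Wirtinger's inequality, and its consequence \<open>\<pi>\<^sup>4 \<integral>w\<^sup>2 \<le> \<integral>w\<^sub>x\<^sub>x\<^sup>2\<close>, give the rate of dissipation.  The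
  fourth derivative may be unbounded near the boundary, but the equation bounds \<open>w w\<^sub>x\<^sub>x\<^sub>x\<^sub>x\<close> pointwise by
  integrable quantities.
\<close>

lemma energy_dissipation:
  assumes \<gamma>: "\<gamma> > 0"
    and w: "\<And>x. x \<in> {0..1} \<Longrightarrow> (w has_real_derivative w1 x) (at x within {0..1})"
    and w1: "\<And>x. x \<in> {0..1} \<Longrightarrow> (w1 has_real_derivative w2 x) (at x within {0..1})"
    and w2: "continuous_on {0..1} w2" and wt: "continuous_on {0..1} wt"
    and w3: "\<And>x. x \<in> {0<..<1} \<Longrightarrow> (w2 has_real_derivative w3 x) (at x)"
    and w4: "\<And>x. x \<in> {0<..<1} \<Longrightarrow> (w3 has_real_derivative w4 x) (at x)"
    and bc: "w 0 = 0" "w 1 = 0" "w2 0 = 0" "w2 1 = 0"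
    and pde: "\<And>x. x \<in> {0<..<1} \<Longrightarrow> wt x + \<gamma> * w4 x - w2 x - w x = h x"
    and H: "H integrable_on {0..1}" "\<And>x. x \<in> {0<..<1} \<Longrightarrow> 2 * (w x * h x) \<le> H x"
  shows "integral {0..1} (\<lambda>x. 2 * w x * wt x)
    \<le> - 2 * (\<gamma> * pi ^ 4 + pi\<^sup>2 - 1) * integral {0..1} (\<lambda>x. (w x)\<^sup>2) + integral {0..1} H"
proof -
  have cw: "continuous_on {0..1} w" using w by (rule DERIV_continuous_on)
  have cw1: "continuous_on {0..1} w1" using w1 by (rule DERIV_continuous_on)
  \<comment> \<open>The flux: its derivative is \<open>w w'''' - w''\<^sup>2\<close>.\<close>
  define K where "K x = w x * w3 x - w1 x * w2 x" for x
  define \<phi> where "\<phi> x = 2 * w x * wt x + 2 * \<gamma> * (w2 x)\<^sup>2 - 2 * (w x * w2 x) - 2 * (w x)\<^sup>2 - H x" for x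
  have int\<phi>: "\<phi> integrable_on {0..1}"
    unfolding \<phi>_def[abs_def]
    by (intro integrable_diff H integrable_continuous_real continuous_intros cw w2 wt)
  let ?I = "\<lambda>x. integral {0..x} \<phi>"
  have step: "?I b - ?I a \<le> - 2 * \<gamma> * (K b - K a)" if ab: "0 < a" "a < b" "b < 1" for a b
  proof -
    have dK: "(K has_real_derivative w x * w4 x - (w2 x)\<^sup>2) (at x)" if x: "x \<in> {0<..<1}" for x
    proof -
      have "(w has_real_derivative w1 x) (at x)" "(w1 has_real_derivative w2 x) (at x)"
        using w[of x] w1[of x] x by (simp_all add: at_within_Icc_at)
      then show ?thesis unfolding K_def[abs_def]
        by (auto intro!: derivative_eq_intros w3[OF x] w4[OF x] simp: power2_eq_square)
    qed
    have "((\<lambda>x. w x * w4 x - (w2 x)\<^sup>2) has_integral K b - K a) {a..b}"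
    proof (rule fundamental_theorem_of_calculus)
      fix x assume "x \<in> {a..b}"
      then have "x \<in> {0<..<1}" using ab by auto
      from has_field_derivative_at_within[OF dK[OF this]]
      show "(K has_vector_derivative w x * w4 x - (w2 x)\<^sup>2) (at x within {a..b})"
        by (simp add: has_real_derivative_iff_has_vector_derivative)
    qed (use ab in simp)
    then have R: "((\<lambda>x. - 2 * \<gamma> * (w x * w4 x - (w2 x)\<^sup>2)) has_integral - 2 * \<gamma> * (K b - K a)) {a..b}"
      by (rule has_integral_mult_right)
    have int: "\<phi> integrable_on {a..b}"
      by (rule integrable_subinterval_real[OF int\<phi>]) (use ab in auto)
    have "integral {a..b} \<phi> \<le> - 2 * \<gamma> * (K b - K a)"
    proof (rule has_integral_le[OF integrable_integral[OF int] R])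
      fix x assume "x \<in> {a..b}"
      then have x: "x \<in> {0<..<1}" using ab by auto
      have "2 * (w x * (wt x + \<gamma> * w4 x - w2 x - w x)) \<le> H x" using H(2)[OF x] pde[OF x] by simp
      then show "\<phi> x \<le> - 2 * \<gamma> * (w x * w4 x - (w2 x)\<^sup>2)"
        unfolding \<phi>_def by (simp add: algebra_simps power2_eq_square)
    qed
    moreover have "?I a + integral {a..b} \<phi> = ?I b"
      by (rule Henstock_Kurzweil_Integration.integral_combine)
        (use ab in \<open>auto intro: integrable_subinterval_real[OF int\<phi>]\<close>)
    ultimately show ?thesis by linarith
  qed
  have ex: "\<exists>z\<in>{0<..<1}. \<bar>z - p\<bar> < 1 / (real n + 3) \<and> \<bar>K z\<bar> < 1 / (real n + 3)" if "p = 0 \<or> p = 1" for p and n :: nat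
    unfolding K_def by (rule boundary_flux_small[OF w cw1 w2 w3]) (use that bc in auto)
  obtain a where a: "\<And>n. a n \<in> {0<..<1}" "\<And>n. \<bar>a n - 0\<bar> < 1 / (real n + 3)" "\<And>n. \<bar>K (a n)\<bar> < 1 / (real n + 3)"
    using ex[of 0] by (metis (no_types))
  obtain b where b: "\<And>n. b n \<in> {0<..<1}" "\<And>n. \<bar>b n - 1\<bar> < 1 / (real n + 3)" "\<And>n. \<bar>K (b n)\<bar> < 1 / (real n + 3)"
    using ex[of 1] by (metis (no_types))
  have null: "(\<lambda>n. 1 / (real n + 3)) \<longlonglongrightarrow> 0"
    by real_asymp
  have conv: "X \<longlonglongrightarrow> c" if "\<And>n. \<bar>X n - c\<bar> < 1 / (real n + 3)" for X and c :: real
    by (rule Lim_transform2[OF tendsto_const], rule Lim_null_comparison[OF _ null])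
      (use that in \<open>auto intro!: always_eventually less_imp_le simp: abs_minus_commute\<close>)
  have alim: "a \<longlonglongrightarrow> 0" and blim: "b \<longlonglongrightarrow> 1" using conv a(2) b(2) by blast+
  have Ka: "(\<lambda>n. K (a n)) \<longlonglongrightarrow> 0" and Kb: "(\<lambda>n. K (b n)) \<longlonglongrightarrow> 0"
    using conv[of "\<lambda>n. K (a n)" 0] conv[of "\<lambda>n. K (b n)" 0] a(3) b(3) by simp_all
  have ab: "a n < b n" for n
  proof -
    have "1 / (real n + 3) \<le> 1 / 3" by (intro divide_left_mono) auto
    then show ?thesis using a(2)[of n] b(2)[of n] by linarith
  qed
  note cI = indefinite_integral_continuous_1[OF int\<phi>]
  have Ia: "(\<lambda>n. ?I (a n)) \<longlonglongrightarrow> ?I 0"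
    by (rule continuous_on_tendsto_compose[OF cI alim]) (use a in \<open>auto intro!: always_eventually less_imp_le\<close>)
  have Ib: "(\<lambda>n. ?I (b n)) \<longlonglongrightarrow> ?I 1"
    by (rule continuous_on_tendsto_compose[OF cI blim]) (use b in \<open>auto intro!: always_eventually less_imp_le\<close>)
  have "?I 1 - ?I 0 \<le> - 2 * \<gamma> * (0 - 0)"
    by (rule LIMSEQ_le[OF tendsto_diff[OF Ib Ia] tendsto_mult[OF tendsto_const tendsto_diff[OF Kb Ka]]])
      (use step a(1) b(1) ab in auto)
  then have "integral {0..1} \<phi> \<le> 0" by simp
  define W0 W1 W2 W02 where "W0 = integral {0..1} (\<lambda>x. (w x)\<^sup>2)" and "W1 = integral {0..1} (\<lambda>x. (w1 x)\<^sup>2)"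
    and "W2 = integral {0..1} (\<lambda>x. (w2 x)\<^sup>2)" and "W02 = integral {0..1} (\<lambda>x. w x * w2 x)"
  have iW: "((\<lambda>x. (w x)\<^sup>2) has_integral W0) {0..1}" "((\<lambda>x. (w1 x)\<^sup>2) has_integral W1) {0..1}"
    "((\<lambda>x. (w2 x)\<^sup>2) has_integral W2) {0..1}" "((\<lambda>x. w x * w2 x) has_integral W02) {0..1}"
    unfolding W0_def W1_def W2_def W02_def
    by (intro integrable_integral integrable_continuous_real continuous_intros cw cw1 w2)+
  have it: "((\<lambda>x. 2 * w x * wt x) has_integral integral {0..1} (\<lambda>x. 2 * w x * wt x)) {0..1}"
    by (intro integrable_integral integrable_continuous_real continuous_intros cw wt)
  have "(\<phi> has_integral integral {0..1} (\<lambda>x. 2 * w x * wt x) + 2 * \<gamma> * W2 - 2 * W02 - 2 * W0 - integral {0..1} H) {0..1}"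
    unfolding \<phi>_def[abs_def]
    by (intro has_integral_add has_integral_diff has_integral_mult_right it iW integrable_integral H)
  with \<open>integral {0..1} \<phi> \<le> 0\<close>
  have main: "integral {0..1} (\<lambda>x. 2 * w x * wt x) \<le> - 2 * \<gamma> * W2 + 2 * W02 + 2 * W0 + integral {0..1} H"
    by (simp add: integral_unique)
  have parts: "((\<lambda>x. w1 x * w1 x + w x * w2 x) has_integral w 1 * w1 1 - w 0 * w1 0) {0..1}"
  proof (rule fundamental_theorem_of_calculus)
    fix x :: real assume x: "x \<in> {0..1}"
    show "((\<lambda>x. w x * w1 x) has_vector_derivative w1 x * w1 x + w x * w2 x) (at x within {0..1})"
      unfolding has_real_derivative_iff_has_vector_derivative [symmetric]
      by (auto intro!: derivative_eq_intros w[OF x] w1[OF x])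
  qed simp
  have "((\<lambda>x. w1 x * w1 x + w x * w2 x) has_integral W1 + W02) {0..1}"
    using has_integral_add[OF iW(2,4)] by (simp add: power2_eq_square)
  from has_integral_unique[OF parts this] have W02: "W02 = - W1" by (simp add: bc)
  have poincare: "pi\<^sup>2 * W0 \<le> W1"
    unfolding W0_def W1_def by (rule wirtinger_inequality[OF w cw1 bc(1,2)])
  \<comment> \<open>Expanding the square of \<open>w'' + \<pi>\<^sup>2 w\<close> bounds the integral of \<open>w''\<^sup>2\<close> from below.\<close>
  have "((\<lambda>x. (w2 x)\<^sup>2 + 2 * pi\<^sup>2 * (w x * w2 x) + pi ^ 4 * (w x)\<^sup>2) has_integral W2 + 2 * pi\<^sup>2 * W02 + pi ^ 4 * W0) {0..1}"
    by (intro has_integral_add has_integral_mult_right iW)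
  moreover have "(w2 x)\<^sup>2 + 2 * pi\<^sup>2 * (w x * w2 x) + pi ^ 4 * (w x)\<^sup>2 = (w2 x + pi\<^sup>2 * w x)\<^sup>2" for x
    by (simp add: power2_eq_square algebra_simps eval_nat_numeral)
  ultimately have "((\<lambda>x. (w2 x + pi\<^sup>2 * w x)\<^sup>2) has_integral W2 + 2 * pi\<^sup>2 * W02 + pi ^ 4 * W0) {0..1}"
    by (simp only:)
  from has_integral_nonneg[OF this] have "0 \<le> W2 + 2 * pi\<^sup>2 * W02 + pi ^ 4 * W0" by simp
  moreover have "2 * pi\<^sup>2 * W02 = - 2 * (pi\<^sup>2 * W1)" unfolding W02 by simp
  moreover have "pi\<^sup>2 * (pi\<^sup>2 * W0) \<le> pi\<^sup>2 * W1" using poincare by (rule mult_left_mono) simp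
  moreover have "pi\<^sup>2 * (pi\<^sup>2 * W0) = pi ^ 4 * W0" by (simp add: power4_eq_xxxx power2_eq_square)
  ultimately have "pi ^ 4 * W0 \<le> W2" by linarith
  then have "\<gamma> * (pi ^ 4 * W0) \<le> \<gamma> * W2" using \<gamma> by (intro mult_left_mono) auto
  with main poincare W02 have "integral {0..1} (\<lambda>x. 2 * w x * wt x)
      \<le> - 2 * (\<gamma> * (pi ^ 4 * W0)) - 2 * (pi\<^sup>2 * W0) + 2 * W0 + integral {0..1} H"
    by linarith
  then show ?thesis unfolding W0_def[symmetric] by (simp add: algebra_simps)
qed

text \<open>
  If the strict bound fails for some larger constant \<open>N\<close>, consider the first time at which it fails.  Up to that
  time all delayed values obey the bound, and the choice of \<open>\<mu>\<close> makes the derivative of \<open>E t - N exp (- \<mu> t)\<close>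
  negative there, so the difference would have been positive before.
\<close>

lemma halanay_inequality:
  fixes \<tau> \<beta> :: "'n::finite \<Rightarrow> real" and E E' :: "real \<Rightarrow> real"
  assumes \<tau>: "\<And>k. \<tau> k > 0" "\<And>k. \<tau> k \<le> r" and \<beta>: "\<And>k. \<beta> k \<ge> 0"
    and \<mu>: "\<mu> > 0" "(\<Sum>k\<in>UNIV. \<beta> k * exp (\<mu> * \<tau> k)) + \<mu> < a"
    and der: "\<And>t. t \<ge> 0 \<Longrightarrow> (E has_real_derivative E' t) (at t within {0..})"
    and le: "\<And>t. t \<ge> 0 \<Longrightarrow> E' t \<le> - a * E t + (\<Sum>k\<in>UNIV. \<beta> k * E (t - \<tau> k))"
    and init: "\<And>t. - r \<le> t \<Longrightarrow> t \<le> 0 \<Longrightarrow> E t \<le> M" and M: "M \<ge> 0" and t: "t \<ge> 0"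
  shows "E t \<le> M * exp (- \<mu> * t)"
proof -
  have r: "r > 0" using \<tau>[of undefined] by linarith
  have strict: "E t < N * exp (- \<mu> * t)" if N: "N > M" and t: "t \<ge> 0" for N t
  proof (rule ccontr)
    assume neg: "\<not> E t < N * exp (- \<mu> * t)"
    define h where "h s = E s - N * exp (- \<mu> * s)" for s
    have dh: "(h has_real_derivative E' s - N * (exp (- \<mu> * s) * (- \<mu>))) (at s within {0..})" if "s \<ge> 0" for s
      unfolding h_def[abs_def] by (auto intro!: derivative_eq_intros der that)
    have ch: "continuous_on {0..t} h"
      by (rule DERIV_continuous_on, rule DERIV_subset[OF dh]) auto
    define S where "S = {0..t} \<inter> h -` {0..}"
    have "closed S" unfolding S_def by (rule continuous_closed_preimage[OF ch]) auto
    moreover have "bounded S" unfolding S_def by (rule bounded_subset[of "{0..t}"]) auto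
    ultimately have cS: "compact S" by (simp add: compact_eq_bounded_closed)
    have "t \<in> S" using neg t by (simp add: S_def h_def)
    then obtain s where s: "s \<in> S" "\<And>y. y \<in> S \<Longrightarrow> s \<le> y"
      using compact_attains_inf[OF cS] by blast
    have s0: "0 \<le> s" "s \<le> t" "h s \<ge> 0" using s(1) by (auto simp: S_def)
    have before: "h y < 0" if "0 \<le> y" "y < s" for y
      using s(2)[of y] that s0 by (force simp: S_def)
    have "h 0 < 0" using init[of 0] r N by (simp add: h_def)
    then have "s > 0" using s0 by (cases "s = 0") auto
    have past: "E y \<le> N * exp (- \<mu> * y)" if "- r \<le> y" "y < s" for y
    proof (cases "y \<ge> 0")
      case True
      then show ?thesis using before[of y] that by (simp add: h_def)
    next
      case False
      then have "1 \<le> exp (- \<mu> * y)" using \<mu> by (simp add: mult_nonneg_nonpos)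
      then have "N * 1 \<le> N * exp (- \<mu> * y)" using N M by (intro mult_left_mono) auto
      then show ?thesis using init[of y] that False N by auto
    qed
    let ?e = "N * exp (- \<mu> * s)"
    have e: "?e > 0" using N M by simp
    have "E (s - \<tau> k) \<le> ?e * exp (\<mu> * \<tau> k)" for k
      using past[of "s - \<tau> k"] \<tau>[of k] s0 by (simp add: algebra_simps exp_add[symmetric] flip: exp_add)
    then have "(\<Sum>k\<in>UNIV. \<beta> k * E (s - \<tau> k)) \<le> (\<Sum>k\<in>UNIV. \<beta> k * (?e * exp (\<mu> * \<tau> k)))"
      using \<beta> by (intro sum_mono mult_left_mono) auto
    also have "\<dots> = ?e * (\<Sum>k\<in>UNIV. \<beta> k * exp (\<mu> * \<tau> k))"
      by (simp add: sum_distrib_left mult_ac)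
    finally have S: "(\<Sum>k\<in>UNIV. \<beta> k * E (s - \<tau> k)) \<le> ?e * (\<Sum>k\<in>UNIV. \<beta> k * exp (\<mu> * \<tau> k))" .
    have "0 \<le> (\<Sum>k\<in>UNIV. \<beta> k * exp (\<mu> * \<tau> k))" using \<beta> by (intro sum_nonneg) auto
    then have "a \<ge> 0" using \<mu> by linarith
    then have "a * ?e \<le> a * E s" using s0 by (intro mult_left_mono) (auto simp: h_def)
    then have "E' s \<le> ?e * ((\<Sum>k\<in>UNIV. \<beta> k * exp (\<mu> * \<tau> k)) - a)"
      using le[OF s0(1)] S by (simp add: algebra_simps)
    also have "\<dots> < ?e * (- \<mu>)" using \<mu> e by (intro mult_strict_left_mono) auto
    finally have neg': "E' s - N * (exp (- \<mu> * s) * (- \<mu>)) < 0" by simp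
    have "(h has_real_derivative E' s - N * (exp (- \<mu> * s) * (- \<mu>))) (at s)"
      using dh[OF s0(1)] \<open>s > 0\<close> at_within_interior[of s "{0..}"] by simp
    from DERIV_neg_dec_left[OF this neg'] obtain d where d: "d > 0" "\<And>y. 0 < y \<Longrightarrow> y < d \<Longrightarrow> h s < h (s - y)" by blast
    have "h s < h (s - min (d / 2) s)" using d \<open>s > 0\<close> by (intro d(2)) auto
    moreover have "h (s - min (d / 2) s) < 0" using d \<open>s > 0\<close> by (intro before) auto
    ultimately show False using s0 by linarith
  qed
  show ?thesis
  proof (rule field_le_epsilon)
    fix \<epsilon> :: real assume \<epsilon>: "\<epsilon> > 0"
    have "exp (- \<mu> * t) \<le> 1" using \<mu> t by simp
    then have "\<epsilon> * exp (- \<mu> * t) \<le> \<epsilon>" using \<epsilon> by (intro mult_left_le) auto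
    moreover have "E t < (M + \<epsilon>) * exp (- \<mu> * t)" using \<epsilon> t by (intro strict) auto
    ultimately show "E t \<le> M * exp (- \<mu> * t) + \<epsilon>" by (simp add: distrib_right)
  qed
qed

section \<open>Decay of the distance of two solutions\<close>

lemma has_real_derivative_Dt:
  "(\<lambda>s. u s x) differentiable (at t within T) \<Longrightarrow> ((\<lambda>s. u s x) has_real_derivative Dt T u t x) (at t within T)"
  unfolding Dt_def has_real_derivative_iff_has_vector_derivative by (simp add: vector_derivative_works)

lemma has_real_derivative_Dx:
  "v differentiable (at x within {0..1}) \<Longrightarrow> (v has_real_derivative Dx v x) (at x within {0..1})"
  unfolding Dx_def has_real_derivative_iff_has_vector_derivative by (simp add: vector_derivative_works)

lemma has_real_derivative_Dx_interior:
  assumes "v differentiable (at x)" "x \<in> {0<..<1}"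
  shows "(v has_real_derivative Dx v x) (at x)"
proof -
  have "at x within {0..1} = at x" using assms(2) by (simp add: at_within_Icc_at)
  with has_real_derivative_Dx[of v x] assms(1) show ?thesis by simp
qed

lemma classical_solution_derivatives:
  assumes u: "efk_classical_solution T \<gamma> \<tau> f g u" and t: "t \<in> T"
  shows "x \<in> {0..1} \<Longrightarrow> ((\<lambda>s. u s x) has_real_derivative Dt T u t x) (at t within T)"
    and "x \<in> {0..1} \<Longrightarrow> (u t has_real_derivative Dx (u t) x) (at x within {0..1})"
    and "x \<in> {0..1} \<Longrightarrow> (Dx (u t) has_real_derivative (Dx ^^ 2) (u t) x) (at x within {0..1})"
    and "x \<in> {0<..<1} \<Longrightarrow> ((Dx ^^ 2) (u t) has_real_derivative (Dx ^^ 3) (u t) x) (at x)"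
    and "x \<in> {0<..<1} \<Longrightarrow> ((Dx ^^ 3) (u t) has_real_derivative (Dx ^^ 4) (u t) x) (at x)"
  using u t has_real_derivative_Dx[of "Dx (u t)" x] has_real_derivative_Dx_interior[of "(Dx ^^ 2) (u t)" x]
    has_real_derivative_Dx_interior[of "(Dx ^^ 3) (u t)" x]
  unfolding efk_classical_solution_def C12_def
  by (auto intro!: has_real_derivative_Dt has_real_derivative_Dx simp: eval_nat_numeral)

lemma at_within_half_line_nontrivial: "t \<ge> 0 \<Longrightarrow> at t within {0::real..} \<noteq> bot"
proof
  assume "t \<ge> 0" "at t within {0..} = bot"
  have "{t<..} \<subseteq> {0..}" using \<open>t \<ge> 0\<close> by auto
  then have "at_right t \<le> bot"
    using at_le[of "{t<..}" "{0..}" t] \<open>at t within {0..} = bot\<close> by simp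
  then have "at_right t = bot" by (rule bot.extremum_uniqueI)
  with trivial_limit_at_right_real[of t] show False by blast
qed

lemma classical_solution_restrict:
  assumes u: "efk_classical_solution UNIV \<gamma> \<tau> f g u"
  shows "efk_classical_solution {0..} \<gamma> \<tau> f g u"
proof -
  have Dt: "Dt {0..} u t x = Dt UNIV u t x" "(\<lambda>s. u s x) differentiable (at t within {0..})" if "t \<ge> 0" "x \<in> {0..1}" for t x
  proof -
    have "((\<lambda>s. u s x) has_vector_derivative Dt UNIV u t x) (at t within {0..})"
      using classical_solution_derivatives(1)[OF u, of t x] that
      by (auto simp: has_real_derivative_iff_has_vector_derivative intro: has_vector_derivative_at_within)
    then show "Dt {0..} u t x = Dt UNIV u t x" "(\<lambda>s. u s x) differentiable (at t within {0..})"
      using vector_derivative_within[OF at_within_half_line_nontrivial[OF that(1)]]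
      unfolding Dt_def[of "{0..}"] by (auto intro: differentiableI_vector)
  qed
  have c: "continuous_on ({0..} \<times> {0..1}) h" if "continuous_on (UNIV \<times> {0..1}) h" for h :: "real \<times> real \<Rightarrow> real"
    by (rule continuous_on_subset[OF that]) auto
  have "continuous_on ({0..} \<times> {0..1}) (\<lambda>(t, x). Dt {0..} u t x)"
    by (rule continuous_on_eq[of _ "\<lambda>(t, x). Dt UNIV u t x"])
      (use u in \<open>auto simp: efk_classical_solution_def C12_def Dt intro!: c\<close>)
  then show ?thesis
    using u by (auto simp: efk_classical_solution_def C12_def Dt intro!: c)
qed

text \<open>
  The delayed terms are separated by \<open>2 |w w\<^sub>k| \<le> w\<^sup>2 + w\<^sub>k\<^sup>2\<close>.  In terms of squared norms this costs nothing: the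
  condition of the Halanay inequality remains \<open>\<Sum>\<beta>\<^sub>k < \<gamma> \<pi>\<^sup>4 + \<pi>\<^sup>2 - 1\<close>.
\<close>

lemma energy_inequality:
  fixes \<tau> \<beta> :: "'n::finite \<Rightarrow> real" and u v :: "real \<Rightarrow> real \<Rightarrow> real"
  assumes \<gamma>: "\<gamma> > 0" and \<tau>: "\<And>k. \<tau> k > 0" and \<beta>: "\<And>k. \<beta> k > 0"
    and lip: "\<And>\<xi> \<eta>. \<bar>f \<xi> - f \<eta>\<bar> \<le> (\<Sum>k\<in>UNIV. \<beta> k * \<bar>\<xi> $ k - \<eta> $ k\<bar>)"
    and u: "efk_classical_solution {0..} \<gamma> \<tau> f g u" and v: "efk_classical_solution {0..} \<gamma> \<tau> f g v"
    and sq: "\<And>s. s \<ge> - r \<Longrightarrow> (\<lambda>x. (u s x - v s x)\<^sup>2) integrable_on {0..1}" and r: "\<And>k. \<tau> k \<le> r"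
  defines "E t \<equiv> L2_dist_sq u v t"
  shows "\<exists>E'. \<forall>t\<ge>0. (E has_real_derivative E' t) (at t within {0..}) \<and>
     E' t \<le> - (2 * (\<gamma> * pi ^ 4 + pi\<^sup>2 - 1) - (\<Sum>k\<in>UNIV. \<beta> k)) * E t + (\<Sum>k\<in>UNIV. \<beta> k * E (t - \<tau> k))"
proof -
  define w where "w t x = u t x - v t x" for t x
  define wt where "wt t x = Dt {0..} u t x - Dt {0..} v t x" for t x
  define B where "B = (\<Sum>k\<in>UNIV. \<beta> k)"
  have E: "E t = integral {0..1} (\<lambda>x. (w t x)\<^sup>2)" for t by (simp add: E_def w_def)
  note ud = classical_solution_derivatives[OF u] and vd = classical_solution_derivatives[OF v]
  have cont: "continuous_on ({0..} \<times> {0..1}) (\<lambda>(t, x). w t x)" "continuous_on ({0..} \<times> {0..1}) (\<lambda>(t, x). wt t x)"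
    using u v unfolding efk_classical_solution_def C12_def w_def wt_def case_prod_unfold
    by (auto intro!: continuous_intros)
  have cu2: "continuous_on ({0..} \<times> {0..1}) (\<lambda>(t, x). (Dx ^^ 2) (u t) x)" and cv2: "continuous_on ({0..} \<times> {0..1}) (\<lambda>(t, x). (Dx ^^ 2) (v t) x)"
    using u v unfolding efk_classical_solution_def C12_def by auto
  have der: "(E has_real_derivative integral {0..1} (\<lambda>x. 2 * w t x * wt t x)) (at t within {0..})" if t: "t \<ge> 0" for t
  proof -
    have "((\<lambda>t. integral (cbox 0 1) (\<lambda>x. (w t x)\<^sup>2)) has_field_derivative integral (cbox 0 1) (\<lambda>x. 2 * w t x * wt t x)) (at t within {0..})"
    proof (rule leibniz_rule_field_derivative)
      fix s x :: real assume s: "s \<in> {0..}" and x: "x \<in> cbox 0 1"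
      then have "((\<lambda>s. w s x) has_real_derivative wt s x) (at s within {0..})"
        unfolding w_def wt_def by (intro DERIV_diff ud(1) vd(1)) auto
      from DERIV_power[OF this, of 2]
      show "((\<lambda>s. (w s x)\<^sup>2) has_real_derivative 2 * w s x * wt s x) (at s within {0..})" by (simp add: mult_ac)
    next
      fix s :: real assume "s \<in> {0..}"
      from continuous_on_slice[OF cont(1) this]
      show "(\<lambda>x. (w s x)\<^sup>2) integrable_on cbox 0 1" by (auto intro!: integrable_continuous_real continuous_intros)
    next
      have "continuous_on ({0..} \<times> {0..1}) (\<lambda>p. 2 * w (fst p) (snd p) * wt (fst p) (snd p))"
        using cont by (intro continuous_intros) (simp_all add: case_prod_unfold)
      then show "continuous_on ({0..} \<times> cbox 0 1) (\<lambda>(s, x). 2 * w s x * wt s x)" by (simp add: case_prod_unfold)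
    qed (use t in auto)
    then show ?thesis by (simp add: E[abs_def])
  qed
  have le: "integral {0..1} (\<lambda>x. 2 * w t x * wt t x) \<le> - (2 * (\<gamma> * pi ^ 4 + pi\<^sup>2 - 1) - B) * E t + (\<Sum>k\<in>UNIV. \<beta> k * E (t - \<tau> k))"
    if t: "t \<ge> 0" for t
  proof -
    have t': "t \<in> {0..}" using t by simp
    define h where "h x = f (\<chi> k. u (t - \<tau> k) x) - f (\<chi> k. v (t - \<tau> k) x)" for x
    define H where "H x = B * (w t x)\<^sup>2 + (\<Sum>k\<in>UNIV. \<beta> k * (w (t - \<tau> k) x)\<^sup>2)" for x
    have sqw: "((\<lambda>x. (w s x)\<^sup>2) has_integral E s) {0..1}" if "s \<ge> - r" for s
      using integrable_integral[OF sq[OF that]] unfolding E_def w_def .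
    have "(H has_integral B * E t + (\<Sum>k\<in>UNIV. \<beta> k * E (t - \<tau> k))) {0..1}"
      unfolding H_def[abs_def]
    proof (intro has_integral_add has_integral_mult_right has_integral_sum sqw)
      show "t \<ge> - r" using t r[of undefined] \<tau>[of undefined] by linarith
      show "t - \<tau> k \<ge> - r" for k using t r[of k] by linarith
    qed simp
    then have H: "H integrable_on {0..1}" "integral {0..1} H = B * E t + (\<Sum>k\<in>UNIV. \<beta> k * E (t - \<tau> k))"
      by (auto simp: integral_unique)
    have "integral {0..1} (\<lambda>x. 2 * w t x * wt t x) \<le> - 2 * (\<gamma> * pi ^ 4 + pi\<^sup>2 - 1) * integral {0..1} (\<lambda>x. (w t x)\<^sup>2) + integral {0..1} H"
    proof (rule energy_dissipation[OF \<gamma> _ _ _ _ _ _ _ _ _ _ _ H(1)])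
      fix x :: real assume x: "x \<in> {0..1}"
      show "(w t has_real_derivative Dx (u t) x - Dx (v t) x) (at x within {0..1})"
        unfolding w_def[abs_def] by (intro DERIV_diff ud(2)[OF t' x] vd(2)[OF t' x])
      show "((\<lambda>x. Dx (u t) x - Dx (v t) x) has_real_derivative (Dx ^^ 2) (u t) x - (Dx ^^ 2) (v t) x) (at x within {0..1})"
        by (intro DERIV_diff ud(3)[OF t' x] vd(3)[OF t' x])
    next
      show "continuous_on {0..1} (\<lambda>x. (Dx ^^ 2) (u t) x - (Dx ^^ 2) (v t) x)"
        by (intro continuous_on_diff continuous_on_slice[OF cu2 t'] continuous_on_slice[OF cv2 t'])
      show "continuous_on {0..1} (wt t)" by (rule continuous_on_slice[OF cont(2) t'])
    next
      fix x :: real assume x: "x \<in> {0<..<1}"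
      show "((\<lambda>x. (Dx ^^ 2) (u t) x - (Dx ^^ 2) (v t) x) has_real_derivative (Dx ^^ 3) (u t) x - (Dx ^^ 3) (v t) x) (at x)"
        by (intro DERIV_diff ud(4)[OF t' x] vd(4)[OF t' x])
      show "((\<lambda>x. (Dx ^^ 3) (u t) x - (Dx ^^ 3) (v t) x) has_real_derivative (Dx ^^ 4) (u t) x - (Dx ^^ 4) (v t) x) (at x)"
        by (intro DERIV_diff ud(5)[OF t' x] vd(5)[OF t' x])
      have "Dt {0..} u t x + \<gamma> * (Dx ^^ 4) (u t) x - (Dx ^^ 2) (u t) x - u t x = g t x + f (\<chi> k. u (t - \<tau> k) x)"
        "Dt {0..} v t x + \<gamma> * (Dx ^^ 4) (v t) x - (Dx ^^ 2) (v t) x - v t x = g t x + f (\<chi> k. v (t - \<tau> k) x)"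
        using u v t' x unfolding efk_classical_solution_def by blast+
      then show "wt t x + \<gamma> * ((Dx ^^ 4) (u t) x - (Dx ^^ 4) (v t) x) - ((Dx ^^ 2) (u t) x - (Dx ^^ 2) (v t) x) - w t x = h x"
        unfolding wt_def w_def h_def by (simp add: right_diff_distrib)
      have "2 * (w t x * h x) \<le> 2 * (\<bar>w t x\<bar> * \<bar>h x\<bar>)" by (simp flip: abs_mult)
      also have "\<dots> \<le> 2 * (\<bar>w t x\<bar> * (\<Sum>k\<in>UNIV. \<beta> k * \<bar>w (t - \<tau> k) x\<bar>))"
        using lip[of "\<chi> k. u (t - \<tau> k) x" "\<chi> k. v (t - \<tau> k) x"]
        unfolding h_def w_def by (intro mult_left_mono) auto
      also have "\<dots> = (\<Sum>k\<in>UNIV. \<beta> k * (2 * \<bar>w t x\<bar> * \<bar>w (t - \<tau> k) x\<bar>))"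
        by (simp add: sum_distrib_left mult_ac)
      also have "\<dots> \<le> (\<Sum>k\<in>UNIV. \<beta> k * ((w t x)\<^sup>2 + (w (t - \<tau> k) x)\<^sup>2))"
      proof (intro sum_mono mult_left_mono)
        fix k
        show "2 * \<bar>w t x\<bar> * \<bar>w (t - \<tau> k) x\<bar> \<le> (w t x)\<^sup>2 + (w (t - \<tau> k) x)\<^sup>2"
          using sum_squares_bound[of "\<bar>w t x\<bar>" "\<bar>w (t - \<tau> k) x\<bar>"] by simp
      qed (use \<beta> in \<open>auto intro: less_imp_le\<close>)
      also have "\<dots> = H x"
        by (simp add: H_def B_def distrib_left sum.distrib sum_distrib_right)
      finally show "2 * (w t x * h x) \<le> H x" .
    qed (use u v t' in \<open>auto simp: efk_classical_solution_def w_def\<close>)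
    then show ?thesis unfolding H(2) E[symmetric] by (simp add: algebra_simps)
  qed
  show ?thesis
  proof (intro exI allI impI conjI)
    fix t :: real assume t: "0 \<le> t"
    show "(E has_real_derivative integral {0..1} (\<lambda>x. 2 * w t x * wt t x)) (at t within {0..})" by (rule der[OF t])
    show "integral {0..1} (\<lambda>x. 2 * w t x * wt t x) \<le> - (2 * (\<gamma> * pi ^ 4 + pi\<^sup>2 - 1) - (\<Sum>k\<in>UNIV. \<beta> k)) * E t + (\<Sum>k\<in>UNIV. \<beta> k * E (t - \<tau> k))"
      by (rule le[OF t, unfolded B_def])
  qed
qed

text \<open>
  The decay rate is the same for all pairs of solutions and all bounds of their initial distance.
\<close>

lemma energy_decay:
  fixes \<tau> \<beta> :: "'n::finite \<Rightarrow> real"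
  assumes \<gamma>: "\<gamma> > 0" and \<tau>: "\<And>k. \<tau> k > 0" and \<beta>: "\<And>k. \<beta> k > 0"
    and lip: "\<And>\<xi> \<eta>. \<bar>f \<xi> - f \<eta>\<bar> \<le> (\<Sum>k\<in>UNIV. \<beta> k * \<bar>\<xi> $ k - \<eta> $ k\<bar>)"
    and small: "(\<Sum>k\<in>UNIV. \<beta> k) < \<gamma> * pi ^ 4 + pi\<^sup>2 - 1"
  shows "\<exists>\<mu>>0. \<forall>u v M. efk_classical_solution {0..} \<gamma> \<tau> f g u \<longrightarrow> efk_classical_solution {0..} \<gamma> \<tau> f g v \<longrightarrow>
    (\<forall>s\<ge>- max_delay \<tau>. (\<lambda>x. (u s x - v s x)\<^sup>2) integrable_on {0..1}) \<longrightarrow>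
    (\<forall>s\<in>{- max_delay \<tau>..0}. L2_dist_sq u v s \<le> M) \<longrightarrow> 0 \<le> M \<longrightarrow>
    (\<forall>t\<ge>0. L2_dist_sq u v t \<le> M * exp (- \<mu> * t))"
proof -
  define B where "B = (\<Sum>k\<in>UNIV. \<beta> k)"
  define a where "a = 2 * (\<gamma> * pi ^ 4 + pi\<^sup>2 - 1) - B"
  \<comment> \<open>The condition on the rate is strict at \<open>\<mu> = 0\<close>, so it holds for some positive rate.\<close>
  have "((\<lambda>\<mu>. (\<Sum>k\<in>UNIV. \<beta> k * exp (\<mu> * \<tau> k)) + \<mu>) \<longlongrightarrow> (\<Sum>k\<in>UNIV. \<beta> k * exp (0 * \<tau> k)) + 0) (at_right 0)"
    by (intro tendsto_intros)
  moreover have "(\<Sum>k\<in>UNIV. \<beta> k * exp (0 * \<tau> k)) + 0 < a" using small by (simp add: a_def B_def)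
  ultimately have "\<forall>\<^sub>F \<mu> in at_right 0. (\<Sum>k\<in>UNIV. \<beta> k * exp (\<mu> * \<tau> k)) + \<mu> < a"
    by (rule order_tendstoD(2))
  then have "\<forall>\<^sub>F \<mu> in at_right 0. \<mu> > 0 \<and> (\<Sum>k\<in>UNIV. \<beta> k * exp (\<mu> * \<tau> k)) + \<mu> < a"
    using eventually_at_right_less[of 0] by eventually_elim simp
  then obtain \<mu> where \<mu>: "\<mu> > 0" "(\<Sum>k\<in>UNIV. \<beta> k * exp (\<mu> * \<tau> k)) + \<mu> < a"
    using eventually_happens'[OF trivial_limit_at_right_real] by blast
  have r: "\<tau> k \<le> max_delay \<tau>" for k unfolding max_delay_def by (intro Max_ge) auto
  show ?thesis
  proof (intro exI[of _ \<mu>] conjI allI impI)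
    fix u v :: "real \<Rightarrow> real \<Rightarrow> real" and M t :: real
    assume u: "efk_classical_solution {0..} \<gamma> \<tau> f g u" and v: "efk_classical_solution {0..} \<gamma> \<tau> f g v"
      and sq: "\<forall>s\<ge>- max_delay \<tau>. (\<lambda>x. (u s x - v s x)\<^sup>2) integrable_on {0..1}"
      and init: "\<forall>s\<in>{- max_delay \<tau>..0}. L2_dist_sq u v s \<le> M"
      and M: "0 \<le> M" and t: "0 \<le> t"
    obtain E' where E': "\<forall>t\<ge>0. ((\<lambda>t. L2_dist_sq u v t) has_real_derivative E' t) (at t within {0..}) \<and>
       E' t \<le> - a * L2_dist_sq u v t + (\<Sum>k\<in>UNIV. \<beta> k * L2_dist_sq u v (t - \<tau> k))"
      using energy_inequality[OF \<gamma> \<tau> \<beta> lip u v _ r] sq unfolding a_def B_def by blast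
    show "L2_dist_sq u v t \<le> M * exp (- \<mu> * t)"
      by (rule halanay_inequality[where E="\<lambda>t. L2_dist_sq u v t" and E'=E' and a=a and \<tau>=\<tau> and \<beta>=\<beta>, OF \<tau> r _ \<mu>])
        (use E' init M t \<beta> in \<open>auto intro: less_imp_le\<close>)
  qed (rule \<mu>)
qed

lemma square_integrable_integral:
  assumes "square_integrable d"
  shows "(\<lambda>x. (d x)\<^sup>2) integrable_on {0..1}" and "(L2_norm d)\<^sup>2 = integral {0..1} (\<lambda>x. (d x)\<^sup>2)"
proof -
  have i: "integrable (lebesgue_on {0..1}) (\<lambda>x. (d x)\<^sup>2)" using assms by (simp add: square_integrable_def)
  show "(\<lambda>x. (d x)\<^sup>2) integrable_on {0..1}" by (rule integrable_on_lebesgue_on[OF i]) simp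
  have "0 \<le> (\<integral>x. (d x)\<^sup>2 \<partial>lebesgue_on {0..1})" by (intro Bochner_Integration.integral_nonneg) simp
  then show "(L2_norm d)\<^sup>2 = integral {0..1} (\<lambda>x. (d x)\<^sup>2)"
    unfolding L2_norm_def using lebesgue_integral_eq_integral[OF i] by simp
qed

lemma L2_norm_nonneg: "0 \<le> L2_norm d"
  unfolding L2_norm_def by (intro real_sqrt_ge_zero Bochner_Integration.integral_nonneg) simp

lemma square_integrable_continuous:
  assumes "continuous_on {0..1} d" shows "square_integrable d"
  unfolding square_integrable_def
  using borel_measurable_integrable[OF continuous_imp_integrable_real[OF assms]]
  by (auto intro!: continuous_imp_integrable_real continuous_intros assms)

lemma square_integrable_diff:
  assumes c: "square_integrable c" and d: "square_integrable d"
  shows "square_integrable (\<lambda>x. c x - d x)"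
  unfolding square_integrable_def
proof
  show m: "(\<lambda>x. c x - d x) \<in> borel_measurable (lebesgue_on {0..1})"
    using c d by (auto simp: square_integrable_def)
  show "integrable (lebesgue_on {0..1}) (\<lambda>x. (c x - d x)\<^sup>2)"
  proof (rule Bochner_Integration.integrable_bound)
    show "integrable (lebesgue_on {0..1}) (\<lambda>x. 2 * (c x)\<^sup>2 + 2 * (d x)\<^sup>2)"
      using c d by (auto simp: square_integrable_def)
    show "AE x in lebesgue_on {0..1}. norm ((c x - d x)\<^sup>2) \<le> norm (2 * (c x)\<^sup>2 + 2 * (d x)\<^sup>2)"
    proof (rule AE_I2)
      fix x
      have "0 \<le> (c x + d x)\<^sup>2" by simp
      then have "(c x - d x)\<^sup>2 \<le> 2 * (c x)\<^sup>2 + 2 * (d x)\<^sup>2"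
        by (simp add: power2_eq_square algebra_simps)
      then show "norm ((c x - d x)\<^sup>2) \<le> norm (2 * (c x)\<^sup>2 + 2 * (d x)\<^sup>2)"
        by (auto intro: order_trans[OF _ abs_ge_self])
    qed
  qed (use m in measurable)
qed

lemma L2_norm_square_le:
  assumes c: "square_integrable c" and d: "square_integrable d"
  shows "(L2_norm c)\<^sup>2 \<le> 2 * (L2_norm (\<lambda>x. c x - d x))\<^sup>2 + 2 * (L2_norm d)\<^sup>2"
    and "(L2_norm (\<lambda>x. c x - d x))\<^sup>2 \<le> 2 * (L2_norm c)\<^sup>2 + 2 * (L2_norm d)\<^sup>2"
proof -
  note cd = square_integrable_diff[OF c d]
  note si = square_integrable_integral
  have "integral {0..1} (\<lambda>x. (c x)\<^sup>2) \<le> 2 * integral {0..1} (\<lambda>x. (c x - d x)\<^sup>2) + 2 * integral {0..1} (\<lambda>x. (d x)\<^sup>2)"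
  proof (rule has_integral_le[OF integrable_integral[OF si(1)[OF c]]])
    show "((\<lambda>x. 2 * (c x - d x)\<^sup>2 + 2 * (d x)\<^sup>2) has_integral
       2 * integral {0..1} (\<lambda>x. (c x - d x)\<^sup>2) + 2 * integral {0..1} (\<lambda>x. (d x)\<^sup>2)) {0..1}"
      by (intro has_integral_add has_integral_mult_right integrable_integral si(1)[OF cd] si(1)[OF d])
    show "(c x)\<^sup>2 \<le> 2 * (c x - d x)\<^sup>2 + 2 * (d x)\<^sup>2" for x
      using zero_le_power2[of "c x - 2 * d x"] by (simp add: power2_eq_square algebra_simps)
  qed
  then show "(L2_norm c)\<^sup>2 \<le> 2 * (L2_norm (\<lambda>x. c x - d x))\<^sup>2 + 2 * (L2_norm d)\<^sup>2"
    by (simp add: si(2)[OF c] si(2)[OF d] si(2)[OF cd])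
  have "integral {0..1} (\<lambda>x. (c x - d x)\<^sup>2) \<le> 2 * integral {0..1} (\<lambda>x. (c x)\<^sup>2) + 2 * integral {0..1} (\<lambda>x. (d x)\<^sup>2)"
  proof (rule has_integral_le[OF integrable_integral[OF si(1)[OF cd]]])
    show "((\<lambda>x. 2 * (c x)\<^sup>2 + 2 * (d x)\<^sup>2) has_integral
       2 * integral {0..1} (\<lambda>x. (c x)\<^sup>2) + 2 * integral {0..1} (\<lambda>x. (d x)\<^sup>2)) {0..1}"
      by (intro has_integral_add has_integral_mult_right integrable_integral si(1)[OF c] si(1)[OF d])
    show "(c x - d x)\<^sup>2 \<le> 2 * (c x)\<^sup>2 + 2 * (d x)\<^sup>2" for x
      using zero_le_power2[of "c x + d x"] by (simp add: power2_eq_square algebra_simps)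
  qed
  then show "(L2_norm (\<lambda>x. c x - d x))\<^sup>2 \<le> 2 * (L2_norm c)\<^sup>2 + 2 * (L2_norm d)\<^sup>2"
    by (simp add: si(2)[OF c] si(2)[OF d] si(2)[OF cd])
qed

text \<open>
  Continuity bounds the norm near each time, and finitely many such neighbourhoods cover the interval.
\<close>

lemma continuous_into_L2_bounded:
  assumes "continuous_into_L2 {a..b} \<kappa>"
  shows "\<exists>M. \<forall>t\<in>{a..b}. (L2_norm (\<kappa> t))\<^sup>2 \<le> M"
proof -
  have sq: "square_integrable (\<kappa> t)" if "t \<in> {a..b}" for t
    using assms that by (simp add: continuous_into_L2_def)
  have "\<exists>d>0. \<forall>s\<in>{a..b}. dist t s < d \<longrightarrow> (L2_norm (\<kappa> s))\<^sup>2 \<le> 2 + 2 * (L2_norm (\<kappa> t))\<^sup>2" if t: "t \<in> {a..b}" for t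
  proof -
    have "((\<lambda>s. L2_norm (\<lambda>x. \<kappa> s x - \<kappa> t x)) \<longlongrightarrow> 0) (at t within {a..b})"
      using assms t by (simp add: continuous_into_L2_def)
    then have "\<forall>\<^sub>F s in at t within {a..b}. dist (L2_norm (\<lambda>x. \<kappa> s x - \<kappa> t x)) 0 < 1"
      by (rule tendstoD) simp
    then obtain d where d: "d > 0" "\<And>s. s \<in> {a..b} \<Longrightarrow> s \<noteq> t \<Longrightarrow> dist s t < d \<Longrightarrow> L2_norm (\<lambda>x. \<kappa> s x - \<kappa> t x) < 1"
      unfolding eventually_at by (auto simp: dist_real_def L2_norm_nonneg)
    have "(L2_norm (\<kappa> s))\<^sup>2 \<le> 2 + 2 * (L2_norm (\<kappa> t))\<^sup>2" if s: "s \<in> {a..b}" "dist t s < d" for s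
    proof (cases "s = t")
      case True
      then show ?thesis by simp
    next
      case False
      then have "L2_norm (\<lambda>x. \<kappa> s x - \<kappa> t x) < 1" using d(2) s by (simp add: dist_commute)
      then have "(L2_norm (\<lambda>x. \<kappa> s x - \<kappa> t x))\<^sup>2 \<le> 1\<^sup>2" by (intro power_mono L2_norm_nonneg) simp
      then show ?thesis using L2_norm_square_le(1)[OF sq[OF s(1)] sq[OF t]] by simp
    qed
    then show ?thesis using d(1) by blast
  qed
  then obtain d where d: "\<And>t. t \<in> {a..b} \<Longrightarrow> d t > 0"
    "\<And>t s. t \<in> {a..b} \<Longrightarrow> s \<in> {a..b} \<Longrightarrow> dist t s < d t \<Longrightarrow> (L2_norm (\<kappa> s))\<^sup>2 \<le> 2 + 2 * (L2_norm (\<kappa> t))\<^sup>2"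
    by metis
  have "{a..b} \<subseteq> (\<Union>t\<in>{a..b}. ball t (d t))" using d(1) by force
  then obtain C where C: "C \<subseteq> {a..b}" "finite C" "{a..b} \<subseteq> (\<Union>t\<in>C. ball t (d t))"
    using compactE_image[OF compact_Icc, of "{a..b}" "\<lambda>t. ball t (d t)" a b] by (metis open_ball)
  have "(L2_norm (\<kappa> s))\<^sup>2 \<le> 2 + 2 * (\<Sum>t\<in>C. (L2_norm (\<kappa> t))\<^sup>2)" if s: "s \<in> {a..b}" for s
  proof -
    obtain t where t: "t \<in> C" "dist t s < d t" using C(3) s by auto
    then have "(L2_norm (\<kappa> s))\<^sup>2 \<le> 2 + 2 * (L2_norm (\<kappa> t))\<^sup>2" using C s by (intro d(2)) auto
    also have "(L2_norm (\<kappa> t))\<^sup>2 \<le> (\<Sum>t\<in>C. (L2_norm (\<kappa> t))\<^sup>2)" by (rule member_le_sum[OF t(1)]) (use C in auto)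
    finally show ?thesis by simp
  qed
  then show ?thesis by blast
qed

lemma L2_norm_cong_interior:
  assumes "square_integrable c" "square_integrable d" "\<And>x. x \<in> {0<..<1} \<Longrightarrow> c x = d x"
  shows "L2_norm c = L2_norm d"
proof -
  have "integral {0..1} (\<lambda>x. (c x)\<^sup>2) = integral {0..1} (\<lambda>x. (d x)\<^sup>2)"
    by (rule integral_spike[of "{0, 1}"]) (use assms(3) in auto)
  then have "(L2_norm c)\<^sup>2 = (L2_norm d)\<^sup>2"
    by (simp add: square_integrable_integral(2) assms)
  then show ?thesis using L2_norm_nonneg by (simp add: power2_eq_iff_nonneg)
qed

section \<open>Stability, uniqueness and existence\<close>

context
  fixes \<gamma> :: real and \<tau> \<beta> :: "'n::finite \<Rightarrow> real" and f :: "real ^ 'n \<Rightarrow> real" and g :: "real \<Rightarrow> real \<Rightarrow> real"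
  assumes \<gamma>: "\<gamma> > 0" and \<tau>: "\<And>k. \<tau> k > 0" and \<beta>: "\<And>k. \<beta> k > 0"
    and lip: "\<And>\<xi> \<eta>. \<bar>f \<xi> - f \<eta>\<bar> \<le> (\<Sum>k\<in>UNIV. \<beta> k * \<bar>\<xi> $ k - \<eta> $ k\<bar>)"
    and small: "(\<Sum>k\<in>UNIV. \<beta> k) < \<gamma> * pi ^ 4 + pi\<^sup>2 - 1"
begin

text \<open>
  Exponential decay of the squared distance gives both clauses at once, with \<open>\<delta> = \<epsilon>\<close> in the first.  The history
  and the solution agree on the open interval only, which does not affect the \<open>L\<^sup>2\<close> norm.
\<close>

lemma classical_solution_stable:
  assumes ubar: "efk_classical_solution UNIV \<gamma> \<tau> f g ubar"
  shows "globally_asymptotically_stable \<gamma> \<tau> f g ubar"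
proof -
  let ?r = "max_delay \<tau>"
  obtain \<mu> where \<mu>: "\<mu> > 0" and decay: "\<And>u v M. efk_classical_solution {0..} \<gamma> \<tau> f g u \<Longrightarrow> efk_classical_solution {0..} \<gamma> \<tau> f g v \<Longrightarrow>
    (\<forall>s\<ge>- ?r. (\<lambda>x. (u s x - v s x)\<^sup>2) integrable_on {0..1}) \<Longrightarrow>
    (\<forall>s\<in>{- ?r..0}. L2_dist_sq u v s \<le> M) \<Longrightarrow> 0 \<le> M \<Longrightarrow>
    (\<forall>t\<ge>0. L2_dist_sq u v t \<le> M * exp (- \<mu> * t))"
    using energy_decay[where \<tau>=\<tau> and f=f and g=g, OF \<gamma> \<tau> \<beta> lip small] by blast
  have r: "?r > 0"
  proof -
    have "\<tau> undefined \<le> ?r" unfolding max_delay_def by (intro Max_ge) auto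
    then show ?thesis using \<tau>[of undefined] by linarith
  qed
  have cont: "continuous_on (UNIV \<times> {0..1}) (\<lambda>(t, x). ubar t x)"
    using ubar by (simp add: efk_classical_solution_def C12_def)
  have cbar: "continuous_on {0..1} (ubar t)" for t by (rule continuous_on_slice[OF cont]) simp
  note sqbar = square_integrable_continuous[OF cbar]
  have bounded: "\<exists>M. \<forall>t\<in>{- ?r..0}. (L2_norm (\<lambda>x. ubar t x - \<kappa> t x))\<^sup>2 \<le> M" if h: "initial_history ?r \<kappa>" for \<kappa>
  proof -
    have L2: "continuous_into_L2 {- ?r..0} \<kappa>" using h by (simp add: initial_history_def)
    have sq: "square_integrable (\<kappa> t)" if "t \<in> {- ?r..0}" for t using L2 that by (simp add: continuous_into_L2_def)
    obtain M1 where M1: "\<forall>t\<in>{- ?r..0}. (L2_norm (\<kappa> t))\<^sup>2 \<le> M1" using continuous_into_L2_bounded[OF L2] by blast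
    have "continuous_on ({- ?r..0} \<times> {0..1}) (\<lambda>(t, x). ubar t x)"
      by (rule continuous_on_subset[OF cont]) auto
    then have "compact ((\<lambda>(t, x). ubar t x) ` ({- ?r..0} \<times> {0..1}))"
      by (intro compact_continuous_image compact_Times compact_Icc)
    from compact_imp_bounded[OF this] obtain C where C: "\<forall>y\<in>(\<lambda>(t, x). ubar t x) ` ({- ?r..0} \<times> {0..1}). norm y \<le> C"
      unfolding bounded_iff by blast
    have "(L2_norm (\<lambda>x. ubar t x - \<kappa> t x))\<^sup>2 \<le> 2 * C\<^sup>2 + 2 * M1" if t: "t \<in> {- ?r..0}" for t
    proof -
      have "(ubar t x)\<^sup>2 \<le> C\<^sup>2" if "x \<in> {0..1}" for x
      proof -
        have "\<bar>ubar t x\<bar> \<le> C" using bspec[OF C imageI[of "(t, x)"]] t that by simp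
        then have "\<bar>ubar t x\<bar>\<^sup>2 \<le> C\<^sup>2" by (intro power_mono) auto
        then show ?thesis by simp
      qed
      then have "integral {0..1} (\<lambda>x. (ubar t x)\<^sup>2) \<le> integral {0..1} (\<lambda>x::real. C\<^sup>2)"
        by (intro integral_le integrable_continuous_real continuous_intros cbar) auto
      then have "(L2_norm (ubar t))\<^sup>2 \<le> C\<^sup>2" by (simp add: square_integrable_integral(2)[OF sqbar])
      then show ?thesis using L2_norm_square_le(2)[OF sqbar sq[OF t], of t] M1 t by fastforce
    qed
    then show ?thesis by blast
  qed
  have est: "L2_norm (\<lambda>x. ubar t x - u t x) \<le> sqrt (N * exp (- \<mu> * t))"
    if h: "initial_history ?r \<kappa>" and u: "efk_ivp_solution \<gamma> \<tau> f g \<kappa> u"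
      and N: "\<forall>s\<in>{- ?r..0}. (L2_norm (\<lambda>x. ubar s x - \<kappa> s x))\<^sup>2 \<le> N" and t: "t \<ge> 0" for \<kappa> u N t
  proof -
    have sqk: "square_integrable (\<kappa> s)" if "s \<in> {- ?r..0}" for s
      using h that by (simp add: initial_history_def continuous_into_L2_def)
    have squ: "square_integrable (u s)" if "s \<ge> - ?r" for s
      using u that by (simp add: efk_ivp_solution_def continuous_into_L2_def)
    note sqd = square_integrable_diff[OF sqbar squ]
    have init: "\<forall>s\<in>{- ?r..0}. L2_dist_sq ubar u s \<le> N"
    proof
      fix s assume s: "s \<in> {- ?r..0}"
      have "L2_norm (\<lambda>x. ubar s x - u s x) = L2_norm (\<lambda>x. ubar s x - \<kappa> s x)"
        using u s by (intro L2_norm_cong_interior square_integrable_diff sqbar squ sqk) (auto simp: efk_ivp_solution_def)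
      then show "L2_dist_sq ubar u s \<le> N"
        using bspec[OF N s] square_integrable_integral(2)[OF sqd, of s s] s by simp
    qed
    have "0 \<le> (L2_norm (\<lambda>x. ubar 0 x - \<kappa> 0 x))\<^sup>2" by simp
    also have "\<dots> \<le> N" using N r by simp
    finally have N0: "0 \<le> N" .
    have "\<forall>t\<ge>0. L2_dist_sq ubar u t \<le> N * exp (- \<mu> * t)"
      by (rule decay[OF classical_solution_restrict[OF ubar] _ _ init N0])
        (use u square_integrable_integral(1)[OF sqd] in \<open>auto simp: efk_ivp_solution_def\<close>)
    then have "(L2_norm (\<lambda>x. ubar t x - u t x))\<^sup>2 \<le> N * exp (- \<mu> * t)"
      using square_integrable_integral(2)[OF sqd, of t t] t r by simp
    then show ?thesis by (rule real_le_rsqrt)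
  qed
  show ?thesis
    unfolding globally_asymptotically_stable_def
  proof (intro conjI allI impI)
    fix \<epsilon> :: real assume \<epsilon>: "\<epsilon> > 0"
    show "\<exists>\<delta>>0. \<forall>\<kappa> u. initial_history ?r \<kappa> \<longrightarrow> efk_ivp_solution \<gamma> \<tau> f g \<kappa> u \<longrightarrow>
        (SUP t\<in>{- ?r..0}. L2_norm (\<lambda>x. ubar t x - \<kappa> t x)) < \<delta> \<longrightarrow>
        (\<forall>t\<ge>0. L2_norm (\<lambda>x. ubar t x - u t x) < \<epsilon>)"
    proof (intro exI[of _ \<epsilon>] conjI \<epsilon> allI impI)
      fix \<kappa> u t
      assume h: "initial_history ?r \<kappa>" and u: "efk_ivp_solution \<gamma> \<tau> f g \<kappa> u"
        and lt: "(SUP t\<in>{- ?r..0}. L2_norm (\<lambda>x. ubar t x - \<kappa> t x)) < \<epsilon>" and t: "0 \<le> (t::real)"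
      define S where "S = (SUP t\<in>{- ?r..0}. L2_norm (\<lambda>x. ubar t x - \<kappa> t x))"
      obtain M where M: "\<forall>t\<in>{- ?r..0}. (L2_norm (\<lambda>x. ubar t x - \<kappa> t x))\<^sup>2 \<le> M" using bounded[OF h] by blast
      have "bdd_above ((\<lambda>t. L2_norm (\<lambda>x. ubar t x - \<kappa> t x)) ` {- ?r..0})"
        by (rule bdd_aboveI[of _ "sqrt M"]) (use M in \<open>auto intro!: real_le_rsqrt\<close>)
      then have le: "L2_norm (\<lambda>x. ubar s x - \<kappa> s x) \<le> S" if "s \<in> {- ?r..0}" for s
        unfolding S_def using that by (intro cSUP_upper)
      have S0: "0 \<le> S" using le[of 0] L2_norm_nonneg[of "\<lambda>x. ubar 0 x - \<kappa> 0 x"] r by simp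
      have "L2_norm (\<lambda>x. ubar t x - u t x) \<le> sqrt (S\<^sup>2 * exp (- \<mu> * t))"
        using le L2_norm_nonneg by (intro est[OF h u _ t]) (auto intro!: power_mono)
      also have "\<dots> \<le> sqrt (S\<^sup>2 * 1)"
        using \<mu> t by (intro real_sqrt_le_mono mult_left_mono) auto
      also have "\<dots> = S" using S0 by simp
      also have "\<dots> < \<epsilon>" using lt by (simp add: S_def)
      finally show "L2_norm (\<lambda>x. ubar t x - u t x) < \<epsilon>" .
    qed
  next
    fix \<kappa> u
    assume h: "initial_history ?r \<kappa>" and u: "efk_ivp_solution \<gamma> \<tau> f g \<kappa> u"
    obtain M where M: "\<forall>t\<in>{- ?r..0}. (L2_norm (\<lambda>x. ubar t x - \<kappa> t x))\<^sup>2 \<le> M" using bounded[OF h] by blast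
    show "((\<lambda>t. L2_norm (\<lambda>x. ubar t x - u t x)) \<longlongrightarrow> 0) at_top"
    proof (rule Lim_null_comparison)
      show "\<forall>\<^sub>F t in at_top. norm (L2_norm (\<lambda>x. ubar t x - u t x)) \<le> sqrt (M * exp (- \<mu> * t))"
        using eventually_ge_at_top[of 0]
        by eventually_elim (use est[OF h u M] L2_norm_nonneg in \<open>auto simp: abs_of_nonneg\<close>)
      have "((\<lambda>t. exp (- \<mu> * t)) \<longlongrightarrow> 0) at_top" using \<mu> by real_asymp
      then have "((\<lambda>t. sqrt (M * exp (- \<mu> * t))) \<longlongrightarrow> sqrt (M * 0)) at_top" by (intro tendsto_intros)
      then show "((\<lambda>t. sqrt (M * exp (- \<mu> * t))) \<longlongrightarrow> 0) at_top" by simp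
    qed
  qed
qed

text \<open>
  The squared distance of two periodic solutions is periodic and decays exponentially.
\<close>

lemma periodic_solution_unique:
  assumes \<omega>: "\<omega> > 0"
    and u: "efk_classical_solution UNIV \<gamma> \<tau> f g u" "time_periodic \<omega> u"
    and v: "efk_classical_solution UNIV \<gamma> \<tau> f g v" "time_periodic \<omega> v"
    and x: "x \<in> {0..1}"
  shows "v t x = u t x"
proof -
  obtain \<mu> where \<mu>: "\<mu> > 0" and decay: "\<And>u v M. efk_classical_solution {0..} \<gamma> \<tau> f g u \<Longrightarrow> efk_classical_solution {0..} \<gamma> \<tau> f g v \<Longrightarrow>
    (\<forall>s\<ge>- max_delay \<tau>. (\<lambda>x. (u s x - v s x)\<^sup>2) integrable_on {0..1}) \<Longrightarrow>
    (\<forall>s\<in>{- max_delay \<tau>..0}. L2_dist_sq u v s \<le> M) \<Longrightarrow> 0 \<le> M \<Longrightarrow>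
    (\<forall>t\<ge>0. L2_dist_sq u v t \<le> M * exp (- \<mu> * t))"
    using energy_decay[where \<tau>=\<tau> and f=f and g=g, OF \<gamma> \<tau> \<beta> lip small] by blast
  define E where "E t = L2_dist_sq u v t" for t
  have cuv: "continuous_on (UNIV \<times> {0..1}) (\<lambda>(t, x). u t x)" "continuous_on (UNIV \<times> {0..1}) (\<lambda>(t, x). v t x)"
    using u v by (simp_all add: efk_classical_solution_def C12_def)
  have d: "admissible \<omega> (\<lambda>t x. u t x - v t x)"
    using cuv u(2) v(2) unfolding admissible_def time_periodic_def case_prod_unfold
    by (auto intro!: continuous_intros)
  obtain M where M: "M > 0" "\<And>t x. x \<in> {0..1} \<Longrightarrow> \<bar>u t x - v t x\<bar> \<le> M" using admissible_bounded[OF \<omega> d] by blast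
  note cd = admissible_continuous_x[OF d]
  have int: "(\<lambda>x. (u s x - v s x)\<^sup>2) integrable_on {0..1}" for s
    by (intro integrable_continuous_real continuous_on_power cd)
  have EM: "E s \<le> M\<^sup>2" for s
  proof -
    have "E s \<le> integral {0..1} (\<lambda>x::real. M\<^sup>2)"
      unfolding E_def
    proof (rule integral_le[OF int])
      fix x :: real assume "x \<in> {0..1}"
      then have "\<bar>u s x - v s x\<bar>\<^sup>2 \<le> M\<^sup>2" using M by (intro power_mono) auto
      then show "(u s x - v s x)\<^sup>2 \<le> M\<^sup>2" by simp
    qed auto
    then show ?thesis by simp
  qed
  have bound: "E s \<le> M\<^sup>2 * exp (- \<mu> * s)" if "s \<ge> 0" for s
    using decay[OF classical_solution_restrict[OF u(1)] classical_solution_restrict[OF v(1)], of "M\<^sup>2"] int EM that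
    by (simp add: E_def)
  have "E (s + \<omega>) = E s" for s
    unfolding E_def using u(2) v(2)
    by (intro Henstock_Kurzweil_Integration.integral_cong) (simp add: time_periodic_def)
  then have per: "E (t + real n * \<omega>) = E t" for n
    using periodic_int_multiple[of E \<omega> t "int n"] by simp
  have "E t \<le> 0"
  proof (rule LIMSEQ_le_const)
    show "(\<lambda>n. M\<^sup>2 * exp (- \<mu> * (t + real n * \<omega>))) \<longlonglongrightarrow> 0"
      using \<mu> \<omega> by real_asymp
    obtain N :: nat where N: "real N > - t / \<omega>" using reals_Archimedean2 by blast
    show "\<exists>N. \<forall>n\<ge>N. E t \<le> M\<^sup>2 * exp (- \<mu> * (t + real n * \<omega>))"
    proof (intro exI allI impI)
      fix n assume "N \<le> n"
      then have "- t / \<omega> \<le> real n" using N by linarith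
      then have "- t / \<omega> * \<omega> \<le> real n * \<omega>" using \<omega> by (intro mult_right_mono) auto
      then have "t + real n * \<omega> \<ge> 0" using \<omega> by simp
      from bound[OF this] show "E t \<le> M\<^sup>2 * exp (- \<mu> * (t + real n * \<omega>))" by (simp only: per)
    qed
  qed
  moreover have "E t \<ge> 0" unfolding E_def by (intro Henstock_Kurzweil_Integration.integral_nonneg int) simp
  ultimately have "L2_dist_sq u v t = 0" by (simp add: E_def)
  moreover have "continuous_on {0..1} (\<lambda>x. (u t x - v t x)\<^sup>2)" by (intro continuous_on_power cd)
  ultimately have "(u t x - v t x)\<^sup>2 = 0"
    using integral_eq_0_iff[of 0 1 "\<lambda>x. (u t x - v t x)\<^sup>2"] x by auto
  then show ?thesis by simp
qed

lemma continuous_reaction: "continuous_on UNIV f"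
  unfolding continuous_on_iff
proof (intro ballI allI impI)
  fix \<xi> :: "real ^ 'n" and e :: real assume e: "e > 0"
  define B where "B = (\<Sum>k\<in>UNIV. \<beta> k)"
  have B: "B \<ge> 0" unfolding B_def using \<beta> by (intro sum_nonneg) (auto intro: less_imp_le)
  have "dist (f \<eta>) (f \<xi>) < e" if "dist \<eta> \<xi> < e / (B + 1)" for \<eta>
  proof -
    have "\<bar>f \<eta> - f \<xi>\<bar> \<le> (\<Sum>k\<in>UNIV. \<beta> k * \<bar>\<eta> $ k - \<xi> $ k\<bar>)" by (rule lip)
    also have "\<dots> \<le> (\<Sum>k\<in>UNIV. \<beta> k * dist \<eta> \<xi>)"
      using component_le_norm_cart[of "\<eta> - \<xi>"] \<beta>
      by (intro sum_mono mult_left_mono) (auto simp: dist_norm intro: less_imp_le)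
    also have "\<dots> = B * dist \<eta> \<xi>" by (simp add: B_def sum_distrib_right)
    also have "\<dots> \<le> B * (e / (B + 1))" using that B by (intro mult_left_mono) auto
    also have "\<dots> < e" using e B by (simp add: pos_divide_less_eq)
    finally show ?thesis by (simp add: dist_real_def)
  qed
  then show "\<exists>d>0. \<forall>\<eta>\<in>UNIV. dist \<eta> \<xi> < d \<longrightarrow> dist (f \<eta>) (f \<xi>) < e"
    using e B by (intro exI[of _ "e / (B + 1)"]) auto
qed

text \<open>
  The fixed point \<open>u\<close> solves \<open>u\<^sub>t + A u = F\<close> in the sense of sine series, with \<open>F = g + f (u (t - \<tau>\<^sub>1), \<dots>)\<close>.  A solution with bounded
  forcing is Hoelder continuous in time with exponent \<open>1/2\<close>, so \<open>F\<close> inherits the smaller of this exponent and that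
  of \<open>g\<close>, and the regularity theory applies to \<open>u\<close>.
\<close>

lemma periodic_solution_exists:
  assumes \<omega>: "\<omega> > 0" and hg: "hoelder_continuous_on (UNIV \<times> {0..1}) (\<lambda>(t, x). g t x)" and pg: "time_periodic \<omega> g"
  shows "\<exists>u. efk_classical_solution UNIV \<gamma> \<tau> f g u \<and> time_periodic \<omega> u"
proof -
  obtain a C where a: "0 < a" and C: "\<And>p q. p \<in> UNIV \<times> {0..1} \<Longrightarrow> q \<in> UNIV \<times> {0..1} \<Longrightarrow>
      dist ((\<lambda>(t, x). g t x) p) ((\<lambda>(t, x). g t x) q) \<le> C * dist p q powr a"
    using hg unfolding hoelder_continuous_on_def by blast
  define B where "B = (\<Sum>k\<in>UNIV. \<beta> k)"
  have B: "B \<ge> 0" unfolding B_def using \<beta> by (intro sum_nonneg) (auto intro: less_imp_le)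
  have eig0: "eig \<gamma> 0 = \<gamma> * pi ^ 4 + pi\<^sup>2 - 1" by (simp add: eig_def)
  have cg: "continuous_on (UNIV \<times> {0..1}) (\<lambda>(t, x). g t x)"
    unfolding continuous_on_def
  proof
    fix p :: "real \<times> real" assume p: "p \<in> UNIV \<times> {0..1}"
    let ?F = "at p within UNIV \<times> {0..1}"
    have "((\<lambda>q. dist q p powr a) \<longlongrightarrow> 0 powr a) ?F"
      by (intro tendsto_powr' tendsto_const) (use a in \<open>auto intro!: tendsto_eq_intros\<close>)
    from tendsto_mult_left[OF this, of C] have lim: "((\<lambda>q. C * dist q p powr a) \<longlongrightarrow> 0) ?F" by simp
    have "((\<lambda>q. dist ((\<lambda>(t, x). g t x) q) ((\<lambda>(t, x). g t x) p)) \<longlongrightarrow> 0) ?F"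
      by (rule Lim_null_comparison[OF _ lim]) (use C p in \<open>auto simp: eventually_at_filter\<close>)
    then show "((\<lambda>(t, x). g t x) \<longlongrightarrow> (\<lambda>(t, x). g t x) p) ?F" by (rule iffD2[OF tendsto_dist_iff])
  qed
  define \<Phi> where "\<Phi> u t x = g t x + f (\<chi> k. u (t - \<tau> k) x)" for u :: "real \<Rightarrow> real \<Rightarrow> real" and t x
  have adm: "admissible \<omega> (\<Phi> u)" if u: "admissible \<omega> u" for u
    unfolding admissible_def
  proof
    have "continuous_on (UNIV \<times> {0..1}) (\<lambda>p. (\<lambda>(t, x). u t x) (fst p - \<tau> k, snd p))" for k
      by (rule continuous_on_compose2[of "UNIV \<times> {0..1}"])
        (use u in \<open>auto simp: admissible_def intro!: continuous_intros\<close>)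
    then have "continuous_on (UNIV \<times> {0..1}) (\<lambda>p. \<chi> k. u (fst p - \<tau> k) (snd p))"
      by (intro continuous_on_vec_lambda) simp
    from continuous_on_compose2[OF continuous_reaction this]
    have "continuous_on (UNIV \<times> {0..1}) (\<lambda>p. f (\<chi> k. u (fst p - \<tau> k) (snd p)))" by simp
    from continuous_on_add[OF cg this]
    show "continuous_on (UNIV \<times> {0..1}) (\<lambda>(t, x). \<Phi> u t x)" by (simp add: \<Phi>_def case_prod_unfold)
    show "time_periodic \<omega> (\<Phi> u)"
      unfolding time_periodic_def
    proof (intro allI ballI)
      fix t x :: real assume x: "x \<in> {0..1}"
      have "u (t + \<omega> - \<tau> k) x = u (t - \<tau> k) x" for k
      proof -
        have "u (t - \<tau> k + \<omega>) x = u (t - \<tau> k) x" using u x by (simp add: admissible_def time_periodic_def)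
        then show ?thesis by (simp add: algebra_simps)
      qed
      then show "\<Phi> u (t + \<omega>) x = \<Phi> u t x" using pg x by (simp add: \<Phi>_def time_periodic_def)
    qed
  qed
  have diff: "\<bar>\<Phi> u t x - \<Phi> v t x\<bar> \<le> (\<Sum>k\<in>UNIV. \<beta> k * \<bar>u (t - \<tau> k) x - v (t - \<tau> k) x\<bar>)" for u v t x
    using lip[of "\<chi> k. u (t - \<tau> k) x" "\<chi> k. v (t - \<tau> k) x"] by (simp add: \<Phi>_def)
  have sup: "\<bar>\<Phi> u t x - \<Phi> v t x\<bar> \<le> B * \<delta>" if "\<And>t x. x \<in> {0..1} \<Longrightarrow> \<bar>u t x - v t x\<bar> \<le> \<delta>" "x \<in> {0..1}" for u v \<delta> t x
  proof -
    have "(\<Sum>k\<in>UNIV. \<beta> k * \<bar>u (t - \<tau> k) x - v (t - \<tau> k) x\<bar>) \<le> (\<Sum>k\<in>UNIV. \<beta> k * \<delta>)"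
      using that \<beta> by (intro sum_mono mult_left_mono) (auto intro: less_imp_le)
    then show ?thesis using diff[of u t x v] by (simp add: B_def sum_distrib_right)
  qed
  have L2: "integral {0..1} (\<lambda>x. (\<Phi> u t x - \<Phi> v t x)\<^sup>2) \<le> B\<^sup>2 * Q"
    if u: "admissible \<omega> u" and v: "admissible \<omega> v" and Q: "\<And>t. L2_dist_sq u v t \<le> Q" for u v Q t
  proof -
    have int: "((\<lambda>x. (u s x - v s x)\<^sup>2) has_integral L2_dist_sq u v s) {0..1}" for s
      by (intro integrable_integral integrable_continuous_real continuous_intros admissible_continuous_x[OF u] admissible_continuous_x[OF v])
    have "integral {0..1} (\<lambda>x. (\<Phi> u t x - \<Phi> v t x)\<^sup>2)
      \<le> B * (\<Sum>k\<in>UNIV. \<beta> k * L2_dist_sq u v (t - \<tau> k))"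
    proof (rule has_integral_le)
      show "((\<lambda>x. (\<Phi> u t x - \<Phi> v t x)\<^sup>2) has_integral integral {0..1} (\<lambda>x. (\<Phi> u t x - \<Phi> v t x)\<^sup>2)) {0..1}"
        by (intro integrable_integral integrable_continuous_real continuous_intros
            admissible_continuous_x[OF adm[OF u]] admissible_continuous_x[OF adm[OF v]])
      show "((\<lambda>x. B * (\<Sum>k\<in>UNIV. \<beta> k * (u (t - \<tau> k) x - v (t - \<tau> k) x)\<^sup>2)) has_integral
        B * (\<Sum>k\<in>UNIV. \<beta> k * L2_dist_sq u v (t - \<tau> k))) {0..1}"
        by (intro has_integral_mult_right has_integral_sum int) simp
      fix x
      let ?d = "\<lambda>k. \<bar>u (t - \<tau> k) x - v (t - \<tau> k) x\<bar>"
      have "\<bar>\<Phi> u t x - \<Phi> v t x\<bar>\<^sup>2 \<le> (\<Sum>k\<in>UNIV. \<beta> k * ?d k)\<^sup>2"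
        by (intro power_mono diff) simp
      also have "(\<Sum>k\<in>UNIV. \<beta> k * ?d k) = (\<Sum>k\<in>UNIV. sqrt (\<beta> k) * (sqrt (\<beta> k) * ?d k))"
        using \<beta> by (intro sum.cong) (simp_all add: abs_of_pos flip: mult.assoc)
      also have "\<dots>\<^sup>2 \<le> (\<Sum>k\<in>UNIV. (sqrt (\<beta> k))\<^sup>2) * (\<Sum>k\<in>UNIV. (sqrt (\<beta> k) * ?d k)\<^sup>2)"
        by (rule Cauchy_Schwarz_ineq_sum)
      also have "\<dots> = B * (\<Sum>k\<in>UNIV. \<beta> k * (u (t - \<tau> k) x - v (t - \<tau> k) x)\<^sup>2)"
        using \<beta> by (simp add: B_def power_mult_distrib less_imp_le)
      finally show "(\<Phi> u t x - \<Phi> v t x)\<^sup>2 \<le> B * (\<Sum>k\<in>UNIV. \<beta> k * (u (t - \<tau> k) x - v (t - \<tau> k) x)\<^sup>2)" by simp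
    qed
    also have "\<dots> \<le> B * (\<Sum>k\<in>UNIV. \<beta> k * Q)"
      using B \<beta> Q by (intro mult_left_mono sum_mono) (auto intro: less_imp_le)
    also have "(\<Sum>k\<in>UNIV. \<beta> k * Q) = B * Q" by (simp add: B_def sum_distrib_right)
    also have "B * (B * Q) = B\<^sup>2 * Q" by (simp add: power2_eq_square)
    finally show ?thesis .
  qed
  have "B < eig \<gamma> 0" using small by (simp add: eig0 B_def)
  then have "\<exists>u. admissible \<omega> u \<and> (\<forall>t. \<forall>x\<in>{0..1}. u t x = sol \<gamma> \<omega> (\<Phi> u) t x)"
    by (intro sol_fixed_point[where B=B] \<gamma> \<omega> adm B L2 sup)
  then obtain u where u: "admissible \<omega> u"
    and fix_u: "\<And>t x. x \<in> {0..1} \<Longrightarrow> u t x = sol \<gamma> \<omega> (\<Phi> u) t x" by blast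
  define F where "F = \<Phi> u"
  have F: "admissible \<omega> F" unfolding F_def by (rule adm[OF u])
  obtain M where M: "M > 0" "\<And>t x. x \<in> {0..1} \<Longrightarrow> \<bar>F t x\<bar> \<le> M" using admissible_bounded[OF \<omega> F] by blast
  define K where "K = 4 * M * (\<Sum>k. 1 / sqrt (eig \<gamma> k))"
  have K: "K \<ge> 0" unfolding K_def using M eig_pos[OF \<gamma>]
    by (intro mult_nonneg_nonneg suminf_nonneg summable_inverse_sqrt_eig \<gamma>) (auto intro: less_imp_le)
  have u_hoelder: "\<bar>u t x - u s x\<bar> \<le> K * sqrt \<bar>t - s\<bar>" if "x \<in> {0..1}" for t s x
    using sol_hoelder_half[OF \<gamma> \<omega> F M(2), of t x s] fix_u[OF that] unfolding F_def K_def by simp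
  \<comment> \<open>Less than 1, as the estimates of the time derivative require.\<close>
  define \<alpha> where "\<alpha> = min a (1/2)"
  have \<alpha>: "0 < \<alpha>" "\<alpha> < 1" "\<alpha> \<le> a" "\<alpha> \<le> 1/2" using a by (auto simp: \<alpha>_def)
  define L where "L = \<bar>C\<bar> + B * K + 2 * M"
  have L: "L \<ge> 0" using B K M by (simp add: L_def)
  have hoelder: "\<bar>F t x - F s x\<bar> \<le> L * \<bar>t - s\<bar> powr \<alpha>" if x: "x \<in> {0..1}" for t s x
  proof (cases "\<bar>t - s\<bar> \<le> 1")
    case True
    define h where "h = \<bar>t - s\<bar>"
    have h: "0 \<le> h" "h \<le> 1" using True by (simp_all add: h_def)
    have pw: "h powr b \<le> h powr \<alpha>" if "\<alpha> \<le> b" for b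
      using h that by (cases "h = 0") (auto intro: powr_mono')
    have "\<bar>g t x - g s x\<bar> \<le> C * dist (t, x) (s, x) powr a"
      using C[of "(t, x)" "(s, x)"] x by (simp add: dist_real_def)
    also have "dist (t, x) (s, x) = h" by (simp add: dist_Pair_Pair dist_real_def h_def)
    also have "C * h powr a \<le> \<bar>C\<bar> * h powr \<alpha>"
      using pw[OF \<alpha>(3)] by (intro mult_mono) auto
    finally have 1: "\<bar>g t x - g s x\<bar> \<le> \<bar>C\<bar> * h powr \<alpha>" .
    have "\<bar>f (\<chi> k. u (t - \<tau> k) x) - f (\<chi> k. u (s - \<tau> k) x)\<bar> \<le> (\<Sum>k\<in>UNIV. \<beta> k * \<bar>u (t - \<tau> k) x - u (s - \<tau> k) x\<bar>)"
      using lip[of "\<chi> k. u (t - \<tau> k) x" "\<chi> k. u (s - \<tau> k) x"] by simp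
    also have "\<dots> \<le> (\<Sum>k\<in>UNIV. \<beta> k * (K * h powr \<alpha>))"
    proof (intro sum_mono mult_left_mono)
      fix k
      have "\<bar>u (t - \<tau> k) x - u (s - \<tau> k) x\<bar> \<le> K * sqrt h" using u_hoelder[OF x, of "t - \<tau> k" "s - \<tau> k"] by (simp add: h_def)
      also have "sqrt h \<le> h powr \<alpha>" using pw[OF \<alpha>(4)] h by (simp add: powr_half_sqrt)
      finally show "\<bar>u (t - \<tau> k) x - u (s - \<tau> k) x\<bar> \<le> K * h powr \<alpha>" using K by (simp add: mult_left_mono)
    qed (use \<beta> in \<open>auto intro: less_imp_le\<close>)
    also have "\<dots> = B * K * h powr \<alpha>" by (simp add: B_def sum_distrib_right mult.assoc)
    finally have "\<bar>F t x - F s x\<bar> \<le> \<bar>C\<bar> * h powr \<alpha> + B * K * h powr \<alpha>" using 1 by (simp add: F_def \<Phi>_def)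
    also have "\<dots> \<le> L * h powr \<alpha>" using M by (simp add: L_def algebra_simps)
    finally show ?thesis by (simp add: h_def)
  next
    case False
    have "\<bar>F t x - F s x\<bar> \<le> 2 * M" using M(2)[OF x, of t] M(2)[OF x, of s] by linarith
    also have "\<dots> \<le> L * 1" using B K by (simp add: L_def)
    also have "\<dots> \<le> L * \<bar>t - s\<bar> powr \<alpha>" using L False \<alpha> by (intro mult_left_mono ge_one_powr_ge_zero) auto
    finally show ?thesis .
  qed
  have "efk_classical_solution UNIV \<gamma> \<tau> f g (sol \<gamma> \<omega> F)"
  proof (rule sol_is_classical[OF \<gamma> \<omega> F M(2) \<alpha>(1,2) L hoelder])
    fix t x :: real assume "x \<in> {0..1}"
    then show "F t x = g t x + f (\<chi> k. sol \<gamma> \<omega> F (t - \<tau> k) x)"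
      using fix_u by (simp add: F_def \<Phi>_def)
  qed
  moreover have "time_periodic \<omega> (sol \<gamma> \<omega> F)"
    using admissible_sol(2)[OF \<gamma> \<omega> F] by (simp add: admissible_def)
  ultimately show ?thesis by blast
qed

end

theorem theorem1p3:
  fixes \<gamma> \<omega> :: real
    and \<tau> \<beta> :: "'n::finite \<Rightarrow> real"
    and f :: "real ^ 'n \<Rightarrow> real"
    and g :: "real \<Rightarrow> real \<Rightarrow> real"
  assumes "\<gamma> > 0" and "\<omega> > 0" and "\<And>k. \<tau> k > 0"
    and "locally_lipschitz f"
    and "hoelder_continuous_on (UNIV \<times> {0..1}) (\<lambda>(t, x). g t x)"
    and "time_periodic \<omega> g"
    and "\<And>k. \<beta> k > 0"
    and "\<And>\<xi> \<eta>. \<bar>f \<xi> - f \<eta>\<bar> \<le> (\<Sum>k\<in>UNIV. \<beta> k * \<bar>\<xi> $ k - \<eta> $ k\<bar>)"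
    and "(\<Sum>k\<in>UNIV. \<beta> k * exp ((\<gamma> * pi ^ 4 + pi ^ 2 - 1) * \<tau> k)) < \<gamma> * pi ^ 4 + pi ^ 2 - 1"
  shows "\<exists>ubar.
    efk_classical_solution UNIV \<gamma> \<tau> f g ubar \<and> time_periodic \<omega> ubar \<and>
    (\<forall>v. efk_classical_solution UNIV \<gamma> \<tau> f g v \<and> time_periodic \<omega> v \<longrightarrow>
         (\<forall>t. \<forall>x\<in>{0..1}. v t x = ubar t x)) \<and>
    globally_asymptotically_stable \<gamma> \<tau> f g ubar"
proof -
  have "eig \<gamma> 0 = \<gamma> * pi ^ 4 + pi\<^sup>2 - 1" by (simp add: eig_def)
  then have pos: "\<gamma> * pi ^ 4 + pi\<^sup>2 - 1 > 0" using eig_pos[OF assms(1), of 0] by simp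
  have "\<beta> k * 1 \<le> \<beta> k * exp ((\<gamma> * pi ^ 4 + pi\<^sup>2 - 1) * \<tau> k)" for k
    using assms(3)[of k] assms(7)[of k] pos by (intro mult_left_mono) auto
  then have "(\<Sum>k\<in>UNIV. \<beta> k) \<le> (\<Sum>k\<in>UNIV. \<beta> k * exp ((\<gamma> * pi ^ 4 + pi\<^sup>2 - 1) * \<tau> k))"
    by (intro sum_mono) simp
  then have small: "(\<Sum>k\<in>UNIV. \<beta> k) < \<gamma> * pi ^ 4 + pi\<^sup>2 - 1" using assms(9) by linarith
  note hyps = assms(1,3,7,8) small
  obtain ubar where ubar: "efk_classical_solution UNIV \<gamma> \<tau> f g ubar" "time_periodic \<omega> ubar"
    using periodic_solution_exists[where \<tau>=\<tau>, OF hyps assms(2,5,6)] by blast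
  have "v t x = ubar t x" if "efk_classical_solution UNIV \<gamma> \<tau> f g v \<and> time_periodic \<omega> v" "x \<in> {0..1}" for v t x
    using periodic_solution_unique[where \<tau>=\<tau>, OF hyps assms(2) ubar] that by blast
  with ubar classical_solution_stable[where \<tau>=\<tau>, OF hyps ubar(1)] show ?thesis by blast
qed

end
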